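(* Let $n\ge 1$, $p\ge 1$, $t_0<t_1$, $x_0<x_1$, $G=(t_0,t_1)\times(x_0,x_1)$, and let $\alpha_{k,j},\beta_{k,j}$ ($k,j=1,2,3$) be given constant real $n\times n$ matrices. Put $\Delta=x_1-x_0$ and, for $k=1,2,3$, $$\gamma_{k,1}=\alpha_{k,1}+\beta_{k,1},\quad \gamma_{k,2}=\alpha_{k,2}+\Delta\beta_{k,1}+\beta_{k,2},\quad \gamma_{k,3}=\alpha_{k,3}+\tfrac{\Delta^2}{2!}\beta_{k,1}+\Delta\beta_{k,2}+\beta_{k,3},$$ and let $\gamma$ be the $3n\times 3n$ block matrix $$\gamma=\begin{pmatrix}\gamma_{1,1}&\gamma_{2,1}&\gamma_{3,1}\\ \gamma_{1,2}&\gamma_{2,2}&\gamma_{3,2}\\ \gamma_{1,3}&\gamma_{2,3}&\gamma_{3,3}\end{pmatrix}.$$ Suppose $\det\gamma\neq 0$ and write $\gamma^{-1}=(K_{i,j})_{i,j=1}^3$ with $n\times n$ blocks $K_{i,j}$ ($K_{i,j}$ in block row $i$, block column $j$). For $k=1,2,3$ define the matrix functions $$a_k(x)=\beta_{k,1}\tfrac{(x_1-x)^2}{2!}+\beta_{k,2}(x_1-x)+\beta_{k,3},\qquad \beta_k(x)=K_{k,1}+K_{k,2}(x-x_0)+K_{k,3}\tfrac{(x-x_0)^2}{2!},\qquad q_k(x)=-\beta_k(x),$$ and $$R_0(\tau,\xi;t,x)=\theta(t-\tau)\Big[\tfrac{(x-\xi)^2}{2!}\theta(x-\xi)E+a_1(\xi)q_1(x)+a_2(\xi)q_2(x)+a_3(\xi)q_3(x)\Big],$$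 where $\theta$ is the Heaviside function on $\mathbb{R}$ and $E$ is the $n\times n$ identity matrix. For a function $u$ in $W^{(1,3)}_{p,n}(G)$ define $$(l_0u)(x)=u(t_0,x),$$ $$(l_ku)(t)=u_t(t,x_0)\alpha_{k,1}+u_{tx}(t,x_0)\alpha_{k,2}+u_{txx}(t,x_0)\alpha_{k,3}+u_t(t,x_1)\beta_{k,1}+u_{tx}(t,x_1)\beta_{k,2}+u_{txx}(t,x_1)\beta_{k,3},\quad k=1,2,3.$$ Then every $u\in W^{(1,3)}_{p,n}(G)$ admits the representation $$u(t,x)=(l_0u)(x)+\sum_{k=1}^{3}\int_{t_0}^{t}(l_ku)(\tau)\,\beta_k(x)\,d\tau+\iint_G u_{txxx}(\tau,\xi)\,R_0(\tau,\xi;t,x)\,d\tau\,d\xi,\qquad (t,x)\in G.$$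
   Context: Vector functions are $n$-dimensional row vectors and are multiplied by $n\times n$ matrices on the right. $L_{p,n}(G)$ is the space of row vectors $u=(u_1,\dots,u_n)$ with $u_i\in L_p(G)$. $W^{(1,3)}_{p,n}(G)=\{u\in L_{p,n}(G):\ D_t^iD_x^ju\in L_{p,n}(G),\ i=0,1,\ j=0,1,2,3\}$, derivatives understood in the Sobolev (weak) sense; $u_t,u_{tx},u_{txx},u_{txxx}$ denote $D_tu,D_tD_xu,D_tD_x^2u,D_tD_x^3u$, and $u(t_0,x)$, $u_t(t,x_0)$, $u_{tx}(t,x_0)$, $u_{txx}(t,x_0)$, $u_t(t,x_1)$, etc. denote the corresponding traces of $u$ and its derivatives on the lines $t=t_0$, $x=x_0$, $x=x_1$. *)

theory Defs
  imports "HOL-Analysis.Analysis"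
begin

datatype blk = B1 | B2 | B3

lemma UNIV_blk: "(UNIV :: blk set) = {B1, B2, B3}"
  using blk.exhaust by auto

instance blk :: finite
  by standard (simp add: UNIV_blk)

fun bnat :: "blk \<Rightarrow> nat" where
  "bnat B1 = 1" | "bnat B2 = 2" | "bnat B3 = 3"

fun bidx :: "nat \<Rightarrow> blk" where
  "bidx (Suc 0) = B1" | "bidx (Suc (Suc 0)) = B2" | "bidx _ = B3"

definition blkmat :: "(nat \<Rightarrow> nat \<Rightarrow> real^'n^'n) \<Rightarrow> real^('n \<times> blk)^('n \<times> blk)" where
  "blkmat M = (\<chi> r c. M (bnat (snd r)) (bnat (snd c)) $ fst r $ fst c)"

definition blk_of :: "real^('n \<times> blk)^('n \<times> blk) \<Rightarrow> nat \<Rightarrow> nat \<Rightarrow> real^'n^'n" where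
  "blk_of A i j = (\<chi> a b. A $ (a, bidx i) $ (b, bidx j))"

definition gam :: "real \<Rightarrow> real \<Rightarrow> (nat \<Rightarrow> nat \<Rightarrow> real^'n^'n) \<Rightarrow> (nat \<Rightarrow> nat \<Rightarrow> real^'n^'n)
    \<Rightarrow> nat \<Rightarrow> nat \<Rightarrow> real^'n^'n" where
  "gam x0 x1 \<alpha> \<beta> k j =
     (let \<Delta> = x1 - x0 in
      if j = 1 then \<alpha> k 1 + \<beta> k 1
      else if j = 2 then \<alpha> k 2 + \<Delta> *\<^sub>R \<beta> k 1 + \<beta> k 2
      else \<alpha> k 3 + (\<Delta>\<^sup>2 / fact 2) *\<^sub>R \<beta> k 1 + \<Delta> *\<^sub>R \<beta> k 2 + \<beta> k 3)"

definition gamma_mat :: "real \<Rightarrow> real \<Rightarrow> (nat \<Rightarrow> nat \<Rightarrow> real^'n^'n) \<Rightarrow> (nat \<Rightarrow> nat \<Rightarrow> real^'n^'n)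
    \<Rightarrow> real^('n \<times> blk)^('n \<times> blk)" where
  "gamma_mat x0 x1 \<alpha> \<beta> = blkmat (\<lambda>i j. gam x0 x1 \<alpha> \<beta> j i)"

definition Kblk :: "real \<Rightarrow> real \<Rightarrow> (nat \<Rightarrow> nat \<Rightarrow> real^'n^'n) \<Rightarrow> (nat \<Rightarrow> nat \<Rightarrow> real^'n^'n)
    \<Rightarrow> nat \<Rightarrow> nat \<Rightarrow> real^'n^'n" where
  "Kblk x0 x1 \<alpha> \<beta> i j = blk_of (matrix_inv (gamma_mat x0 x1 \<alpha> \<beta>)) i j"

definition a_fun :: "real \<Rightarrow> (nat \<Rightarrow> nat \<Rightarrow> real^'n^'n) \<Rightarrow> nat \<Rightarrow> real \<Rightarrow> real^'n^'n" where
  "a_fun x1 \<beta> k x = ((x1 - x)\<^sup>2 / fact 2) *\<^sub>R \<beta> k 1 + (x1 - x) *\<^sub>R \<beta> k 2 + \<beta> k 3"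

definition beta_fun :: "real \<Rightarrow> real \<Rightarrow> (nat \<Rightarrow> nat \<Rightarrow> real^'n^'n) \<Rightarrow> (nat \<Rightarrow> nat \<Rightarrow> real^'n^'n)
    \<Rightarrow> nat \<Rightarrow> real \<Rightarrow> real^'n^'n" where
  "beta_fun x0 x1 \<alpha> \<beta> k x =
     Kblk x0 x1 \<alpha> \<beta> k 1 + (x - x0) *\<^sub>R Kblk x0 x1 \<alpha> \<beta> k 2
       + ((x - x0)\<^sup>2 / fact 2) *\<^sub>R Kblk x0 x1 \<alpha> \<beta> k 3"

definition q_fun :: "real \<Rightarrow> real \<Rightarrow> (nat \<Rightarrow> nat \<Rightarrow> real^'n^'n) \<Rightarrow> (nat \<Rightarrow> nat \<Rightarrow> real^'n^'n)
    \<Rightarrow> nat \<Rightarrow> real \<Rightarrow> real^'n^'n" where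
  "q_fun x0 x1 \<alpha> \<beta> k x = - beta_fun x0 x1 \<alpha> \<beta> k x"

text \<open>Heaviside function (the value at 0 is immaterial).\<close>
definition heaviside :: "real \<Rightarrow> real" where
  "heaviside s = (if s \<ge> 0 then 1 else 0)"

definition R0 :: "real \<Rightarrow> real \<Rightarrow> (nat \<Rightarrow> nat \<Rightarrow> real^'n^'n) \<Rightarrow> (nat \<Rightarrow> nat \<Rightarrow> real^'n^'n)
    \<Rightarrow> real \<times> real \<Rightarrow> real \<times> real \<Rightarrow> real^'n^'n" where
  "R0 x0 x1 \<alpha> \<beta> w z =
     (let \<tau> = fst w; \<xi> = snd w; t = fst z; x = snd z in
      heaviside (t - \<tau>) *\<^sub>R
        (((x - \<xi>)\<^sup>2 / fact 2 * heaviside (x - \<xi>)) *\<^sub>R mat 1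
         + (\<Sum>k\<in>{1,2,3}. a_fun x1 \<beta> k \<xi> ** q_fun x0 x1 \<alpha> \<beta> k x)))"

definition Lp_on :: "real \<Rightarrow> 'a::euclidean_space set \<Rightarrow> ('a \<Rightarrow> real) \<Rightarrow> bool" where
  "Lp_on p A f \<longleftrightarrow> f \<in> borel_measurable (lebesgue_on A)
      \<and> (\<integral>\<^sup>+ z\<in>A. ennreal (\<bar>f z\<bar> powr p) \<partial>lebesgue) < \<infinity>"

definition Lpn_on :: "real \<Rightarrow> 'a::euclidean_space set \<Rightarrow> ('a \<Rightarrow> real^'n) \<Rightarrow> bool" where
  "Lpn_on p A u \<longleftrightarrow> (\<forall>i. Lp_on p A (\<lambda>z. u z $ i))"

definition pt :: "(real \<times> real \<Rightarrow> real) \<Rightarrow> real \<times> real \<Rightarrow> real" where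
  "pt \<phi> z = deriv (\<lambda>s. \<phi> (s, snd z)) (fst z)"

definition px :: "(real \<times> real \<Rightarrow> real) \<Rightarrow> real \<times> real \<Rightarrow> real" where
  "px \<phi> z = deriv (\<lambda>y. \<phi> (fst z, y)) (snd z)"

definition pd :: "nat \<Rightarrow> nat \<Rightarrow> (real \<times> real \<Rightarrow> real) \<Rightarrow> real \<times> real \<Rightarrow> real" where
  "pd i j \<phi> = (pt ^^ i) ((px ^^ j) \<phi>)"

definition smooth2 :: "(real \<times> real \<Rightarrow> real) \<Rightarrow> bool" where
  "smooth2 \<phi> \<longleftrightarrow> (\<forall>i j. continuous_on UNIV (pd i j \<phi>)
      \<and> (\<forall>z. ((\<lambda>s. pd i j \<phi> (s, snd z)) has_real_derivative pd (Suc i) j \<phi> z) (at (fst z))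
           \<and> ((\<lambda>y. pd i j \<phi> (fst z, y)) has_real_derivative pd i (Suc j) \<phi> z) (at (snd z))))"

definition test_fun :: "(real \<times> real) set \<Rightarrow> (real \<times> real \<Rightarrow> real) \<Rightarrow> bool" where
  "test_fun G \<phi> \<longleftrightarrow> smooth2 \<phi> \<and> compact (closure {z. \<phi> z \<noteq> 0})
      \<and> closure {z. \<phi> z \<noteq> 0} \<subseteq> G"

definition is_weak_deriv :: "(real \<times> real) set \<Rightarrow> nat \<Rightarrow> nat \<Rightarrow> (real \<times> real \<Rightarrow> real^'n)
    \<Rightarrow> (real \<times> real \<Rightarrow> real^'n) \<Rightarrow> bool" where
  "is_weak_deriv G i j u v \<longleftrightarrow>
     (\<forall>\<phi>. test_fun G \<phi> \<longrightarrow>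
        (LINT z:G|lebesgue. pd i j \<phi> z *\<^sub>R u z) = ((-1::real) ^ (i + j)) *\<^sub>R (LINT z:G|lebesgue. \<phi> z *\<^sub>R v z))"

definition rect :: "real \<Rightarrow> real \<Rightarrow> real \<Rightarrow> real \<Rightarrow> (real \<times> real) set" where
  "rect t0 t1 x0 x1 = {t0<..<t1} \<times> {x0<..<x1}"

definition W13 :: "real \<Rightarrow> (real \<times> real) set \<Rightarrow> (real \<times> real \<Rightarrow> real^'n) set" where
  "W13 p G = {u. Lpn_on p G u \<and>
     (\<forall>i\<le>1. \<forall>j\<le>3. \<exists>v. is_weak_deriv G i j u v \<and> Lpn_on p G v)}"

definition wd :: "real \<Rightarrow> (real \<times> real) set \<Rightarrow> nat \<Rightarrow> nat \<Rightarrow> (real \<times> real \<Rightarrow> real^'n)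
    \<Rightarrow> (real \<times> real \<Rightarrow> real^'n)" where
  "wd p G i j u = (SOME v. is_weak_deriv G i j u v \<and> Lpn_on p G v)"

definition is_trace_t :: "real \<Rightarrow> real \<Rightarrow> real \<Rightarrow> real \<Rightarrow> real \<Rightarrow> real
    \<Rightarrow> (real \<times> real \<Rightarrow> real^'n) \<Rightarrow> (real \<Rightarrow> real^'n) \<Rightarrow> bool" where
  "is_trace_t p t0 t1 x0 x1 a w g \<longleftrightarrow>
     Lpn_on p {x0<..<x1} g \<and>
     (\<forall>\<epsilon>>0. \<exists>\<delta>>0. AE t in lebesgue. t \<in> {t0<..<t1} \<and> \<bar>t - a\<bar> < \<delta> \<longrightarrow>
        (\<integral>\<^sup>+ x\<in>{x0<..<x1}. ennreal (norm (w (t, x) - g x) powr p) \<partial>lebesgue) < ennreal \<epsilon>)"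

definition is_trace_x :: "real \<Rightarrow> real \<Rightarrow> real \<Rightarrow> real \<Rightarrow> real \<Rightarrow> real
    \<Rightarrow> (real \<times> real \<Rightarrow> real^'n) \<Rightarrow> (real \<Rightarrow> real^'n) \<Rightarrow> bool" where
  "is_trace_x p t0 t1 x0 x1 a w h \<longleftrightarrow>
     Lpn_on p {t0<..<t1} h \<and>
     (\<forall>\<epsilon>>0. \<exists>\<delta>>0. AE x in lebesgue. x \<in> {x0<..<x1} \<and> \<bar>x - a\<bar> < \<delta> \<longrightarrow>
        (\<integral>\<^sup>+ t\<in>{t0<..<t1}. ennreal (norm (w (t, x) - h t) powr p) \<partial>lebesgue) < ennreal \<epsilon>)"

definition trace_t where
  "trace_t p t0 t1 x0 x1 a w = (SOME g. is_trace_t p t0 t1 x0 x1 a w g)"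

definition trace_x where
  "trace_x p t0 t1 x0 x1 a w = (SOME h. is_trace_x p t0 t1 x0 x1 a w h)"

definition l0 :: "real \<Rightarrow> real \<Rightarrow> real \<Rightarrow> real \<Rightarrow> real \<Rightarrow> (real \<times> real \<Rightarrow> real^'n) \<Rightarrow> real \<Rightarrow> real^'n" where
  "l0 p t0 t1 x0 x1 u = trace_t p t0 t1 x0 x1 t0 u"

definition lk :: "real \<Rightarrow> real \<Rightarrow> real \<Rightarrow> real \<Rightarrow> real \<Rightarrow> (nat \<Rightarrow> nat \<Rightarrow> real^'n^'n)
    \<Rightarrow> (nat \<Rightarrow> nat \<Rightarrow> real^'n^'n) \<Rightarrow> nat \<Rightarrow> (real \<times> real \<Rightarrow> real^'n) \<Rightarrow> real \<Rightarrow> real^'n" where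
  "lk p t0 t1 x0 x1 \<alpha> \<beta> k u t =
     (let G = rect t0 t1 x0 x1; tr = (\<lambda>a j. trace_x p t0 t1 x0 x1 a (wd p G 1 j u) t) in
       tr x0 0 v* \<alpha> k 1 + tr x0 1 v* \<alpha> k 2 + tr x0 2 v* \<alpha> k 3
     + tr x1 0 v* \<beta> k 1 + tr x1 1 v* \<beta> k 2 + tr x1 2 v* \<beta> k 3)"

end

(* Idea. Put w_j = D_t D_x^j u. Testing the weak derivatives against tensor products psi(t) eta(x)
   of smooth cut-off functions shows that, almost everywhere,
     u(t,x) = g(x) + int_{t0}^t w_0(tau,x) dtau,
     w_j(t,x) = c_j(t) + int_{x0}^x w_{j+1}(t,xi) dxi   (j = 0,1,2).
   These primitives identify the traces: g is the trace of u on t = t0, c_j is that of w_j on x = x0,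
   and c_j + int_{x0}^{x1} w_{j+1} is that of w_j on x = x1. Iterating gives the Taylor expansion of
   w_0 in x with coefficients c_0, c_1, c_2 and remainder in w_3, so that
   l_k u = sum_j c_{j-1} gamma_{k,j} + int w_3 a_k. Multiplying by the inverse of gamma expresses the
   c_j through l_k u and w_3; substituting into the Taylor expansion and integrating over t gives
   the representation. *)
theory Submission
  imports Defs
begin

section \<open>Smooth cut-off functions\<close>

text \<open>\<open>wd\<close>, \<open>trace_t\<close> and \<open>trace_x\<close> are arbitrary
  choices, fixed only up to null sets, and a single slice of a Lebesgue measurable function need not
  be measurable. Each function is therefore replaced by a Borel representative vanishing outside the
  rectangle; the argument runs in \<open>lborel\<close> and returns to \<open>lebesgue\<close> at
  the end. Products of one-variable test functions suffice: each primitive undoes one derivative in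
  one variable, and the limits of such products, the indicators of boxes, already detect whether an
  integrable function vanishes. A test function is the derivative of a test function exactly when
  its integral is zero. The one missing direction in each slice is the constant of integration, a
  function of the other variable: this is the origin of c_j and g. The exponent is felt at the
  traces: on a bounded rectangle all functions are integrable, but a trace is a limit of slices in
  the p-th power mean, so Jensen's inequality on short intervals compares a slice with the
  primitive. The primitive and the trace in t come from those in x by exchanging
  coordinates.\<close>

primrec times_differentiable :: "nat \<Rightarrow> (real \<Rightarrow> real) \<Rightarrow> bool" where
  "times_differentiable 0 f = True"
| "times_differentiable (Suc n) f = (\<exists>f'. (\<forall>x. (f has_real_derivative f' x) (at x)) \<and> times_differentiable n f')"

lemma times_differentiable_Suc_D: "times_differentiable (Suc n) f \<Longrightarrow> times_differentiable n f"
  by (induction n arbitrary: f) (simp, metis times_differentiable.simps(2))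

lemma times_differentiable_const: "times_differentiable n (\<lambda>x. c)"
  by (induction n arbitrary: c) (auto intro!: exI[of _ "\<lambda>x. 0"] derivative_eq_intros)

lemma times_differentiable_add: "times_differentiable n f \<Longrightarrow> times_differentiable n g \<Longrightarrow> times_differentiable n (\<lambda>x. f x + g x)"
proof (induction n arbitrary: f g)
  case (Suc n)
  then obtain f' g' where "\<forall>x. (f has_real_derivative f' x) (at x)" "times_differentiable n f'"
    "\<forall>x. (g has_real_derivative g' x) (at x)" "times_differentiable n g'" by auto
  with Suc.IH[of f' g'] show ?case
    by (auto intro!: exI[of _ "\<lambda>x. f' x + g' x"] derivative_intros)
qed simp

lemma times_differentiable_mult: "times_differentiable n f \<Longrightarrow> times_differentiable n g \<Longrightarrow> times_differentiable n (\<lambda>x. f x * g x)"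
proof (induction n arbitrary: f g)
  case (Suc n)
  then obtain f' g' where *: "\<forall>x. (f has_real_derivative f' x) (at x)" "times_differentiable n f'"
    "\<forall>x. (g has_real_derivative g' x) (at x)" "times_differentiable n g'" by auto
  have "times_differentiable n (\<lambda>x. f' x * g x + f x * g' x)"
    using Suc * by (auto intro!: times_differentiable_add dest!: times_differentiable_Suc_D simp del: times_differentiable.simps)
  moreover have "((\<lambda>x. f x * g x) has_real_derivative f' x * g x + f x * g' x) (at x)" for x
    using * by (auto intro!: derivative_eq_intros)
  ultimately show ?case
    by (auto intro!: exI[of _ "\<lambda>x. f' x * g x + f x * g' x"])
qed simp

lemma times_differentiable_affine: "times_differentiable n f \<Longrightarrow> times_differentiable n (\<lambda>x. f (c * x + d))"
proof (induction n arbitrary: f)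
  case (Suc n)
  then obtain f' where *: "\<And>x. (f has_real_derivative f' x) (at x)" "times_differentiable n f'" by auto
  have "((\<lambda>x. f (c * x + d)) has_real_derivative f' (c * x + d) * c) (at x)" for x
    by (rule DERIV_chain2[OF *(1)]) (auto intro!: derivative_eq_intros)
  moreover have "times_differentiable n (\<lambda>x. f' (c * x + d) * c)"
    using Suc.IH[OF *(2)] by (intro times_differentiable_mult times_differentiable_const)
  ultimately show ?case
    unfolding times_differentiable.simps by (intro exI[of _ "\<lambda>x. f' (c * x + d) * c"]) blast
qed simp

definition smooth1 :: "(real \<Rightarrow> real) \<Rightarrow> bool" where
  "smooth1 f \<longleftrightarrow> (\<forall>n. times_differentiable n f)"

text \<open>Derivatives on the whole line are unique, so the witness hidden in
  \<open>times_differentiable\<close> is \<open>deriv f\<close> for every n at once. The existential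
  form keeps the closure lemmas above short inductions; this lemma returns from it to
  \<open>deriv\<close>.\<close>

lemma smooth1_deriv:
  assumes "smooth1 f"
  shows "(f has_real_derivative deriv f x) (at x)" and "smooth1 (deriv f)"
proof -
  have "\<exists>f'. (\<forall>x. (f has_real_derivative f' x) (at x)) \<and> times_differentiable n f'" for n
    using assms by (metis smooth1_def times_differentiable.simps(2))
  moreover have "f' = deriv f" if "\<forall>x. (f has_real_derivative f' x) (at x)" for f'
    using that by (intro ext) (metis DERIV_imp_deriv)
  ultimately have *: "(\<forall>x. (f has_real_derivative deriv f x) (at x)) \<and> times_differentiable n (deriv f)" for n
    by metis
  from * show "(f has_real_derivative deriv f x) (at x)" "smooth1 (deriv f)"
    by (auto simp: smooth1_def)
qed

lemma smooth1_continuous: "smooth1 f \<Longrightarrow> continuous_on S f"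
  by (meson smooth1_deriv(1) DERIV_isCont continuous_at_imp_continuous_on)

lemma smooth1I:
  assumes "\<And>x. (f has_real_derivative g x) (at x)" "smooth1 g"
  shows "smooth1 f"
  unfolding smooth1_def
proof
  fix n show "times_differentiable n f"
    using assms by (cases n) (auto simp: smooth1_def)
qed

lemma smooth1_const: "smooth1 (\<lambda>x. c)"
  and smooth1_add: "smooth1 f \<Longrightarrow> smooth1 g \<Longrightarrow> smooth1 (\<lambda>x. f x + g x)"
  and smooth1_mult: "smooth1 f \<Longrightarrow> smooth1 g \<Longrightarrow> smooth1 (\<lambda>x. f x * g x)"
  and smooth1_affine: "smooth1 f \<Longrightarrow> smooth1 (\<lambda>x. f (c * x + d))"
  by (simp_all add: smooth1_def times_differentiable_const times_differentiable_add times_differentiable_mult times_differentiable_affine)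

section \<open>A flat function and the cutoffs built from it\<close>

definition exp_flat :: "real poly \<Rightarrow> real \<Rightarrow> real" where
  "exp_flat q x = (if x > 0 then poly q (1 / x) * exp (- 1 / x) else 0)"

text \<open>With s = 1 / x this is the decay of a polynomial against \<open>exp (- s)\<close> at
  infinity, checked monomial by monomial.\<close>

lemma exp_flat_tendsto_0: "((\<lambda>x. poly q (1 / x) * exp (- 1 / x)) \<longlongrightarrow> 0) (at_right (0::real))"
proof -
  have "((\<lambda>s. \<Sum>i\<le>degree q. coeff q i * (s ^ i / exp s)) \<longlongrightarrow> (\<Sum>i\<le>degree q. coeff q i * 0)) at_top"
    by (intro tendsto_intros tendsto_power_div_exp_0)
  then have "((\<lambda>s. poly q s * exp (- s)) \<longlongrightarrow> 0) at_top"
    by (simp add: poly_altdef sum_distrib_right exp_minus divide_inverse mult.assoc)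
  moreover have "filterlim (\<lambda>x::real. 1 / x) at_top (at_right 0)"
    using filterlim_inverse_at_top_right by (simp add: inverse_eq_divide)
  ultimately have "((\<lambda>x. poly q (1 / x) * exp (- (1 / x))) \<longlongrightarrow> 0) (at_right (0::real))"
    by (rule filterlim_compose)
  then show ?thesis by simp
qed

text \<open>With \<open>s = 1/x\<close>: the derivative of \<open>q(s) e\<^sup>-\<^sup>s\<close> in \<open>x\<close> is \<open>s\<^sup>2 (q(s) - q'(s)) e\<^sup>-\<^sup>s\<close>,
  so this family of functions is closed under differentiation.\<close>
lemma exp_flat_deriv: "(exp_flat q has_real_derivative exp_flat ([:0, 0, 1:] * (q - pderiv q)) x) (at x)"
proof (cases x "0::real" rule: linorder_cases)
  case less
  have "((\<lambda>x. 0) has_real_derivative 0) (at x)" by simp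
  then have "(exp_flat q has_real_derivative 0) (at x)"
    by (rule has_field_derivative_transform_within_open[where S = "{..<0}"])
       (use less in \<open>auto simp: exp_flat_def\<close>)
  then show ?thesis using less by (simp add: exp_flat_def)
next
  case equal
  \<comment> \<open>Dividing by h multiplies the polynomial in 1 / h by one more factor 1 / h, so
    the right-hand quotient is covered by the limit for \<open>[:0, 1:] * q\<close>.\<close>
  have "((\<lambda>h. exp_flat q h / h) \<longlongrightarrow> 0) (at_right 0)"
  proof (rule Lim_transform_eventually[OF exp_flat_tendsto_0[of "[:0, 1:] * q"]])
    show "\<forall>\<^sub>F x in at_right 0. poly ([:0, 1:] * q) (1 / x) * exp (- 1 / x) = exp_flat q x / x"
      by (auto simp: eventually_at_filter exp_flat_def field_simps)
  qed
  moreover have "((\<lambda>h. exp_flat q h / h) \<longlongrightarrow> 0) (at_left 0)"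
    by (rule Lim_transform_eventually[OF tendsto_const])
       (auto simp: eventually_at_filter exp_flat_def)
  ultimately have "((\<lambda>h. exp_flat q h / h) \<longlongrightarrow> 0) (at 0)"
    using filterlim_split_at by blast
  then show ?thesis using equal by (simp add: DERIV_def exp_flat_def)
next
  case greater
  have "((\<lambda>x. poly q (1 / x) * exp (- 1 / x)) has_real_derivative
     poly ([:0, 0, 1:] * (q - pderiv q)) (1 / x) * exp (- 1 / x)) (at x)"
    using greater
    by (auto intro!: derivative_eq_intros poly_DERIV[THEN DERIV_chain2] simp: field_simps power2_eq_square)
  then have "(exp_flat q has_real_derivative poly ([:0, 0, 1:] * (q - pderiv q)) (1 / x) * exp (- 1 / x)) (at x)"
    by (rule has_field_derivative_transform_within_open[where S = "{0<..}"])
       (use greater in \<open>auto simp: exp_flat_def\<close>)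
  then show ?thesis using greater by (simp add: exp_flat_def)
qed

lemma smooth1_exp_flat: "smooth1 (exp_flat q)"
  unfolding smooth1_def
proof
  fix n show "times_differentiable n (exp_flat q)"
    by (induction n arbitrary: q) (use exp_flat_deriv in auto)
qed

text \<open>The shift by \<open>- 1\<close> makes the support a compact subset of the open interval.\<close>
definition cutoff :: "real \<Rightarrow> real \<Rightarrow> nat \<Rightarrow> real \<Rightarrow> real" where
  "cutoff a b n s = exp_flat 1 (real n * (s - a) - 1) * exp_flat 1 (real n * (b - s) - 1)"

lemma smooth1_cutoff: "smooth1 (cutoff a b n)"
proof -
  have "smooth1 (\<lambda>s. exp_flat 1 (real n * s + (- real n * a - 1)) * exp_flat 1 ((- real n) * s + (real n * b - 1)))"
    by (intro smooth1_mult smooth1_affine smooth1_exp_flat)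
  then show ?thesis
    by (simp add: cutoff_def[abs_def] algebra_simps)
qed

lemma cutoff_bounds: "0 \<le> cutoff a b n s" "cutoff a b n s \<le> 1"
  by (auto simp: cutoff_def exp_flat_def intro!: mult_le_one)

text \<open>Inside the interval both arguments of \<open>exp_flat 1\<close> grow to infinity, where
  it tends to 1; outside, one of them is negative for every n. With \<open>cutoff_bounds\<close>
  this lets dominated convergence turn test-function identities into integrals over boxes.\<close>

lemma cutoff_tendsto: "(\<lambda>n. cutoff a b n s) \<longlonglongrightarrow> indicator {a<..<b} s"
proof (cases "s \<in> {a<..<b}")
  case True
  have fl: "(exp_flat 1 \<longlongrightarrow> 1) at_top"
  proof (rule Lim_transform_eventually)
    show "((\<lambda>x::real. exp (- 1 / x)) \<longlongrightarrow> 1) at_top"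
      by (rule tendsto_eq_intros tendsto_divide_0[OF tendsto_const] filterlim_at_top_imp_at_infinity filterlim_ident | simp)+
    show "\<forall>\<^sub>F x in at_top. exp (- 1 / x) = exp_flat 1 x"
      using eventually_gt_at_top[of 0] by eventually_elim (simp add: exp_flat_def)
  qed
  have lin: "filterlim (\<lambda>n. real n * c - 1) at_top sequentially" if "c > 0" for c :: real
    using filterlim_tendsto_add_at_top[OF tendsto_const[of "-1"]
        filterlim_tendsto_pos_mult_at_top[OF tendsto_const that filterlim_real_sequentially]]
    by (simp add: mult.commute)
  have "(\<lambda>n. cutoff a b n s) \<longlonglongrightarrow> 1 * 1"
    unfolding cutoff_def using True
    by (intro tendsto_mult filterlim_compose[OF fl] lin) auto
  then show ?thesis using True by simp
next
  case False
  have "real n * (s - a) - 1 \<le> 0 \<or> real n * (b - s) - 1 \<le> 0" for n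
  proof (cases "s \<le> a")
    case True then have "real n * (s - a) \<le> 0" by (simp add: mult_nonneg_nonpos)
    then show ?thesis by simp
  next
    case 2: False then have "real n * (b - s) \<le> 0" using False by (simp add: mult_nonneg_nonpos)
    then show ?thesis by simp
  qed
  then have "cutoff a b n s = 0" for n
    unfolding cutoff_def exp_flat_def mult_eq_0_iff by (meson not_less)
  then show ?thesis using False by simp
qed

text \<open>Compact support in the open interval is expressed by a closed subinterval, which may be
  empty; the margins on both sides are what survives sums and derivatives.\<close>

definition test_fun1 :: "real \<Rightarrow> real \<Rightarrow> (real \<Rightarrow> real) \<Rightarrow> bool" where
  "test_fun1 a b \<eta> \<longleftrightarrow> smooth1 \<eta> \<and> (\<exists>a' b'. a < a' \<and> b' < b \<and> (\<forall>x. x \<notin> {a'..b'} \<longrightarrow> \<eta> x = 0))"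

lemma test_fun1_cutoff:
  assumes "a \<le> a'" "b' \<le> b" "n > 0"
  shows "test_fun1 a b (cutoff a' b' n)"
proof -
  \<comment> \<open>The margin 1 / n is the distance from an end at which the shifted argument
    \<open>n * (x - a') - 1\<close> or its mirror image becomes positive.\<close>
  have *: "cutoff a' b' n x = 0" if "x \<notin> {a' + 1 / n .. b' - 1 / n}" for x
  proof -
    have "real n * (x - a') - 1 \<le> 0 \<or> real n * (b' - x) - 1 \<le> 0"
      using that \<open>n > 0\<close> by (auto simp: field_simps)
    then show ?thesis
      unfolding cutoff_def exp_flat_def mult_eq_0_iff by (meson not_less)
  qed
  have "1 / real n > 0" using assms by simp
  with assms have "a < a' + 1 / n" "b' - 1 / n < b" by linarith+
  with * smooth1_cutoff show ?thesis unfolding test_fun1_def by blast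
qed

lemma test_fun1_deriv:
  assumes "test_fun1 a b \<eta>"
  shows "test_fun1 a b (deriv \<eta>)"
proof -
  from assms obtain a' b' where *: "smooth1 \<eta>" "a < a'" "b' < b" "\<And>x. x \<notin> {a'..b'} \<Longrightarrow> \<eta> x = 0"
    by (auto simp: test_fun1_def)
  have "deriv \<eta> x = 0" if "x \<notin> {a'..b'}" for x
  proof -
    have "((\<lambda>x. 0) has_real_derivative 0) (at x)" by simp
    then have "(\<eta> has_real_derivative 0) (at x)"
      by (rule has_field_derivative_transform_within_open[where S = "- {a'..b'}"])
         (use that * in auto)
    then show ?thesis by (rule DERIV_imp_deriv)
  qed
  with * smooth1_deriv(2) show ?thesis unfolding test_fun1_def by blast
qed

lemma test_fun1_props:
  assumes "test_fun1 a b \<eta>"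
  shows "smooth1 \<eta>" "x \<le> a \<Longrightarrow> \<eta> x = 0" "b \<le> x \<Longrightarrow> \<eta> x = 0"
    "\<eta> \<in> borel_measurable borel" "\<exists>B. \<forall>x. \<bar>\<eta> x\<bar> \<le> B"
proof -
  from assms obtain a' b' where *: "smooth1 \<eta>" "a < a'" "b' < b" "\<And>x. x \<notin> {a'..b'} \<Longrightarrow> \<eta> x = 0"
    by (auto simp: test_fun1_def)
  show "smooth1 \<eta>" by fact
  show "x \<le> a \<Longrightarrow> \<eta> x = 0" "b \<le> x \<Longrightarrow> \<eta> x = 0" using * by auto
  show "\<eta> \<in> borel_measurable borel"
    by (intro borel_measurable_continuous_onI smooth1_continuous *)
  have "compact (\<eta> ` {a'..b'})"
    by (intro compact_continuous_image smooth1_continuous * compact_Icc)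
  then obtain B where B: "\<And>x. x \<in> {a'..b'} \<Longrightarrow> \<bar>\<eta> x\<bar> \<le> B"
    by (metis compact_imp_bounded bounded_iff image_eqI real_norm_def)
  then have "\<bar>\<eta> x\<bar> \<le> max B 0" for x using * by (cases "x \<in> {a'..b'}") fastforce+
  then show "\<exists>B. \<forall>x. \<bar>\<eta> x\<bar> \<le> B" by blast
qed

section \<open>Lebesgue measure on products\<close>

lemma AE_lborel_pair:
  fixes Q :: "'a::euclidean_space \<times> 'b::euclidean_space \<Rightarrow> bool"
  assumes "AE z in lborel. Q z"
  shows "AE x in lborel. AE y in lborel. Q (x, y)"
  by (rule lborel_pair.AE_pair) (unfold lborel_prod, rule assms)

text \<open>Invariance under exchanging coordinates is the source of every statement about the
  second variable below, and later carries the results for x over to t.\<close>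

lemma distr_lborel_swap:
  "distr lborel lborel prod.swap = (lborel :: ('a::euclidean_space \<times> 'b::euclidean_space) measure)"
proof -
  have "distr (lborel \<Otimes>\<^sub>M lborel) (lborel \<Otimes>\<^sub>M lborel) (\<lambda>(x, y). (y, x)) =
      (lborel \<Otimes>\<^sub>M lborel :: ('a \<times> 'b) measure)"
    using lborel_pair.distr_pair_swap[where ?'a = 'a and ?'b = 'b] by simp
  then show ?thesis
    by (simp add: lborel_prod prod.swap_def[abs_def] case_prod_beta')
qed

lemma AE_lborel_swap:
  fixes Q :: "'a::euclidean_space \<times> 'b::euclidean_space \<Rightarrow> bool"
  assumes "AE z in lborel. Q z"
  shows "AE z in lborel. Q (prod.swap z)"
proof -
  have m: "prod.swap \<in> lborel \<rightarrow>\<^sub>M (lborel :: ('a \<times> 'b) measure)"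
    by (simp add: prod.swap_def[abs_def] borel_prod[symmetric] cong: measurable_cong_sets)
  from assms have "AE z in distr lborel lborel prod.swap. Q z"
    by (subst distr_lborel_swap)
  then show ?thesis by (rule AE_distrD[OF m])
qed

lemma AE_lborel_pair_snd:
  fixes Q :: "'a::euclidean_space \<times> 'b::euclidean_space \<Rightarrow> bool"
  assumes "AE z in lborel. Q z"
  shows "AE y in lborel. AE x in lborel. Q (x, y)"
  using AE_lborel_pair[OF AE_lborel_swap[OF assms]] by simp

lemma lborel_integrable_swap:
  fixes f :: "'a::euclidean_space \<times> 'b::euclidean_space \<Rightarrow> 'c::{banach, second_countable_topology}"
  assumes "integrable lborel f"
  shows "integrable lborel (\<lambda>z. f (prod.swap z))"
  using lborel_pair.integrable_product_swap[of f] assms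
  by (simp add: lborel_prod prod.swap_def case_prod_beta')

lemma lborel_integral_swap:
  fixes f :: "'a::euclidean_space \<times> 'b::euclidean_space \<Rightarrow> 'c::{banach, second_countable_topology}"
  assumes "f \<in> borel_measurable borel"
  shows "(\<integral>z. f (prod.swap z) \<partial>lborel) = (\<integral>z. f z \<partial>lborel)"
  using lborel_pair.integral_product_swap[of f] assms
  by (simp add: lborel_prod prod.swap_def case_prod_beta')

lemma
  fixes f :: "'a::euclidean_space \<times> 'b::euclidean_space \<Rightarrow> 'c::{banach, second_countable_topology}"
  assumes "integrable lborel f"
  shows lborel_AE_integrable_fst: "AE x in lborel. integrable lborel (\<lambda>y. f (x, y))"
    and lborel_integrable_fst: "integrable lborel (\<lambda>x. \<integral>y. f (x, y) \<partial>lborel)"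
    and lborel_integral_fst: "(\<integral>x. (\<integral>y. f (x, y) \<partial>lborel) \<partial>lborel) = integral\<^sup>L lborel f"
  using lborel_pair.AE_integrable_fst'[of f] lborel_pair.integrable_fst'[of f]
    lborel_pair.integral_fst'[of f] assms
  by (simp_all add: lborel_prod)

lemma
  fixes f :: "'a::euclidean_space \<times> 'b::euclidean_space \<Rightarrow> 'c::{banach, second_countable_topology}"
  assumes "integrable lborel f"
  shows lborel_AE_integrable_snd: "AE y in lborel. integrable lborel (\<lambda>x. f (x, y))"
    and lborel_integral_snd: "(\<integral>y. (\<integral>x. f (x, y) \<partial>lborel) \<partial>lborel) = integral\<^sup>L lborel f"
  using lborel_AE_integrable_fst[OF lborel_integrable_swap[OF assms]]
    lborel_integral_fst[OF lborel_integrable_swap[OF assms]] lborel_integral_swap[of f] assms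
  by auto

text \<open>A dominating tensor product makes the iterated integral of the norm finite, which is
  Fubini's criterion. The bound is asked for almost every x only, because for a primitive it comes
  from slices of an integrable function, and these are integrable only almost everywhere.\<close>

lemma lborel_integrable_prodI_AE:
  fixes f :: "'a::euclidean_space \<times> 'b::euclidean_space \<Rightarrow> 'c::{banach, second_countable_topology}"
    and g :: "'a \<Rightarrow> 'd::{banach, second_countable_topology}"
    and h :: "'b \<Rightarrow> 'e::{banach, second_countable_topology}"
  assumes "integrable lborel g" "integrable lborel h" "f \<in> borel_measurable borel"
    and bound: "AE x in lborel. \<forall>y. norm (f (x, y)) \<le> norm (g x) * norm (h y)"
  shows "integrable lborel f"
proof -
  have [measurable]: "f \<in> borel_measurable (borel \<Otimes>\<^sub>M borel)"
    using assms by (simp add: borel_prod)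
  have *: "integrable lborel (\<lambda>y. f (x, y))" if "\<forall>y. norm (f (x, y)) \<le> norm (g x) * norm (h y)" for x
    by (rule Bochner_Integration.integrable_bound[of _ "\<lambda>y. norm (g x) * norm (h y)"])
       (use assms that integrable_norm[OF assms(2)] in auto)
  have "integrable (lborel \<Otimes>\<^sub>M lborel) f"
  proof (rule lborel_pair.Fubini_integrable)
    show "integrable lborel (\<lambda>x. \<integral>y. norm (f (x, y)) \<partial>lborel)"
    proof (rule Bochner_Integration.integrable_bound)
      show "integrable lborel (\<lambda>x. norm (g x) * (\<integral>y. norm (h y) \<partial>lborel))"
        using integrable_norm[OF assms(1)] by simp
      show "AE x in lborel. norm (\<integral>y. norm (f (x, y)) \<partial>lborel)
          \<le> norm (norm (g x) * (\<integral>y. norm (h y) \<partial>lborel))"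
        using bound
      proof eventually_elim
        case (elim x)
        have "(\<integral>y. norm (f (x, y)) \<partial>lborel) \<le> (\<integral>y. norm (g x) * norm (h y) \<partial>lborel)"
          by (rule integral_mono) (use elim *[of x] integrable_norm[OF assms(2)] in auto)
        then show ?case by auto
      qed
    qed measurable
    show "AE x in lborel. integrable lborel (\<lambda>y. f (x, y))"
      using bound by eventually_elim (rule *)
  qed simp
  then show ?thesis by (simp add: lborel_prod)
qed

lemmas lborel_integrable_prodI = lborel_integrable_prodI_AE[OF _ _ _ AE_I2[OF allI]]

text \<open>\<open>ennreal\<close> truncates at 0, so \<open>ennreal (f x)\<close> and
  \<open>ennreal (- f x)\<close> are the positive and the negative part. As densities they define
  finite measures that agree on boxes, an intersection-stable generator of the Borel sets; hence the
  measures agree, and so do the densities almost everywhere.\<close>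

lemma AE_eq_0_if_box_integrals_real:
  fixes f :: "'a::euclidean_space \<Rightarrow> real"
  assumes f: "integrable lborel f"
    and zero: "\<And>a b. (LINT x:box a b|lborel. f x) = 0"
  shows "AE x in lborel. f x = 0"
proof -
  have [measurable]: "f \<in> borel_measurable borel" using f by auto
  have fin: "(\<integral>\<^sup>+x. ennreal (f x) \<partial>lborel) \<noteq> \<infinity>" "(\<integral>\<^sup>+x. ennreal (- f x) \<partial>lborel) \<noteq> \<infinity>"
    using f by (auto simp: real_integrable_def)
  have eq: "(\<integral>\<^sup>+x. ennreal (f x) * indicator (box a b) x \<partial>lborel)
      = (\<integral>\<^sup>+x. ennreal (- f x) * indicator (box a b) x \<partial>lborel)" for a b
  proof -
    let ?g = "\<lambda>x. indicator (box a b) x * f x"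
    have g: "integrable lborel ?g"
      using integrable_mult_indicator[OF _ f, of "box a b"] by auto
    have *: "(\<integral>\<^sup>+x. ennreal (?g x) \<partial>lborel) = (\<integral>\<^sup>+x. ennreal (f x) * indicator (box a b) x \<partial>lborel)"
      "(\<integral>\<^sup>+x. ennreal (- ?g x) \<partial>lborel) = (\<integral>\<^sup>+x. ennreal (- f x) * indicator (box a b) x \<partial>lborel)"
      by (auto intro!: nn_integral_cong split: split_indicator)
    have "enn2real (\<integral>\<^sup>+x. ennreal (?g x) \<partial>lborel) = enn2real (\<integral>\<^sup>+x. ennreal (- ?g x) \<partial>lborel)"
      using zero[of a b] real_lebesgue_integral_def[OF g] by (simp add: set_lebesgue_integral_def)
    moreover have "(\<integral>\<^sup>+x. ennreal (?g x) \<partial>lborel) \<noteq> \<infinity>" "(\<integral>\<^sup>+x. ennreal (- ?g x) \<partial>lborel) \<noteq> \<infinity>"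
      using g by (auto simp: real_integrable_def)
    moreover have "r = s" if "enn2real r = enn2real s" "r \<noteq> \<infinity>" "s \<noteq> \<infinity>" for r s
      using that by (cases r; cases s) auto
    ultimately show ?thesis
      unfolding * by blast
  qed
  have "density lborel (\<lambda>x. ennreal (f x)) = density lborel (\<lambda>x. ennreal (- f x))" (is "?M = ?N")
  proof (rule measure_eqI_generator_eq)
    let ?E = "range (\<lambda>(a, b). box a b::'a set)"
    show "Int_stable ?E"
      by (auto simp: Int_stable_def box_Int_box)
    show "?E \<subseteq> Pow UNIV" "sets ?M = sigma_sets UNIV ?E" "sets ?N = sigma_sets UNIV ?E"
      by (simp_all add: borel_eq_box)
    let ?A = "\<lambda>n::nat. box (- (real n *\<^sub>R One)) (real n *\<^sub>R One) :: 'a set"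
    show "range ?A \<subseteq> ?E" "(\<Union>i. ?A i) = UNIV"
      unfolding UN_box_eq_UNIV by auto
    have "(\<integral>\<^sup>+x. ennreal (f x) * indicator (?A i) x \<partial>lborel) \<le> (\<integral>\<^sup>+x. ennreal (f x) \<partial>lborel)" for i
      by (intro nn_integral_mono) (auto split: split_indicator)
    then show "emeasure ?M (?A i) \<noteq> \<infinity>" for i
      using fin(1) neq_top_trans by (simp add: emeasure_density)
    show "emeasure ?M X = emeasure ?N X" if "X \<in> ?E" for X
      using that eq by (auto simp: emeasure_density)
  qed
  then have "AE x in lborel. ennreal (f x) = ennreal (- f x)"
    using fin by (subst (asm) finite_density_unique) auto
  then show ?thesis
  proof eventually_elim
    case (elim x)
    then show ?case by (cases "f x" "0::real" rule: linorder_cases) (auto simp: ennreal_neg)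
  qed
qed

lemma AE_eq_0_if_box_integrals:
  fixes f :: "'a::euclidean_space \<Rightarrow> 'b::euclidean_space"
  assumes f: "integrable lborel f"
    and zero: "\<And>a b. (LINT x:box a b|lborel. f x) = 0"
  shows "AE x in lborel. f x = 0"
proof -
  have "AE x in lborel. f x \<bullet> i = 0" for i
  proof (rule AE_eq_0_if_box_integrals_real)
    show "integrable lborel (\<lambda>x. f x \<bullet> i)" using f by simp
    fix a b
    have "(LINT x:box a b|lborel. f x \<bullet> i) = (LINT x:box a b|lborel. f x) \<bullet> i"
      using integral_inner_left[of i lborel "\<lambda>x. indicator (box a b) x *\<^sub>R f x"]
        integrable_mult_indicator[OF _ f, of "box a b"]
      by (simp add: set_lebesgue_integral_def)
    then show "(LINT x:box a b|lborel. f x \<bullet> i) = 0" by (simp add: zero)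
  qed
  then have "AE x in lborel. \<forall>i\<in>Basis. f x \<bullet> i = 0"
    by (subst AE_finite_all) auto
  then show ?thesis
    by eventually_elim (simp add: euclidean_all_zero_iff)
qed

text \<open>Products of cutoffs converge boundedly to the indicator of a box. The box is clipped to
  the rectangle (\<open>A\<close>, \<open>B\<close>, \<open>C\<close>, \<open>D\<close>) so that the
  cutoffs are admissible; clipping does not change the integral, since f vanishes outside the
  rectangle.\<close>

lemma AE_eq_0_if_test_fun1_integrals:
  fixes f :: "real \<times> real \<Rightarrow> 'b::euclidean_space"
  assumes f: "integrable lborel f"
    and supp: "\<And>z. z \<notin> {a<..<b} \<times> {c<..<d} \<Longrightarrow> f z = 0"
    and zero: "\<And>\<psi> \<eta>. test_fun1 a b \<psi> \<Longrightarrow> test_fun1 c d \<eta> \<Longrightarrow>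
      (\<integral>z. (\<psi> (fst z) * \<eta> (snd z)) *\<^sub>R f z \<partial>lborel) = 0"
  shows "AE z in lborel. f z = 0"
proof (rule AE_eq_0_if_box_integrals[OF f])
  have [measurable]: "f \<in> borel_measurable borel" using f by auto
  fix l u :: "real \<times> real"
  define A where "A = max a (fst l)"
  define B where "B = min b (fst u)"
  define C where "C = max c (snd l)"
  define D where "D = min d (snd u)"
  have mc: "(\<lambda>z. cutoff A B n (fst z) * cutoff C D n (snd z)) \<in> borel_measurable borel" for n
    by (intro borel_measurable_continuous_onI continuous_intros
        continuous_on_compose2[OF smooth1_continuous[OF smooth1_cutoff]]) auto
  have "(\<lambda>n. \<integral>z. (cutoff A B n (fst z) * cutoff C D n (snd z)) *\<^sub>R f z \<partial>lborel)
    \<longlonglongrightarrow> (\<integral>z. (indicator {A<..<B} (fst z) * indicator {C<..<D} (snd z)) *\<^sub>R f z \<partial>lborel)"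
  proof (rule integral_dominated_convergence[where w = "\<lambda>z. norm (f z)"])
    show "AE z in lborel. (\<lambda>n. (cutoff A B n (fst z) * cutoff C D n (snd z)) *\<^sub>R f z)
       \<longlonglongrightarrow> (indicator {A<..<B} (fst z) * indicator {C<..<D} (snd z)) *\<^sub>R f z"
      by (intro AE_I2 tendsto_intros cutoff_tendsto)
    show "AE z in lborel. norm ((cutoff A B n (fst z) * cutoff C D n (snd z)) *\<^sub>R f z) \<le> norm (f z)" for n
      using cutoff_bounds by (auto simp: abs_mult intro!: mult_left_le_one_le mult_le_one)
    have "{A<..<B} \<times> {C<..<D} \<in> sets (borel :: (real \<times> real) measure)"
      by (simp add: open_Times)
    then have "(\<lambda>z. indicator ({A<..<B} \<times> {C<..<D}) z *\<^sub>R f z) \<in> borel_measurable lborel"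
      by measurable
    then show "(\<lambda>z. (indicator {A<..<B} (fst z) * indicator {C<..<D} (snd z)) *\<^sub>R f z) \<in> borel_measurable lborel"
      by (auto simp: indicator_times)
    show "(\<lambda>z. (cutoff A B n (fst z) * cutoff C D n (snd z)) *\<^sub>R f z) \<in> borel_measurable lborel" for n
      using mc by measurable
  qed (use f in auto)
  moreover have "\<forall>\<^sub>F n in sequentially. (\<integral>z. (cutoff A B n (fst z) * cutoff C D n (snd z)) *\<^sub>R f z \<partial>lborel) = 0"
    using eventually_gt_at_top[of 0]
    by eventually_elim (auto intro!: zero test_fun1_cutoff simp: A_def B_def C_def D_def)
  ultimately have "(\<integral>z. (indicator {A<..<B} (fst z) * indicator {C<..<D} (snd z)) *\<^sub>R f z \<partial>lborel) = 0"
    by (rule LIMSEQ_unique[OF _ tendsto_eventually])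
  moreover have "(indicator {A<..<B} (fst z) * indicator {C<..<D} (snd z)) *\<^sub>R f z
      = indicator (box l u) z *\<^sub>R f z" for z
  proof (cases "z \<in> {a<..<b} \<times> {c<..<d}")
    case True
    then have "fst z \<in> {A<..<B} \<and> snd z \<in> {C<..<D} \<longleftrightarrow> z \<in> box l u"
      unfolding A_def B_def C_def D_def
      by (auto simp: box_prod mem_Times_iff)
    then show ?thesis by (auto simp: indicator_def)
  qed (simp add: supp)
  ultimately show "(LINT z:box l u|lborel. f z) = 0"
    by (simp add: set_lebesgue_integral_def)
qed

section \<open>Univariate test functions\<close>

text \<open>Integration by parts when the primitive comes from a merely integrable function, so that
  no pointwise derivative is at hand: by Fubini on the triangle c \<le> \<xi> \<le> y \<le> d, the
  inner integral of k over [\<xi>, d] is \<kappa> d - \<kappa> \<xi>.\<close>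

lemma primitive_by_parts:
  fixes h :: "real \<Rightarrow> 'b::euclidean_space"
  assumes h: "integrable lborel h"
    and \<kappa>: "\<And>x. (\<kappa> has_real_derivative k x) (at x)"
    and k: "continuous_on UNIV k"
  shows "(LINT y:{c..d}|lborel. k y *\<^sub>R (LINT \<xi>:{c..y}|lborel. h \<xi>))
    = (LINT \<xi>:{c..d}|lborel. (\<kappa> d - \<kappa> \<xi>) *\<^sub>R h \<xi>)"
proof -
  define F where "F = (\<lambda>(y, \<xi>). if c \<le> \<xi> \<and> \<xi> \<le> y \<and> y \<le> d then k y *\<^sub>R h \<xi> else 0)"
  have [measurable]: "h \<in> borel_measurable borel" "k \<in> borel_measurable borel"
    using h k by (auto intro: borel_measurable_continuous_onI)
  have "compact (k ` {c..d})"
    by (intro compact_continuous_image continuous_on_subset[OF k]) auto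
  then obtain B where B: "\<And>x. x \<in> {c..d} \<Longrightarrow> \<bar>k x\<bar> \<le> B"
    by (metis compact_imp_bounded bounded_iff image_eqI real_norm_def)
  have F: "integrable lborel F"
  proof (rule lborel_integrable_prodI[of "\<lambda>y. indicator {c..d} y * B"])
    show "F \<in> borel_measurable borel"
      unfolding F_def borel_prod[symmetric] by measurable
    show "norm (F (y, \<xi>)) \<le> norm (indicator {c..d} y * B) * norm (h \<xi>)" for y \<xi>
      using B[of y] by (auto simp: F_def intro!: mult_right_mono)
    have "integrable lborel (indicator {c..d} :: real \<Rightarrow> real)"
      by (simp add: integrable_indicator_iff emeasure_lborel_Icc_eq)
    then show "integrable lborel (\<lambda>y. indicator {c..d} y * B)"
      by simp
  qed fact
  have "(LINT y:{c..d}|lborel. k y *\<^sub>R (LINT \<xi>:{c..y}|lborel. h \<xi>))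
    = (\<integral>y. (\<integral>\<xi>. F (y, \<xi>) \<partial>lborel) \<partial>lborel)"
    unfolding set_lebesgue_integral_def integral_scaleR_right[symmetric]
    by (intro Bochner_Integration.integral_cong) (auto simp: F_def indicator_def)
  also have "\<dots> = (\<integral>\<xi>. (\<integral>y. F (y, \<xi>) \<partial>lborel) \<partial>lborel)"
    using F by (simp add: lborel_integral_fst lborel_integral_snd)
  also have "\<dots> = (LINT \<xi>:{c..d}|lborel. (\<kappa> d - \<kappa> \<xi>) *\<^sub>R h \<xi>)"
    unfolding set_lebesgue_integral_def
  proof (intro Bochner_Integration.integral_cong refl)
    fix \<xi>
    show "(\<integral>y. F (y, \<xi>) \<partial>lborel) = indicator {c..d} \<xi> *\<^sub>R (\<kappa> d - \<kappa> \<xi>) *\<^sub>R h \<xi>"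
    proof (cases "\<xi> \<in> {c..d}")
      case True
      then have "(\<lambda>y. F (y, \<xi>)) = (\<lambda>y. (k y * indicator {\<xi>..d} y) *\<^sub>R h \<xi>)"
        by (auto simp: F_def indicator_def)
      moreover have "has_bochner_integral lborel (\<lambda>y. k y * indicator {\<xi>..d} y) (\<kappa> d - \<kappa> \<xi>)"
        using True k \<kappa> by (intro has_bochner_integral_FTC_Icc_real)
          (auto simp: continuous_on_eq_continuous_at)
      ultimately show ?thesis
        using True by (simp add: has_bochner_integral_iff)
    qed (auto simp: F_def intro!: integral_eq_zero_AE)
  qed
  finally show ?thesis .
qed

lemma test_fun1_add: "test_fun1 a b f \<Longrightarrow> test_fun1 a b g \<Longrightarrow> test_fun1 a b (\<lambda>x. f x + g x)"
  unfolding test_fun1_def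
proof (elim conjE exE, intro conjI smooth1_add)
  fix a1 b1 a2 b2
  assume "a < a1" "b1 < b" "\<forall>x. x \<notin> {a1..b1} \<longrightarrow> f x = 0"
    "a < a2" "b2 < b" "\<forall>x. x \<notin> {a2..b2} \<longrightarrow> g x = 0"
  then have "a < min a1 a2" "max b1 b2 < b"
    "\<forall>x. x \<notin> {min a1 a2..max b1 b2} \<longrightarrow> f x + g x = 0"
    by (auto simp: min_le_iff_disj le_max_iff_disj)
  then show "\<exists>a' b'. a < a' \<and> b' < b \<and> (\<forall>x. x \<notin> {a'..b'} \<longrightarrow> f x + g x = 0)"
    by blast
qed auto

lemma test_fun1_cmult: "test_fun1 a b f \<Longrightarrow> test_fun1 a b (\<lambda>x. r * f x)"
  unfolding test_fun1_def by (auto intro!: smooth1_mult smooth1_const)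

text \<open>The primitive starting at minus infinity vanishes to the left of the support of
  \<theta>, and to the right of it equals the whole integral, which is zero. Thus mean zero is
  exactly what keeps the support compact.\<close>

lemma test_fun1_antiderivative:
  assumes "test_fun1 a b \<theta>" "(\<integral>x. \<theta> x \<partial>lborel) = 0"
  obtains \<eta> where "test_fun1 a b \<eta>" "deriv \<eta> = \<theta>"
proof -
  from assms obtain a' b' where *: "smooth1 \<theta>" "a < a'" "b' < b" "\<And>x. x \<notin> {a'..b'} \<Longrightarrow> \<theta> x = 0"
    by (auto simp: test_fun1_def)
  define \<eta> where "\<eta> x = (\<integral>y. (if y \<le> x then \<theta> y else 0) \<partial>lborel)" for x
  have \<eta>': "(\<eta> has_real_derivative \<theta> x) (at x)" for x
  proof -
    \<comment> \<open>A base point to the left of both the support and x: near x the function \<eta>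
      is then an ordinary integral starting at A, and the fundamental theorem of calculus
      applies.\<close>
    define A where "A = min a' x - 1"
    have eq: "\<eta> u = integral {A..u} \<theta>" if "u \<in> {A<..<x + 1}" for u
    proof -
      have "\<eta> u = (LINT y:{A..u}|lborel. \<theta> y)"
        unfolding \<eta>_def set_lebesgue_integral_def
        by (intro Bochner_Integration.integral_cong) (auto simp: indicator_def A_def intro!: *)
      also have "\<dots> = integral {A..u} \<theta>"
        by (intro set_borel_integral_eq_integral(2) borel_integrable_atLeastAtMost' smooth1_continuous *)
      finally show ?thesis .
    qed
    have "((\<lambda>u. integral {A..u} \<theta>) has_real_derivative \<theta> x) (at x within {A..x + 1})"
      by (intro integral_has_real_derivative smooth1_continuous *) (auto simp: A_def)
    then have "((\<lambda>u. integral {A..u} \<theta>) has_real_derivative \<theta> x) (at x within {A<..<x + 1})"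
      by (rule DERIV_subset) auto
    then have "((\<lambda>u. integral {A..u} \<theta>) has_real_derivative \<theta> x) (at x)"
      by (subst (asm) at_within_open) (auto simp: A_def)
    then show ?thesis
      by (rule has_field_derivative_transform_within_open[where S = "{A<..<x + 1}"])
         (auto simp: eq A_def)
  qed
  have "\<eta> x = 0" if "x \<notin> {a'..b'}" for x
  proof (cases "x < a'")
    case True
    then have "(\<lambda>y. if y \<le> x then \<theta> y else 0) = (\<lambda>y. 0)"
      using * by (auto intro!: ext)
    then show ?thesis by (simp add: \<eta>_def)
  next
    case False
    then have "(\<lambda>y. if y \<le> x then \<theta> y else 0) = \<theta>"
      using * that by (auto intro!: ext)
    then show ?thesis by (simp add: \<eta>_def assms)
  qed
  moreover have "smooth1 \<eta>" using \<eta>' *(1) by (rule smooth1I)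
  ultimately have "test_fun1 a b \<eta>" using * unfolding test_fun1_def by blast
  moreover have "deriv \<eta> = \<theta>" using \<eta>' by (intro ext DERIV_imp_deriv)
  ultimately show thesis by (rule that)
qed

lemma test_fun1_integrable: "test_fun1 a b \<eta> \<Longrightarrow> integrable lborel \<eta>"
proof -
  assume \<eta>: "test_fun1 a b \<eta>"
  then obtain B where B: "\<And>x. \<bar>\<eta> x\<bar> \<le> B" using test_fun1_props(5) by blast
  show "integrable lborel \<eta>"
  proof (rule Bochner_Integration.integrable_bound[of _ "\<lambda>x. indicator {a..b} x * B"])
    show "AE x in lborel. norm (\<eta> x) \<le> norm (indicator {a..b} x * B)"
    proof (rule AE_I2)
      fix x show "norm (\<eta> x) \<le> norm (indicator {a..b} x * B)"
        using B[of x] test_fun1_props(2,3)[OF \<eta>, of x] by (cases "x \<in> {a..b}") auto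
    qed
    have "integrable lborel (indicator {a..b} :: real \<Rightarrow> real)"
      by (simp add: integrable_indicator_iff emeasure_lborel_Icc_eq)
    then show "integrable lborel (\<lambda>y. indicator {a..b} y * B)"
      by simp
  qed (use test_fun1_props(4)[OF \<eta>] in auto)
qed

text \<open>The integrals of the cutoffs tend to b - a, so those with large n are positive, without
  computing any of them.\<close>

lemma ex_test_fun1_nonzero_integral:
  assumes "a < b"
  obtains \<rho> where "test_fun1 a b \<rho>" "(\<integral>x. \<rho> x \<partial>lborel) \<noteq> 0"
proof -
  have "(\<lambda>n. \<integral>x. cutoff a b n x \<partial>lborel) \<longlonglongrightarrow> (\<integral>x. indicator {a<..<b} x \<partial>lborel)"
  proof (rule integral_dominated_convergence[where w = "indicator {a..b}"])
    show "integrable lborel (indicator {a..b} :: real \<Rightarrow> real)"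
      by (simp add: integrable_indicator_iff emeasure_lborel_Icc_eq)
    show "AE x in lborel. norm (cutoff a b n x) \<le> indicator {a..b} x" for n
    proof (rule AE_I2)
      fix x
      have "cutoff a b n x = 0" if "x \<notin> {a..b}"
      proof -
        have "real n * (x - a) \<le> 0 \<or> real n * (b - x) \<le> 0"
          using that by (auto intro: mult_nonneg_nonpos)
        then show ?thesis by (auto simp: cutoff_def exp_flat_def)
      qed
      then show "norm (cutoff a b n x) \<le> indicator {a..b} x"
        using cutoff_bounds[of a b n x] by (auto simp: indicator_def)
    qed
    show "cutoff a b n \<in> borel_measurable lborel" for n
      using borel_measurable_continuous_onI[OF smooth1_continuous[OF smooth1_cutoff]] by simp
  qed (auto intro!: cutoff_tendsto)
  moreover have "(\<integral>x. indicator {a<..<b} x \<partial>lborel) > (0::real)"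
    using assms by simp
  ultimately have "\<forall>\<^sub>F n in sequentially. (\<integral>x. cutoff a b n x \<partial>lborel) > 0"
    by (rule order_tendstoD)
  then have "\<forall>\<^sub>F n in sequentially. (\<integral>x. cutoff a b n x \<partial>lborel) > 0 \<and> n > 0"
    using eventually_gt_at_top[of 0] by eventually_elim simp
  then obtain n where "(\<integral>x. cutoff a b n x \<partial>lborel) > 0" "n > 0"
    by (auto dest: eventually_happens)
  with test_fun1_cutoff[of a a b b n] show thesis by (intro that[of "cutoff a b n"]) auto
qed

section \<open>Weak derivatives and primitives\<close>

lemma test_fun1_tensor_measurable:
  assumes "test_fun1 a b \<psi>" "test_fun1 c d \<eta>"
  shows "(\<lambda>z. \<psi> (fst z) * \<eta> (snd z)) \<in> borel_measurable borel"
proof -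
  have [measurable]: "\<psi> \<in> borel_measurable borel" "\<eta> \<in> borel_measurable borel"
    using assms test_fun1_props(4) by auto
  show ?thesis by (simp add: borel_prod[symmetric])
qed

lemma test_fun1_tensor_integrable:
  fixes f :: "real \<times> real \<Rightarrow> 'b::euclidean_space"
  assumes f: "integrable lborel f" and "test_fun1 a b \<psi>" "test_fun1 c d \<eta>"
  shows "integrable lborel (\<lambda>z. (\<psi> (fst z) * \<eta> (snd z)) *\<^sub>R f z)"
proof -
  obtain B1 B2 where B: "\<And>x. \<bar>\<psi> x\<bar> \<le> B1" "\<And>x. \<bar>\<eta> x\<bar> \<le> B2"
    using assms test_fun1_props(5) by metis
  show ?thesis
  proof (rule Bochner_Integration.integrable_bound)
    show "integrable lborel (\<lambda>z. (B1 * B2) *\<^sub>R f z)" using f by simp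
    have "\<bar>\<psi> (fst z)\<bar> * \<bar>\<eta> (snd z)\<bar> \<le> \<bar>B1 * B2\<bar>" for z
      using B(1)[of "fst z"] B(2)[of "snd z"] by (simp add: abs_mult mult_mono)
    then show "AE z in lborel. norm ((\<psi> (fst z) * \<eta> (snd z)) *\<^sub>R f z) \<le> norm ((B1 * B2) *\<^sub>R f z)"
      by (auto simp: abs_mult intro!: mult_right_mono)
  qed (use f test_fun1_tensor_measurable[OF assms(2,3)] in auto)
qed

text \<open>The domain of integration moves with z; written as a condition inside an integral over
  the whole line, it becomes part of a jointly measurable integrand.\<close>

lemma borel_measurable_primitive:
  fixes g :: "real \<times> real \<Rightarrow> 'b::euclidean_space"
  assumes "g \<in> borel_measurable borel"
  shows "(\<lambda>z. LINT \<xi>:{c..snd z}|lborel. g (fst z, \<xi>)) \<in> borel_measurable borel"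
proof -
  have [measurable]: "g \<in> borel_measurable (borel \<Otimes>\<^sub>M borel)" using assms by (simp add: borel_prod)
  have "(\<lambda>z. \<integral>\<xi>. (if c \<le> \<xi> \<and> \<xi> \<le> snd z then g (fst z, \<xi>) else 0) \<partial>lborel)
      \<in> borel_measurable (borel \<Otimes>\<^sub>M borel :: (real \<times> real) measure)"
    by (rule lborel.borel_measurable_lebesgue_integral) measurable
  moreover have "(LINT \<xi>:{c..y}|lborel. g (s, \<xi>))
      = (\<integral>\<xi>. (if c \<le> \<xi> \<and> \<xi> \<le> y then g (s, \<xi>) else 0) \<partial>lborel)" for s y
    unfolding set_lebesgue_integral_def by (intro Bochner_Integration.integral_cong) auto
  ultimately show ?thesis by (simp add: borel_prod)
qed

lemma norm_set_integral_le:
  fixes f :: "'a \<Rightarrow> 'b::{banach, second_countable_topology}"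
  assumes "A \<in> sets M" "integrable M f"
  shows "norm (LINT x:A|M. f x) \<le> (\<integral>x. norm (f x) \<partial>M)"
  unfolding set_lebesgue_integral_def
  by (intro order_trans[OF integral_norm_bound] integral_mono integrable_norm
      integrable_mult_indicator assms) (auto simp: indicator_def)

text \<open>The lemma of du Bois-Reymond with a parameter. Subtracting from f the primitive
  \<open>G\<close> of g leaves \<open>F\<close>, whose weak derivative in the second variable is
  zero (\<open>F_deriv\<close>). Such an \<open>F\<close> is orthogonal to all products whose second
  factor has mean zero, hence agrees almost everywhere with a function of the first
  variable.\<close>

lemma weak_derivative_imp_primitive:
  fixes f g :: "real \<times> real \<Rightarrow> 'b::euclidean_space"
  assumes cd: "c < d"
    and f: "integrable lborel f" "\<And>z. z \<notin> {a<..<b} \<times> {c<..<d} \<Longrightarrow> f z = 0"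
    and g: "integrable lborel g" "\<And>z. z \<notin> {a<..<b} \<times> {c<..<d} \<Longrightarrow> g z = 0"
    and weak: "\<And>\<psi> \<eta>. test_fun1 a b \<psi> \<Longrightarrow> test_fun1 c d \<eta> \<Longrightarrow>
      (\<integral>z. (\<psi> (fst z) * deriv \<eta> (snd z)) *\<^sub>R f z \<partial>lborel)
        = - (\<integral>z. (\<psi> (fst z) * \<eta> (snd z)) *\<^sub>R g z \<partial>lborel)"
  obtains C where "integrable lborel C" "\<And>s. s \<notin> {a<..<b} \<Longrightarrow> C s = 0"
    "AE z in lborel. z \<in> {a<..<b} \<times> {c<..<d} \<longrightarrow>
      f z = C (fst z) + (LINT \<xi>:{c..snd z}|lborel. g (fst z, \<xi>))"
proof -
  let ?R = "{a<..<b} \<times> {c<..<d}"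
  define G where "G = (\<lambda>z. LINT \<xi>:{c..snd z}|lborel. g (fst z, \<xi>))"
  define GR where "GR z = (if z \<in> ?R then G z else 0)" for z
  define F where "F z = f z - GR z" for z
  have [measurable]: "f \<in> borel_measurable borel" "g \<in> borel_measurable borel"
    using f g by auto
  have [measurable]: "G \<in> borel_measurable borel"
    unfolding G_def by (rule borel_measurable_primitive) measurable
  have [measurable]: "G \<in> borel_measurable (borel \<Otimes>\<^sub>M borel)" "g \<in> borel_measurable (borel \<Otimes>\<^sub>M borel)"
    unfolding borel_prod by measurable
  have R[measurable]: "?R \<in> sets borel" by (simp add: open_Times)
  have int1: "integrable lborel (indicator {c<..<d} :: real \<Rightarrow> real)"
    using cd by (simp add: integrable_indicator_iff)
  \<comment> \<open>In the slice s the primitive is bounded by the integral of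
    \<open>norm (g (s, \<xi>))\<close> over \<xi>, which is itself integrable in s. The truncation
    to the rectangle supplies integrability in the second variable.\<close>
  have "integrable lborel GR"
  proof (rule lborel_integrable_prodI_AE[OF _ int1])
    show "integrable lborel (\<lambda>s. \<integral>\<xi>. norm (g (s, \<xi>)) \<partial>lborel)"
      by (rule lborel_integrable_fst) (use g in auto)
    have "AE s in lborel. integrable lborel (\<lambda>\<xi>. g (s, \<xi>))"
      using g lborel_AE_integrable_fst by blast
    then show "AE s in lborel. \<forall>y. norm (GR (s, y))
        \<le> norm (\<integral>\<xi>. norm (g (s, \<xi>)) \<partial>lborel) * norm (indicator {c<..<d} y :: real)"
    proof eventually_elim
      case (elim s)
      have "norm (G (s, y)) \<le> (\<integral>\<xi>. norm (g (s, \<xi>)) \<partial>lborel)" for y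
        using norm_set_integral_le[OF _ elim, of "{c..y}"] by (simp add: G_def)
      then show ?case by (auto simp: GR_def)
    qed
    show "GR \<in> borel_measurable borel" unfolding GR_def[abs_def] by measurable
  qed
  then have F: "integrable lborel F" unfolding F_def using f by auto
  have F0: "F z = 0" if "z \<notin> ?R" for z using that f by (auto simp: F_def GR_def)
  have F_deriv: "(\<integral>z. (\<psi> (fst z) * deriv \<eta> (snd z)) *\<^sub>R F z \<partial>lborel) = 0"
    if \<psi>: "test_fun1 a b \<psi>" and \<eta>: "test_fun1 c d \<eta>" for \<psi> \<eta>
  proof -
    note \<eta>' = test_fun1_deriv[OF \<eta>]
    have [measurable]: "\<psi> \<in> borel_measurable borel" "\<eta> \<in> borel_measurable borel"
      "deriv \<eta> \<in> borel_measurable borel"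
      using test_fun1_props(4) \<psi> \<eta> \<eta>' by auto
    have "(\<integral>z. (\<psi> (fst z) * deriv \<eta> (snd z)) *\<^sub>R GR z \<partial>lborel)
        = (\<integral>s. \<integral>y. (\<psi> s * deriv \<eta> y) *\<^sub>R GR (s, y) \<partial>lborel \<partial>lborel)"
      using lborel_integral_fst[OF test_fun1_tensor_integrable[OF \<open>integrable lborel GR\<close> \<psi> \<eta>']] by simp
    also have "\<dots> = (\<integral>s. \<psi> s *\<^sub>R (LINT y:{c..d}|lborel. deriv \<eta> y *\<^sub>R G (s, y)) \<partial>lborel)"
      unfolding set_lebesgue_integral_def integral_scaleR_right[symmetric]
    proof (intro Bochner_Integration.integral_cong refl)
      fix s y
      show "(\<psi> s * deriv \<eta> y) *\<^sub>R GR (s, y)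
          = \<psi> s *\<^sub>R indicator {c..d} y *\<^sub>R deriv \<eta> y *\<^sub>R G (s, y)"
        using test_fun1_props(2,3)[OF \<psi>, of s] test_fun1_props(2,3)[OF \<eta>', of y]
        by (cases "(s, y) \<in> ?R") (auto simp: GR_def not_less)
    qed
    \<comment> \<open>Integration by parts in the slice: the boundary term disappears because \<eta>
      vanishes at d.\<close>
    also have "\<dots> = (\<integral>s. \<psi> s *\<^sub>R (\<integral>\<xi>. - \<eta> \<xi> *\<^sub>R g (s, \<xi>) \<partial>lborel) \<partial>lborel)"
    proof (rule integral_cong_AE)
      have "AE s in lborel. integrable lborel (\<lambda>\<xi>. g (s, \<xi>))"
        using g lborel_AE_integrable_fst by blast
      then show "AE s in lborel. \<psi> s *\<^sub>R (LINT y:{c..d}|lborel. deriv \<eta> y *\<^sub>R G (s, y))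
          = \<psi> s *\<^sub>R (\<integral>\<xi>. - \<eta> \<xi> *\<^sub>R g (s, \<xi>) \<partial>lborel)"
      proof eventually_elim
        case (elim s)
        have "(LINT y:{c..d}|lborel. deriv \<eta> y *\<^sub>R G (s, y))
            = (LINT \<xi>:{c..d}|lborel. (\<eta> d - \<eta> \<xi>) *\<^sub>R g (s, \<xi>))"
          unfolding G_def using smooth1_deriv[OF test_fun1_props(1)[OF \<eta>]] elim
          by (auto intro!: primitive_by_parts smooth1_continuous)
        also have "\<dots> = (\<integral>\<xi>. - \<eta> \<xi> *\<^sub>R g (s, \<xi>) \<partial>lborel)"
          unfolding set_lebesgue_integral_def
        proof (intro Bochner_Integration.integral_cong refl)
          fix \<xi>
          show "indicator {c..d} \<xi> *\<^sub>R (\<eta> d - \<eta> \<xi>) *\<^sub>R g (s, \<xi>) = - \<eta> \<xi> *\<^sub>R g (s, \<xi>)"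
            using test_fun1_props(2,3)[OF \<eta>, of \<xi>] test_fun1_props(3)[OF \<eta>, of d]
            by (cases "\<xi> \<in> {c..d}") auto
        qed
        finally show ?case by simp
      qed
    qed (simp_all add: set_lebesgue_integral_def)
    also have "\<dots> = - (\<integral>s. \<integral>\<xi>. (\<psi> s * \<eta> \<xi>) *\<^sub>R g (s, \<xi>) \<partial>lborel \<partial>lborel)"
      by (simp flip: integral_minus integral_scaleR_right)
    also have "\<dots> = - (\<integral>z. (\<psi> (fst z) * \<eta> (snd z)) *\<^sub>R g z \<partial>lborel)"
      using lborel_integral_fst[OF test_fun1_tensor_integrable[OF g(1) \<psi> \<eta>]] by simp
    finally have "(\<integral>z. (\<psi> (fst z) * deriv \<eta> (snd z)) *\<^sub>R GR z \<partial>lborel)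
        = (\<integral>z. (\<psi> (fst z) * deriv \<eta> (snd z)) *\<^sub>R f z \<partial>lborel)"
      using weak[OF \<psi> \<eta>] by simp
    then show ?thesis
      unfolding F_def scaleR_diff_right
      using test_fun1_tensor_integrable[OF f(1) \<psi> \<eta>'] test_fun1_tensor_integrable[OF \<open>integrable lborel GR\<close> \<psi> \<eta>']
      by simp
  qed
  obtain \<rho> where \<rho>: "test_fun1 c d \<rho>" "(\<integral>x. \<rho> x \<partial>lborel) \<noteq> 0"
    using ex_test_fun1_nonzero_integral[OF cd] by blast
  define M where "M = (\<integral>x. \<rho> x \<partial>lborel)"
  \<comment> \<open>If \<open>F\<close> is constant in each slice, its weighted mean with weight
    \<rho> / \<open>M\<close> must be that constant; this defines the candidate before constancy is
    known.\<close>
  define C where "C s = (\<integral>y. \<rho> y *\<^sub>R F (s, y) \<partial>lborel) /\<^sub>R M" for s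
  have MC: "M *\<^sub>R C s = (\<integral>y. \<rho> y *\<^sub>R F (s, y) \<partial>lborel)" for s
    using \<rho>(2) by (simp add: C_def M_def)
  have C: "integrable lborel C"
  proof -
    obtain B where B: "\<And>x. \<bar>\<rho> x\<bar> \<le> B" using test_fun1_props(5)[OF \<rho>(1)] by blast
    have [measurable]: "\<rho> \<in> borel_measurable borel" using test_fun1_props(4)[OF \<rho>(1)] .
    have "integrable lborel (\<lambda>z. \<rho> (snd z) *\<^sub>R F z)"
    proof (rule Bochner_Integration.integrable_bound)
      show "integrable lborel (\<lambda>z. B *\<^sub>R F z)" using F by simp
      have "\<bar>\<rho> x\<bar> \<le> \<bar>B\<bar>" for x using B[of x] by simp
      then show "AE z in lborel. norm (\<rho> (snd z) *\<^sub>R F z) \<le> norm (B *\<^sub>R F z)"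
        by (auto intro!: mult_right_mono)
      have "(\<lambda>z::real\<times>real. \<rho> (snd z)) \<in> borel_measurable borel"
        unfolding borel_prod[symmetric] by measurable
      then show "(\<lambda>z. \<rho> (snd z) *\<^sub>R F z) \<in> borel_measurable lborel" using F by auto
    qed
    from lborel_integrable_fst[OF this] show ?thesis unfolding C_def by simp
  qed
  have C0: "C s = 0" if "s \<notin> {a<..<b}" for s
    using that F0 by (auto simp: C_def)
  define CR where "CR z = (if z \<in> ?R then C (fst z) else 0)" for z
  have CR: "integrable lborel CR"
  proof (rule lborel_integrable_prodI[OF C int1])
    have "(\<lambda>z::real\<times>real. C (fst z)) \<in> borel_measurable borel"
      using C unfolding borel_prod[symmetric] by measurable
    then show "CR \<in> borel_measurable borel" unfolding CR_def[abs_def] by measurable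
  qed (auto simp: CR_def)
  have "AE z in lborel. F z - CR z = 0"
  proof (rule AE_eq_0_if_test_fun1_integrals)
    fix \<psi> \<zeta> assume \<psi>: "test_fun1 a b \<psi>" and \<zeta>: "test_fun1 c d \<zeta>"
    define m where "m = (\<integral>x. \<zeta> x \<partial>lborel)"
    have "(\<integral>x. \<zeta> x + (- m / M) * \<rho> x \<partial>lborel) = 0"
      using test_fun1_integrable[OF \<zeta>] test_fun1_integrable[OF \<rho>(1)] \<rho>(2) by (simp add: m_def M_def)
    \<comment> \<open>Subtracting a multiple of \<open>\<rho>\<close> gives \<open>\<zeta>\<close> mean zero, hence an admissible primitive.\<close>
    then obtain \<eta> where \<eta>: "test_fun1 c d \<eta>" "deriv \<eta> = (\<lambda>x. \<zeta> x + (- m / M) * \<rho> x)"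
      using test_fun1_antiderivative[OF test_fun1_add[OF \<zeta> test_fun1_cmult[OF \<rho>(1), of "- m / M"]]] by blast
    have "0 = (\<integral>z. (\<psi> (fst z) * \<zeta> (snd z)) *\<^sub>R F z
        + (- m / M) *\<^sub>R (\<psi> (fst z) * \<rho> (snd z)) *\<^sub>R F z \<partial>lborel)"
      using F_deriv[OF \<psi> \<eta>(1)] by (simp add: \<eta>(2) algebra_simps)
    also have "\<dots> = (\<integral>z. (\<psi> (fst z) * \<zeta> (snd z)) *\<^sub>R F z \<partial>lborel)
        - (m / M) *\<^sub>R (\<integral>z. (\<psi> (fst z) * \<rho> (snd z)) *\<^sub>R F z \<partial>lborel)"
      using test_fun1_tensor_integrable[OF F \<psi> \<zeta>] test_fun1_tensor_integrable[OF F \<psi> \<rho>(1)]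
      by (simp del: scaleR_scaleR)
    also have "(\<integral>z. (\<psi> (fst z) * \<rho> (snd z)) *\<^sub>R F z \<partial>lborel)
        = (\<integral>s. \<integral>y. (\<psi> s * \<rho> y) *\<^sub>R F (s, y) \<partial>lborel \<partial>lborel)"
      using lborel_integral_fst[OF test_fun1_tensor_integrable[OF F \<psi> \<rho>(1)]] by simp
    also have "\<dots> = (\<integral>s. \<psi> s *\<^sub>R M *\<^sub>R C s \<partial>lborel)"
      unfolding MC by (simp flip: integral_scaleR_right)
    also have "(m / M) *\<^sub>R \<dots> = (\<integral>s. \<psi> s *\<^sub>R m *\<^sub>R C s \<partial>lborel)"
      using \<rho>(2) by (simp add: M_def mult.commute flip: integral_scaleR_right)
    \<comment> \<open>Within the rectangle \<open>CR\<close> does not depend on y, so integrating it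
      against \<zeta> produces the factor \<open>m\<close>.\<close>
    also have "\<dots> = (\<integral>s. \<integral>y. (\<psi> s * \<zeta> y) *\<^sub>R CR (s, y) \<partial>lborel \<partial>lborel)"
    proof (intro Bochner_Integration.integral_cong refl)
      fix s
      have "(\<psi> s * \<zeta> y) *\<^sub>R CR (s, y) = (\<zeta> y) *\<^sub>R \<psi> s *\<^sub>R C s" for y
        using test_fun1_props(2,3)[OF \<zeta>, of y] test_fun1_props(2,3)[OF \<psi>, of s]
        by (cases "(s, y) \<in> ?R") (auto simp: CR_def not_less)
      then show "\<psi> s *\<^sub>R m *\<^sub>R C s = (\<integral>y. (\<psi> s * \<zeta> y) *\<^sub>R CR (s, y) \<partial>lborel)"
        using test_fun1_integrable[OF \<zeta>] by (simp add: m_def)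
    qed
    also have "\<dots> = (\<integral>z. (\<psi> (fst z) * \<zeta> (snd z)) *\<^sub>R CR z \<partial>lborel)"
      using lborel_integral_fst[OF test_fun1_tensor_integrable[OF CR \<psi> \<zeta>]] by simp
    finally show "(\<integral>z. (\<psi> (fst z) * \<zeta> (snd z)) *\<^sub>R (F z - CR z) \<partial>lborel) = 0"
      using test_fun1_tensor_integrable[OF F \<psi> \<zeta>] test_fun1_tensor_integrable[OF CR \<psi> \<zeta>]
      by (simp add: scaleR_diff_right)
  next
    show "integrable lborel (\<lambda>z. F z - CR z)" using F CR by simp
    show "F z - CR z = 0" if "z \<notin> ?R" for z
      using F0[OF that] that unfolding CR_def by (simp only: if_False diff_self)
  qed
  then have "AE z in lborel. z \<in> ?R \<longrightarrow> f z = C (fst z) + G z"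
    by eventually_elim (auto simp: F_def GR_def CR_def algebra_simps)
  with C C0 show thesis unfolding G_def by (rule that)
qed

section \<open>Integrability to a power\<close>

text \<open>By homogeneity it is enough to use the tangent at 1, with s / m as the argument. The
  point s = 0 lies outside the open half-line on which convexity is invoked; there the left side is
  (1 - p) times a power, hence nonpositive.\<close>

lemma powr_ge_tangent:
  fixes s m p :: real
  assumes "p \<ge> 1" "s \<ge> 0" "m > 0"
  shows "m powr p + p * m powr (p - 1) * (s - m) \<le> s powr p"
proof (cases "s = 0")
  case True
  have "m powr (p - 1) * m = m powr p" using assms by (simp add: powr_diff)
  then have "m powr p + p * m powr (p - 1) * (s - m) = (1 - p) * m powr p"
    using True by (simp add: algebra_simps)
  also have "\<dots> \<le> 0" using assms by (simp add: mult_nonpos_nonneg)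
  finally show ?thesis using True by simp
next
  case False
  then have s: "s > 0" using assms by simp
  have "1 + p * (s / m - 1) \<le> (s / m) powr p"
  proof -
    have conv: "convex_on {0<..} (\<lambda>x. x powr p)" by (rule powr_convex) fact
    have "((\<lambda>x. x powr p) has_real_derivative p * 1 powr (p - 1)) (at 1 within {0<..})"
      by (auto intro!: derivative_eq_intros)
    then have "(s / m) powr p - 1 powr p \<ge> p * 1 powr (p - 1) * (s / m - 1)"
      using convex_on_imp_above_tangent[OF conv, of 1 "s / m" "p * 1 powr (p - 1)"] s assms
      by (simp add: connected_Ioi interior_open)
    then show ?thesis by simp
  qed
  then have "m powr p * (1 + p * (s / m - 1)) \<le> m powr p * (s / m) powr p"
    by (intro mult_left_mono) auto
  moreover have "m powr p * (s / m) powr p = s powr p"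
    using s assms by (simp add: powr_divide)
  moreover have "m powr p * (1 + p * (s / m - 1)) = m powr p + p * m powr (p - 1) * (s - m)"
    using assms by (simp add: powr_diff field_simps)
  ultimately show ?thesis by simp
qed

text \<open>Jensen's inequality; total mass below 1 only helps because the power vanishes at 0.\<close>
lemma powr_set_integral_le:
  fixes f :: "'a \<Rightarrow> real"
  assumes p: "p \<ge> 1" and S: "S \<in> sets M" "emeasure M S \<le> 1"
    and f: "integrable M f" "\<And>x. 0 \<le> f x"
  shows "ennreal ((LINT x:S|M. f x) powr p) \<le> (\<integral>\<^sup>+x\<in>S. ennreal (f x powr p) \<partial>M)"
proof -
  define m where "m = (LINT x:S|M. f x)"
  have m0: "m \<ge> 0"
    unfolding m_def set_lebesgue_integral_def using f by (auto intro!: integral_nonneg_AE)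
  have [measurable]: "f \<in> borel_measurable M" "S \<in> sets M" using f S by auto
  show ?thesis
  proof (cases "m = 0 \<or> (\<integral>\<^sup>+x\<in>S. ennreal (f x powr p) \<partial>M) = \<infinity>")
    case True
    then show ?thesis by (auto simp: m_def)
  next
    case False
    have fS: "emeasure M S < \<infinity>" using S(2) by (rule order_le_less_trans) simp
    have ind: "integrable M (indicator S :: 'a \<Rightarrow> real)"
      using fS by (simp add: integrable_indicator_iff)
    have fi: "integrable M (\<lambda>x. indicator S x * f x)"
      using integrable_mult_indicator[OF S(1) f(1)] by simp
    have *: "(\<integral>\<^sup>+x\<in>S. ennreal (f x powr p) \<partial>M) = (\<integral>\<^sup>+x. ennreal (indicator S x * f x powr p) \<partial>M)"
      by (intro nn_integral_cong) (auto simp: indicator_def)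
    have pi: "integrable M (\<lambda>x. indicator S x * f x powr p)"
      by (rule integrableI_nonneg) (use False in \<open>auto simp: * less_top[symmetric]\<close>)
    have \<mu>: "measure M S \<le> 1" "0 \<le> measure M S"
      using S(2) by (auto simp: measure_def enn2real_leI)
    \<comment> \<open>With \<mu> the mass of S, p \<ge> 1 and \<mu> \<le> 1 give \<mu> + p (1 -
      \<mu>) \<ge> 1. The right-hand side is the integral over S of the tangent of the power at
      \<open>m\<close>.\<close>
    have "m powr p \<le> m powr p * (measure M S + p * (1 - measure M S))"
    proof -
      have "1 - measure M S \<le> p * (1 - measure M S)"
        using p \<mu> mult_right_mono[of 1 p "1 - measure M S"] by simp
      then show ?thesis using mult_left_mono[of 1 _ "m powr p"] by simp
    qed
    also have "\<dots> = m powr p * measure M S + p * m powr (p - 1) * (m - m * measure M S)"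
      using False m0 by (simp add: powr_diff field_simps)
    also have "\<dots> = (\<integral>x. m powr p * indicator S x + p * m powr (p - 1) * (indicator S x * f x - m * indicator S x) \<partial>M)"
      using ind fi by (simp add: m_def set_lebesgue_integral_def)
    also have "\<dots> \<le> (\<integral>x. indicator S x * f x powr p \<partial>M)"
    proof (rule integral_mono)
      fix x
      show "m powr p * indicator S x + p * m powr (p - 1) * (indicator S x * f x - m * indicator S x)
          \<le> indicator S x * f x powr p"
        using powr_ge_tangent[OF p f(2)[of x], of m] False m0 by (cases "x \<in> S") auto
    qed (use ind fi pi in auto)
    finally have "ennreal (m powr p) \<le> ennreal (\<integral>x. indicator S x * f x powr p \<partial>M)"
      by (rule ennreal_leI)
    also have "\<dots> = (\<integral>\<^sup>+x. ennreal (indicator S x * f x powr p) \<partial>M)"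
      using pi by (intro nn_integral_eq_integral[symmetric]) auto
    finally show ?thesis by (simp add: m_def *)
  qed
qed

text \<open>The norm of a sum is at most twice the larger norm. The crude constant does no harm: it
  multiplies quantities that are arbitrarily small or only have to be finite.\<close>

lemma powr_norm_add_le:
  fixes x y :: "'a::real_normed_vector"
  assumes "p \<ge> 0"
  shows "norm (x + y) powr p \<le> 2 powr p * (norm x powr p + norm y powr p)"
proof -
  have "norm (x + y) powr p \<le> (2 * max (norm x) (norm y)) powr p"
    using assms norm_triangle_ineq[of x y] by (intro powr_mono2) auto
  also have "\<dots> = 2 powr p * max (norm x) (norm y) powr p"
    by (simp add: powr_mult)
  also have "\<dots> \<le> 2 powr p * (norm x powr p + norm y powr p)"
    by (intro mult_left_mono) (auto simp: max_def)
  finally show ?thesis .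
qed

text \<open>A nonempty open interval has positive measure. This selects a single line close to the
  boundary on which several almost-everywhere properties hold together.\<close>

lemma AE_imp_ex_in_interval:
  fixes l u :: real
  assumes "AE x in lborel. P x" "l < u"
  shows "\<exists>x. l < x \<and> x < u \<and> P x"
proof (rule ccontr)
  assume "\<not> ?thesis"
  with assms(1) have "AE x in lborel. x \<notin> {l<..<u}"
    by (auto elim!: eventually_mono)
  then have "emeasure lborel {l<..<u} = 0"
    by (subst (asm) AE_iff_measurable[where N = "{l<..<u}"]) auto
  then show False using assms(2) by simp
qed

text \<open>A function measurable for the completion agrees almost everywhere with a Borel function,
  componentwise and hence jointly for finitely many components. The integrability condition passes
  from the components to the norm, the form in which the traces are defined.\<close>

lemma Lpn_on_borel_rep:
  fixes u :: "'a::euclidean_space \<Rightarrow> real^'n"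
  assumes u: "Lpn_on p A u" and A: "A \<in> sets borel" and p: "p \<ge> 1"
  obtains U where "U \<in> borel_measurable borel" "\<And>z. z \<notin> A \<Longrightarrow> U z = 0"
    "AE z in lborel. z \<in> A \<longrightarrow> U z = u z"
    "(\<integral>\<^sup>+z. ennreal (norm (U z) powr p) \<partial>lborel) < \<infinity>"
proof -
  have "\<exists>g\<in>borel_measurable lborel. AE z in lborel. indicator A z *\<^sub>R (u z $ i) = g z" for i
  proof (rule completion_ex_borel_measurable_real)
    have "(\<lambda>z. u z $ i) \<in> borel_measurable (lebesgue_on A)"
      using u by (auto simp: Lpn_on_def Lp_on_def)
    then show "(\<lambda>z. indicator A z *\<^sub>R (u z $ i)) \<in> borel_measurable lebesgue"
      using A by (subst (asm) borel_measurable_restrict_space_iff) auto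
  qed
  then obtain g where g: "\<And>i. g i \<in> borel_measurable lborel"
    "\<And>i. AE z in lborel. indicator A z *\<^sub>R (u z $ i) = g i z" by metis
  have [measurable]: "g i \<in> borel_measurable borel" "A \<in> sets borel" for i using g A by auto
  define U where "U z = (if z \<in> A then \<chi> i. g i z else 0)" for z
  have "AE z in lborel. \<forall>i. indicator A z *\<^sub>R (u z $ i) = g i z"
    using g(2) by (subst AE_all_countable) auto
  then have AE: "AE z in lborel. z \<in> A \<longrightarrow> U z = u z"
    by eventually_elim (auto simp: U_def vec_eq_iff)
  have gp: "(\<integral>\<^sup>+z\<in>A. ennreal (\<bar>g i z\<bar> powr p) \<partial>lborel) < \<infinity>" for i
  proof -
    have "(\<integral>\<^sup>+z\<in>A. ennreal (\<bar>g i z\<bar> powr p) \<partial>lborel) = (\<integral>\<^sup>+z\<in>A. ennreal (\<bar>u z $ i\<bar> powr p) \<partial>lborel)"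
    proof (rule nn_integral_cong_AE)
      show "AE z in lborel. ennreal (\<bar>g i z\<bar> powr p) * indicator A z = ennreal (\<bar>u z $ i\<bar> powr p) * indicator A z"
        using g(2)[of i] by eventually_elim (auto simp: indicator_def)
    qed
    also have "\<dots> < \<infinity>"
      using u by (auto simp: Lpn_on_def Lp_on_def nn_integral_completion)
    finally show ?thesis .
  qed
  \<comment> \<open>The norm is at most n times the largest component, and the p-th power of the
    largest component is at most the sum of all p-th powers.\<close>
  have bound: "ennreal (norm (U z) powr p)
      \<le> ennreal (real CARD('n) powr p) * (\<Sum>i\<in>UNIV. ennreal (\<bar>g i z\<bar> powr p) * indicator A z)" for z
  proof (cases "z \<in> A")
    case True
    define m where "m = Max (range (\<lambda>i. \<bar>g i z\<bar>))"
    have m: "\<bar>g i z\<bar> \<le> m" for i unfolding m_def by (intro Max_ge) auto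
    have m0: "0 \<le> m" using m[of undefined] by linarith
    have "m \<in> range (\<lambda>i. \<bar>g i z\<bar>)" unfolding m_def by (intro Max_in) auto
    then obtain j where j: "m = \<bar>g j z\<bar>" by auto
    have "norm (U z) \<le> (\<Sum>i\<in>UNIV. \<bar>U z $ i\<bar>)" by (rule norm_le_l1_cart)
    also have "\<dots> \<le> (\<Sum>i\<in>(UNIV::'n set). m)" using m True by (intro sum_mono) (simp add: U_def)
    also have "\<dots> = real CARD('n) * m" by simp
    finally have "norm (U z) powr p \<le> (real CARD('n) * m) powr p"
      using p by (intro powr_mono2) auto
    also have "\<dots> = real CARD('n) powr p * \<bar>g j z\<bar> powr p" using m0 j by (simp add: powr_mult)
    also have "\<dots> \<le> real CARD('n) powr p * (\<Sum>i\<in>UNIV. \<bar>g i z\<bar> powr p)"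
      by (intro mult_left_mono member_le_sum) auto
    finally have "ennreal (norm (U z) powr p) \<le> ennreal (real CARD('n) powr p * (\<Sum>i\<in>UNIV. \<bar>g i z\<bar> powr p))"
      by (rule ennreal_leI)
    then show ?thesis using True by (simp add: ennreal_mult sum_nonneg sum_ennreal)
  qed (use p in \<open>simp add: U_def\<close>)
  have "(\<integral>\<^sup>+z. ennreal (norm (U z) powr p) \<partial>lborel)
      \<le> (\<integral>\<^sup>+z. ennreal (real CARD('n) powr p) * (\<Sum>i\<in>UNIV. ennreal (\<bar>g i z\<bar> powr p) * indicator A z) \<partial>lborel)"
    using bound by (intro nn_integral_mono) auto
  also have "\<dots> = ennreal (real CARD('n) powr p) * (\<Sum>i\<in>UNIV. \<integral>\<^sup>+z\<in>A. ennreal (\<bar>g i z\<bar> powr p) \<partial>lborel)"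
    by (subst nn_integral_cmult, measurable, subst nn_integral_sum, measurable)
  also have "\<dots> < \<infinity>"
    using gp by (auto simp: ennreal_mult_less_top)
  finally have fin: "(\<integral>\<^sup>+z. ennreal (norm (U z) powr p) \<partial>lborel) < \<infinity>" .
  have "(\<lambda>z. \<chi> i. g i z) \<in> borel_measurable borel"
    by (subst borel_measurable_euclidean_space) (auto simp: Basis_vec_def inner_axis)
  then have "U \<in> borel_measurable borel" unfolding U_def[abs_def] by measurable
  then show thesis using AE fin by (intro that[of U]) (auto simp: U_def)
qed

lemma Lpn_onI:
  fixes H :: "'a::euclidean_space \<Rightarrow> real^'n"
  assumes "H \<in> borel_measurable borel" "A \<in> sets borel" "p \<ge> 1"
    "(\<integral>\<^sup>+z\<in>A. ennreal (norm (H z) powr p) \<partial>lborel) < \<infinity>"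
  shows "Lpn_on p A H"
  unfolding Lpn_on_def Lp_on_def nn_integral_completion
proof (intro allI conjI)
  fix i
  have "(\<lambda>z. H z $ i) \<in> borel_measurable borel"
    using assms(1) by (simp add: cart_eq_inner_axis)
  then show "(\<lambda>z. H z $ i) \<in> borel_measurable (lebesgue_on A)"
    by (intro measurable_restrict_space1) (simp add: measurable_completion)
  have "(\<integral>\<^sup>+z\<in>A. ennreal (\<bar>H z $ i\<bar> powr p) \<partial>lborel) \<le> (\<integral>\<^sup>+z\<in>A. ennreal (norm (H z) powr p) \<partial>lborel)"
    using assms(3) component_le_norm_cart
    by (intro nn_integral_mono mult_right_mono ennreal_leI powr_mono2) auto
  also have "\<dots> < \<infinity>" by fact
  finally show "(\<integral>\<^sup>+z\<in>A. ennreal (\<bar>H z $ i\<bar> powr p) \<partial>lborel) < \<infinity>" .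
qed

text \<open>On A the norm is at most 1 plus its p-th power, and A has finite measure; primitives and
  Fubini can thus be handled with plain integrability.\<close>

lemma integrable_if_powr_finite:
  fixes U :: "'a::euclidean_space \<Rightarrow> 'b::euclidean_space"
  assumes U: "U \<in> borel_measurable borel" "\<And>z. z \<notin> A \<Longrightarrow> U z = 0"
    "(\<integral>\<^sup>+z. ennreal (norm (U z) powr p) \<partial>lborel) < \<infinity>"
    and A: "A \<in> sets borel" "emeasure lborel A < \<infinity>" and p: "p \<ge> 1"
  shows "integrable lborel U"
proof (rule Bochner_Integration.integrable_bound)
  have "integrable lborel (\<lambda>z. norm (U z) powr p)"
    by (rule integrableI_nonneg) (use U in auto)
  moreover have "integrable lborel (indicator A :: 'a \<Rightarrow> real)"
    using A by (simp add: integrable_indicator_iff)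
  ultimately show "integrable lborel (\<lambda>z. indicator A z + norm (U z) powr p)" by simp
  have "norm (U z) \<le> norm (indicator A z + norm (U z) powr p)" for z
  proof (cases "z \<in> A")
    case True
    show ?thesis
    proof (cases "norm (U z) \<le> 1")
      case False
      then have "norm (U z) powr 1 \<le> norm (U z) powr p" using p by (intro powr_mono) auto
      then show ?thesis using False True by simp
    qed (use True in \<open>simp add: add_increasing2\<close>)
  qed (use U(2) in simp)
  then show "AE z in lborel. norm (U z) \<le> norm (indicator A z + norm (U z) powr p)" by simp
qed (use U in simp)

section \<open>Traces\<close>

text \<open>\<open>trace_x\<close> is a choice among candidates, so it can be computed only through
  uniqueness. Two candidates are both close, in p-th power mean, to one common slice near the line x
  = e, hence to each other.\<close>

lemma is_trace_x_unique:
  fixes w W :: "real \<times> real \<Rightarrow> real^'n"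
  assumes p: "p \<ge> 1" and cd: "c < d" and e: "e \<in> {c..d}"
    and W: "W \<in> borel_measurable borel" "AE z in lborel. z \<in> {a<..<b} \<times> {c<..<d} \<longrightarrow> w z = W z"
    and h: "is_trace_x p a b c d e w h1" "is_trace_x p a b c d e w h2"
  shows "AE t in lborel. t \<in> {a<..<b} \<longrightarrow> h1 t = h2 t"
proof -
  let ?I = "{a<..<b}"
  have L: "Lpn_on p ?I h1" "Lpn_on p ?I h2" using h by (auto simp: is_trace_x_def)
  obtain H1 where H1: "H1 \<in> borel_measurable borel" "AE t in lborel. t \<in> ?I \<longrightarrow> H1 t = h1 t"
    using Lpn_on_borel_rep[OF L(1) _ p] by (metis borel_open open_greaterThanLessThan)
  obtain H2 where H2: "H2 \<in> borel_measurable borel" "AE t in lborel. t \<in> ?I \<longrightarrow> H2 t = h2 t"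
    using Lpn_on_borel_rep[OF L(2) _ p] by (metis borel_open open_greaterThanLessThan)
  note [measurable] = W(1) H1(1) H2(1)
  have [measurable]: "W \<in> borel_measurable (borel \<Otimes>\<^sub>M borel)" using W by (simp add: borel_prod)
  define D where "D = (\<integral>\<^sup>+t\<in>?I. ennreal (norm (H1 t - H2 t) powr p) \<partial>lborel)"
  have small: "D \<le> ennreal (2 powr p * (\<epsilon> + \<epsilon>))" if "\<epsilon> > 0" for \<epsilon> :: real
  proof -
    obtain \<delta>1 \<delta>2 where \<delta>: "\<delta>1 > 0" "\<delta>2 > 0"
      "AE x in lebesgue. x \<in> {c<..<d} \<and> \<bar>x - e\<bar> < \<delta>1 \<longrightarrow>
        (\<integral>\<^sup>+t\<in>?I. ennreal (norm (w (t, x) - h1 t) powr p) \<partial>lebesgue) < ennreal \<epsilon>"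
      "AE x in lebesgue. x \<in> {c<..<d} \<and> \<bar>x - e\<bar> < \<delta>2 \<longrightarrow>
        (\<integral>\<^sup>+t\<in>?I. ennreal (norm (w (t, x) - h2 t) powr p) \<partial>lebesgue) < ennreal \<epsilon>"
      using h \<open>\<epsilon> > 0\<close> unfolding is_trace_x_def by blast
    define \<delta> where "\<delta> = min \<delta>1 \<delta>2"
    have "AE x in lborel. AE t in lborel. (t, x) \<in> ?I \<times> {c<..<d} \<longrightarrow> w (t, x) = W (t, x)"
      using AE_lborel_pair_snd[OF W(2)] .
    with \<delta>(3,4)[unfolded AE_completion_iff]
    have "AE x in lborel. x \<in> {c<..<d} \<and> \<bar>x - e\<bar> < \<delta> \<longrightarrow>
        (AE t in lborel. (t, x) \<in> ?I \<times> {c<..<d} \<longrightarrow> w (t, x) = W (t, x)) \<and>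
        (\<integral>\<^sup>+t\<in>?I. ennreal (norm (w (t, x) - h1 t) powr p) \<partial>lebesgue) < ennreal \<epsilon> \<and>
        (\<integral>\<^sup>+t\<in>?I. ennreal (norm (w (t, x) - h2 t) powr p) \<partial>lebesgue) < ennreal \<epsilon>"
      unfolding \<delta>_def min_less_iff_conj by eventually_elim blast
    \<comment> \<open>e may be an endpoint, so the line is sought in the part of its neighbourhood
      that lies inside (c, d).\<close>
    moreover have "max c (e - \<delta>) < min d (e + \<delta>)" using cd e \<delta> by (auto simp: \<delta>_def)
    ultimately have "\<exists>x. max c (e - \<delta>) < x \<and> x < min d (e + \<delta>) \<and> (x \<in> {c<..<d} \<and> \<bar>x - e\<bar> < \<delta> \<longrightarrow>
        (AE t in lborel. (t, x) \<in> ?I \<times> {c<..<d} \<longrightarrow> w (t, x) = W (t, x)) \<and>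
        (\<integral>\<^sup>+t\<in>?I. ennreal (norm (w (t, x) - h1 t) powr p) \<partial>lebesgue) < ennreal \<epsilon> \<and>
        (\<integral>\<^sup>+t\<in>?I. ennreal (norm (w (t, x) - h2 t) powr p) \<partial>lebesgue) < ennreal \<epsilon>)"
      by (rule AE_imp_ex_in_interval)
    then obtain x where x: "x \<in> {c<..<d}" "\<bar>x - e\<bar> < \<delta>"
      "AE t in lborel. (t, x) \<in> ?I \<times> {c<..<d} \<longrightarrow> w (t, x) = W (t, x)"
      "(\<integral>\<^sup>+t\<in>?I. ennreal (norm (w (t, x) - h1 t) powr p) \<partial>lborel) < ennreal \<epsilon>"
      "(\<integral>\<^sup>+t\<in>?I. ennreal (norm (w (t, x) - h2 t) powr p) \<partial>lborel) < ennreal \<epsilon>"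
      by (auto simp: abs_less_iff nn_integral_completion)
    have 1: "(\<integral>\<^sup>+t\<in>?I. ennreal (norm (W (t, x) - H1 t) powr p) \<partial>lborel) \<le> ennreal \<epsilon>"
    proof -
      have "(\<integral>\<^sup>+t\<in>?I. ennreal (norm (W (t, x) - H1 t) powr p) \<partial>lborel)
          = (\<integral>\<^sup>+t\<in>?I. ennreal (norm (w (t, x) - h1 t) powr p) \<partial>lborel)"
        using x(3) H1(2) by (intro nn_integral_cong_AE, eventually_elim) (use x(1) in \<open>auto simp: indicator_def\<close>)
      then show ?thesis using x(4) by simp
    qed
    have 2: "(\<integral>\<^sup>+t\<in>?I. ennreal (norm (W (t, x) - H2 t) powr p) \<partial>lborel) \<le> ennreal \<epsilon>"
    proof -
      have "(\<integral>\<^sup>+t\<in>?I. ennreal (norm (W (t, x) - H2 t) powr p) \<partial>lborel)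
          = (\<integral>\<^sup>+t\<in>?I. ennreal (norm (w (t, x) - h2 t) powr p) \<partial>lborel)"
        using x(3) H2(2) by (intro nn_integral_cong_AE, eventually_elim) (use x(1) in \<open>auto simp: indicator_def\<close>)
      then show ?thesis using x(5) by simp
    qed
    have "D \<le> (\<integral>\<^sup>+t. ennreal (2 powr p) * (ennreal (norm (W (t, x) - H1 t) powr p) * indicator ?I t
        + ennreal (norm (W (t, x) - H2 t) powr p) * indicator ?I t) \<partial>lborel)"
      unfolding D_def
    proof (rule nn_integral_mono)
      fix t
      have "norm (H1 t - H2 t) powr p \<le> 2 powr p * (norm (W (t, x) - H1 t) powr p + norm (W (t, x) - H2 t) powr p)"
        using powr_norm_add_le[of p "H1 t - W (t, x)" "W (t, x) - H2 t"] p by (simp add: norm_minus_commute)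
      then have "ennreal (norm (H1 t - H2 t) powr p)
          \<le> ennreal (2 powr p) * (ennreal (norm (W (t, x) - H1 t) powr p) + ennreal (norm (W (t, x) - H2 t) powr p))"
        by (simp add: ennreal_leI flip: ennreal_mult ennreal_plus)
      then show "ennreal (norm (H1 t - H2 t) powr p) * indicator ?I t \<le> ennreal (2 powr p) *
          (ennreal (norm (W (t, x) - H1 t) powr p) * indicator ?I t
           + ennreal (norm (W (t, x) - H2 t) powr p) * indicator ?I t)"
        by (auto simp: indicator_def)
    qed
    also have "\<dots> = ennreal (2 powr p) * ((\<integral>\<^sup>+t\<in>?I. ennreal (norm (W (t, x) - H1 t) powr p) \<partial>lborel)
        + (\<integral>\<^sup>+t\<in>?I. ennreal (norm (W (t, x) - H2 t) powr p) \<partial>lborel))"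
      by (subst nn_integral_cmult, measurable, subst nn_integral_add, measurable)
    also have "\<dots> \<le> ennreal (2 powr p) * (ennreal \<epsilon> + ennreal \<epsilon>)"
      using 1 2 by (intro mult_left_mono add_mono) auto
    also have "\<dots> = ennreal (2 powr p * (\<epsilon> + \<epsilon>))"
      using \<open>\<epsilon> > 0\<close> by (simp flip: ennreal_mult ennreal_plus)
    finally show ?thesis .
  qed
  have "D \<le> ennreal r" if "r > 0" for r :: real
    using small[of "r / (2 powr p * 2)"] that by (simp add: field_simps)
  then have "D = 0"
    by (metis ennreal_le_epsilon add_0 le_zero_eq zero_less_iff_neq_zero)
  then have "AE t in lborel. ennreal (norm (H1 t - H2 t) powr p) * indicator ?I t = 0"
    unfolding D_def by (subst (asm) nn_integral_0_iff_AE) auto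
  with H1(2) H2(2) show ?thesis
    by eventually_elim (auto simp: indicator_def)
qed

text \<open>The difference is an integral over an interval of length \<bar>x - e\<bar> \<le> 1, for
  which Jensen's inequality holds with constant 1. The symmetric interval on the right covers both
  positions of x and grows with \<bar>x - e\<bar>, so one bound serves all x in a
  neighbourhood.\<close>

lemma primitive_diff_powr_le:
  fixes g :: "real \<Rightarrow> 'b::euclidean_space"
  assumes p: "p \<ge> 1" and g: "integrable lborel g" and "c \<le> x" "c \<le> e" and xe: "\<bar>x - e\<bar> \<le> 1"
  shows "ennreal (norm ((LINT \<xi>:{c..x}|lborel. g \<xi>) - (LINT \<xi>:{c..e}|lborel. g \<xi>)) powr p)
    \<le> (\<integral>\<^sup>+\<xi>\<in>{e - \<bar>x - e\<bar>..e + \<bar>x - e\<bar>}. ennreal (norm (g \<xi>) powr p) \<partial>lborel)"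
proof -
  let ?J = "{min x e<..max x e}"
  have si: "set_integrable lborel A g" if "A \<in> sets lborel" for A
    using g integrable_mult_indicator[OF that g] by (simp add: set_integrable_def)
  have split: "(LINT \<xi>:{c..v}|lborel. g \<xi>) = (LINT \<xi>:{c..u}|lborel. g \<xi>) + (LINT \<xi>:{u<..v}|lborel. g \<xi>)"
    if "c \<le> u" "u \<le> v" for u v
  proof -
    have "{c..v} = {c..u} \<union> {u<..v}" using that by auto
    moreover have "{c..u} \<inter> {u<..v} = {}" by auto
    ultimately show ?thesis by (simp only: set_integral_Un si sets_lborel atLeastAtMost_borel greaterThanAtMost_borel)
  qed
  have "norm ((LINT \<xi>:{c..x}|lborel. g \<xi>) - (LINT \<xi>:{c..e}|lborel. g \<xi>)) = norm (LINT \<xi>:?J|lborel. g \<xi>)"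
    using split[of x e] split[of e x] assms by (cases "x \<le> e") auto
  also have "\<dots> \<le> (LINT \<xi>:?J|lborel. norm (g \<xi>))"
    unfolding set_lebesgue_integral_def
    using integral_norm_bound[of lborel "\<lambda>\<xi>. indicator ?J \<xi> *\<^sub>R g \<xi>"] by simp
  finally have "ennreal (norm ((LINT \<xi>:{c..x}|lborel. g \<xi>) - (LINT \<xi>:{c..e}|lborel. g \<xi>)) powr p)
      \<le> ennreal ((LINT \<xi>:?J|lborel. norm (g \<xi>)) powr p)"
    using p by (intro ennreal_leI powr_mono2) auto
  also have "\<dots> \<le> (\<integral>\<^sup>+\<xi>\<in>?J. ennreal (norm (g \<xi>) powr p) \<partial>lborel)"
    using xe g p by (intro powr_set_integral_le) (auto simp: ennreal_le_1 abs_le_iff max_def min_def)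
  also have "\<dots> \<le> (\<integral>\<^sup>+\<xi>\<in>{e - \<bar>x - e\<bar>..e + \<bar>x - e\<bar>}. ennreal (norm (g \<xi>) powr p) \<partial>lborel)"
    by (intro nn_integral_mono) (auto simp: indicator_def)
  finally show ?thesis .
qed

text \<open>The strips shrink to a line, which is a null set of the plane, and k itself dominates;
  this is where the uniform smallness required of a trace comes from.\<close>

lemma strip_integral_tendsto_0:
  fixes k :: "real \<times> real \<Rightarrow> real"
  assumes k: "k \<in> borel_measurable borel" "\<And>z. 0 \<le> k z" "(\<integral>\<^sup>+z. ennreal (k z) \<partial>lborel) < \<infinity>" and "\<epsilon> > 0"
  obtains \<delta> where "0 < \<delta>" "\<delta> \<le> 1"
    "(\<integral>\<^sup>+z\<in>UNIV \<times> {e - \<delta>..e + \<delta>}. ennreal (k z) \<partial>lborel) < ennreal \<epsilon>"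
proof -
  note [measurable] = k(1)
  define \<delta> where "\<delta> n = 1 / real (Suc n)" for n
  define S where "S n = (UNIV :: real set) \<times> {e - \<delta> n..e + \<delta> n}" for n :: nat
  have S[measurable]: "S n \<in> sets (borel :: (real \<times> real) measure)" for n
    unfolding S_def by (auto intro!: borel_closed closed_Times)
  have ki: "integrable lborel k" by (rule integrableI_nonneg) (use k in auto)
  have "(\<lambda>n. \<integral>z. indicator (S n) z * k z \<partial>lborel) \<longlonglongrightarrow> (\<integral>z. 0 \<partial>(lborel :: (real \<times> real) measure))"
  proof (rule integral_dominated_convergence[where w = k])
    have "emeasure lborel (UNIV \<times> {e} :: (real \<times> real) set) = 0"
      unfolding lborel_prod[symmetric] by (subst lborel.emeasure_pair_measure_Times) auto
    then have "AE z in lborel. z \<notin> (UNIV \<times> {e} :: (real \<times> real) set)"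
      by (intro AE_not_in) (auto simp: null_sets_def intro!: borel_closed closed_Times)
    then show "AE z in lborel. (\<lambda>n. indicator (S n) z * k z) \<longlonglongrightarrow> 0"
    proof eventually_elim
      case (elim z)
      then have "0 < \<bar>snd z - e\<bar>" by (cases z) auto
      moreover have "\<delta> \<longlonglongrightarrow> 0"
        unfolding \<delta>_def[abs_def] using LIMSEQ_inverse_real_of_nat by (simp add: inverse_eq_divide)
      ultimately have "\<forall>\<^sub>F n in sequentially. \<delta> n < \<bar>snd z - e\<bar>"
        by (rule order_tendstoD[rotated])
      then have "\<forall>\<^sub>F n in sequentially. indicator (S n) z * k z = 0"
        by eventually_elim (auto simp: S_def indicator_def)
      then show ?case by (rule tendsto_eventually)
    qed
    show "AE z in lborel. norm (indicator (S n) z * k z) \<le> k z" for n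
      using k(2) by (auto simp: indicator_def)
  qed (use ki in auto)
  then have "\<forall>\<^sub>F n in sequentially. (\<integral>z. indicator (S n) z * k z \<partial>lborel) < \<epsilon>"
    using \<open>\<epsilon> > 0\<close> by (intro order_tendstoD) auto
  then obtain n where n: "(\<integral>z. indicator (S n) z * k z \<partial>lborel) < \<epsilon>"
    by (auto dest: eventually_happens)
  have "(\<integral>\<^sup>+z\<in>S n. ennreal (k z) \<partial>lborel) = (\<integral>\<^sup>+z. ennreal (indicator (S n) z * k z) \<partial>lborel)"
    by (intro nn_integral_cong) (auto simp: indicator_def)
  also have "\<dots> = ennreal (\<integral>z. indicator (S n) z * k z \<partial>lborel)"
    using k(2) integrable_mult_indicator[OF _ ki, of "S n"] by (intro nn_integral_eq_integral) auto
  also have "\<dots> < ennreal \<epsilon>" using n \<open>\<epsilon> > 0\<close> by (intro ennreal_lessI)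
  finally show thesis by (intro that[of "\<delta> n"]) (auto simp: S_def \<delta>_def)
qed

text \<open>The primitive makes sense at x = e itself, where W has no definite values. Its value
  there, \<open>H\<close>, is a trace because slices at nearby x differ from it only by the integral
  of g over a short interval; uniqueness then identifies the chosen trace with
  \<open>H\<close>.\<close>

lemma trace_x_eq_primitive:
  fixes w W g :: "real \<times> real \<Rightarrow> real^'n"
  assumes p: "p \<ge> 1" and cd: "c < d" and e: "e \<in> {c..d}"
    and W: "W \<in> borel_measurable borel" "AE z in lborel. z \<in> {a<..<b} \<times> {c<..<d} \<longrightarrow> w z = W z"
      "(\<integral>\<^sup>+z. ennreal (norm (W z) powr p) \<partial>lborel) < \<infinity>"
    and g: "integrable lborel g" "(\<integral>\<^sup>+z. ennreal (norm (g z) powr p) \<partial>lborel) < \<infinity>"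
    and C: "C \<in> borel_measurable borel"
    and prim: "AE z in lborel. z \<in> {a<..<b} \<times> {c<..<d} \<longrightarrow>
      W z = C (fst z) + (LINT \<xi>:{c..snd z}|lborel. g (fst z, \<xi>))"
  shows "AE t in lborel. t \<in> {a<..<b} \<longrightarrow>
      trace_x p a b c d e w t = C t + (LINT \<xi>:{c..e}|lborel. g (t, \<xi>))"
proof -
  let ?I = "{a<..<b}"
  define H where "H t = C t + (LINT \<xi>:{c..e}|lborel. g (t, \<xi>))" for t
  define k where "k z = norm (g z) powr p" for z
  have [measurable]: "g \<in> borel_measurable borel" using g by auto
  note [measurable] = W(1) C
  have [measurable]: "g \<in> borel_measurable (borel \<Otimes>\<^sub>M borel)" "W \<in> borel_measurable (borel \<Otimes>\<^sub>M borel)"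
    unfolding borel_prod by measurable
  have H[measurable]: "H \<in> borel_measurable borel"
  proof -
    have "(\<lambda>t. LINT \<xi>:{c..e}|lborel. g (t, \<xi>)) \<in> borel_measurable borel"
      unfolding set_lebesgue_integral_def by (rule lborel.borel_measurable_lebesgue_integral) measurable
    then show ?thesis unfolding H_def[abs_def] by measurable
  qed
  have k: "k \<in> borel_measurable borel" "\<And>z. 0 \<le> k z" "(\<integral>\<^sup>+z. ennreal (k z) \<partial>lborel) < \<infinity>"
    using g unfolding k_def[abs_def] by auto
  note [measurable] = k(1)
  have [measurable]: "k \<in> borel_measurable (borel \<Otimes>\<^sub>M borel)" unfolding borel_prod by measurable
  have AEg: "AE t in lborel. integrable lborel (\<lambda>\<xi>. g (t, \<xi>))"
    using g lborel_AE_integrable_fst by blast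
  \<comment> \<open>The right-hand side is free of x: the bound in each slice is integrated over t
    and becomes an integral over a strip of the plane.\<close>
  have near: "AE x in lborel. x \<in> {c<..<d} \<and> \<bar>x - e\<bar> \<le> \<delta> \<longrightarrow>
      (\<integral>\<^sup>+t\<in>?I. ennreal (norm (W (t, x) - H t) powr p) \<partial>lborel)
        \<le> (\<integral>\<^sup>+z\<in>UNIV \<times> {e - \<delta>..e + \<delta>}. ennreal (k z) \<partial>lborel)" if "\<delta> \<le> 1" for \<delta>
    using AE_lborel_pair_snd[OF prim]
  proof eventually_elim
    case (elim x)
    show ?case
    proof
      assume x: "x \<in> {c<..<d} \<and> \<bar>x - e\<bar> \<le> \<delta>"
      have "AE t in lborel. ennreal (norm (W (t, x) - H t) powr p) * indicator ?I t
          \<le> (\<integral>\<^sup>+\<xi>. ennreal (k (t, \<xi>)) * indicator (UNIV \<times> {e - \<delta>..e + \<delta>}) (t, \<xi>) \<partial>lborel)"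
        using elim AEg
      proof eventually_elim
        case (elim t)
        show ?case
        proof (cases "t \<in> ?I")
          case True
          have "W (t, x) - H t = (LINT \<xi>:{c..x}|lborel. g (t, \<xi>)) - (LINT \<xi>:{c..e}|lborel. g (t, \<xi>))"
            using elim(1) True x by (simp add: H_def)
          then have "ennreal (norm (W (t, x) - H t) powr p)
              \<le> (\<integral>\<^sup>+\<xi>\<in>{e - \<bar>x - e\<bar>..e + \<bar>x - e\<bar>}. ennreal (norm (g (t, \<xi>)) powr p) \<partial>lborel)"
            using primitive_diff_powr_le[OF p elim(2), of c x e] x e that by auto
          also have "\<dots> \<le> (\<integral>\<^sup>+\<xi>. ennreal (k (t, \<xi>)) * indicator (UNIV \<times> {e - \<delta>..e + \<delta>}) (t, \<xi>) \<partial>lborel)"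
            using x by (intro nn_integral_mono) (auto simp: k_def indicator_def)
          finally show ?thesis using True by simp
        qed simp
      qed
      then have "(\<integral>\<^sup>+t\<in>?I. ennreal (norm (W (t, x) - H t) powr p) \<partial>lborel)
          \<le> (\<integral>\<^sup>+t. \<integral>\<^sup>+\<xi>. ennreal (k (t, \<xi>)) * indicator (UNIV \<times> {e - \<delta>..e + \<delta>}) (t, \<xi>) \<partial>lborel \<partial>lborel)"
        by (rule nn_integral_mono_AE)
      also have "\<dots> = (\<integral>\<^sup>+z\<in>UNIV \<times> {e - \<delta>..e + \<delta>}. ennreal (k z) \<partial>lborel)"
        unfolding lborel_prod[symmetric] by (rule lborel.nn_integral_fst) measurable
      finally show "(\<integral>\<^sup>+t\<in>?I. ennreal (norm (W (t, x) - H t) powr p) \<partial>lborel)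
        \<le> (\<integral>\<^sup>+z\<in>UNIV \<times> {e - \<delta>..e + \<delta>}. ennreal (k z) \<partial>lborel)" .
    qed
  qed
  have "Lpn_on p ?I H"
  proof (rule Lpn_onI[OF H _ p])
    \<comment> \<open>\<open>H\<close> inherits its finite p-th power from one good slice: pick a
      line on which W has finite p-th power and the distance to \<open>H\<close> is controlled by
      \<open>near\<close> with \<delta> = 1.\<close>
    have "AE x in lborel. (\<integral>\<^sup>+t. ennreal (norm (W (t, x)) powr p) \<partial>lborel) \<noteq> \<infinity>"
    proof (rule nn_integral_PInf_AE)
      show "(\<lambda>x. \<integral>\<^sup>+t. ennreal (norm (W (t, x)) powr p) \<partial>lborel) \<in> borel_measurable lborel"
        by (rule lborel.borel_measurable_nn_integral) measurable
      have "(\<integral>\<^sup>+x. \<integral>\<^sup>+t. ennreal (norm (W (t, x)) powr p) \<partial>lborel \<partial>lborel)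
          = (\<integral>\<^sup>+z. ennreal (norm (W z) powr p) \<partial>lborel)"
        unfolding lborel_prod[symmetric]
        using lborel_pair.nn_integral_snd[of "\<lambda>z. ennreal (norm (W z) powr p)"] by simp
      then show "(\<integral>\<^sup>+x. \<integral>\<^sup>+t. ennreal (norm (W (t, x)) powr p) \<partial>lborel \<partial>lborel) \<noteq> \<infinity>"
        using W(3) by simp
    qed
    with near[OF order_refl] have "AE x in lborel. (\<integral>\<^sup>+t. ennreal (norm (W (t, x)) powr p) \<partial>lborel) \<noteq> \<infinity> \<and>
      (x \<in> {c<..<d} \<and> \<bar>x - e\<bar> \<le> 1 \<longrightarrow>
      (\<integral>\<^sup>+t\<in>?I. ennreal (norm (W (t, x) - H t) powr p) \<partial>lborel)
        \<le> (\<integral>\<^sup>+z\<in>UNIV \<times> {e - 1..e + 1}. ennreal (k z) \<partial>lborel))"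
      by eventually_elim blast
    moreover have "max c (e - 1) < min d (e + 1)" using cd e by auto
    ultimately have "\<exists>x. max c (e - 1) < x \<and> x < min d (e + 1) \<and>
      (\<integral>\<^sup>+t. ennreal (norm (W (t, x)) powr p) \<partial>lborel) \<noteq> \<infinity> \<and>
      (x \<in> {c<..<d} \<and> \<bar>x - e\<bar> \<le> 1 \<longrightarrow>
      (\<integral>\<^sup>+t\<in>?I. ennreal (norm (W (t, x) - H t) powr p) \<partial>lborel)
        \<le> (\<integral>\<^sup>+z\<in>UNIV \<times> {e - 1..e + 1}. ennreal (k z) \<partial>lborel))"
      by (rule AE_imp_ex_in_interval)
    then obtain x where x: "max c (e - 1) < x" "x < min d (e + 1)"
      "(\<integral>\<^sup>+t. ennreal (norm (W (t, x)) powr p) \<partial>lborel) \<noteq> \<infinity>"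
      "x \<in> {c<..<d} \<and> \<bar>x - e\<bar> \<le> 1 \<longrightarrow>
      (\<integral>\<^sup>+t\<in>?I. ennreal (norm (W (t, x) - H t) powr p) \<partial>lborel)
        \<le> (\<integral>\<^sup>+z\<in>UNIV \<times> {e - 1..e + 1}. ennreal (k z) \<partial>lborel)" by blast
    have "(\<integral>\<^sup>+t\<in>?I. ennreal (norm (W (t, x) - H t) powr p) \<partial>lborel)
        \<le> (\<integral>\<^sup>+z\<in>UNIV \<times> {e - 1..e + 1}. ennreal (k z) \<partial>lborel)"
      using x(1,2) by (intro x(4)[rule_format]) auto
    also have "\<dots> \<le> (\<integral>\<^sup>+z. ennreal (k z) \<partial>lborel)"
      by (intro nn_integral_mono) (auto simp: indicator_def)
    also have "\<dots> < \<infinity>" by fact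
    finally have fin: "(\<integral>\<^sup>+t\<in>?I. ennreal (norm (W (t, x) - H t) powr p) \<partial>lborel) < \<infinity>" .
    have "(\<integral>\<^sup>+t\<in>?I. ennreal (norm (H t) powr p) \<partial>lborel)
        \<le> (\<integral>\<^sup>+t. ennreal (2 powr p) * (ennreal (norm (W (t, x)) powr p)
            + ennreal (norm (W (t, x) - H t) powr p) * indicator ?I t) \<partial>lborel)"
    proof (rule nn_integral_mono)
      fix t
      have "norm (H t) powr p \<le> 2 powr p * (norm (W (t, x)) powr p + norm (W (t, x) - H t) powr p)"
        using powr_norm_add_le[of p "W (t, x)" "H t - W (t, x)"] p by (simp add: norm_minus_commute)
      then have "ennreal (norm (H t) powr p)
          \<le> ennreal (2 powr p) * (ennreal (norm (W (t, x)) powr p) + ennreal (norm (W (t, x) - H t) powr p))"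
        by (simp add: ennreal_leI flip: ennreal_mult ennreal_plus)
      then show "ennreal (norm (H t) powr p) * indicator ?I t \<le> ennreal (2 powr p) *
          (ennreal (norm (W (t, x)) powr p) + ennreal (norm (W (t, x) - H t) powr p) * indicator ?I t)"
        by (auto simp: indicator_def)
    qed
    also have "\<dots> = ennreal (2 powr p) * ((\<integral>\<^sup>+t. ennreal (norm (W (t, x)) powr p) \<partial>lborel)
        + (\<integral>\<^sup>+t\<in>?I. ennreal (norm (W (t, x) - H t) powr p) \<partial>lborel))"
      by (subst nn_integral_cmult, measurable, subst nn_integral_add, measurable)
    also have "\<dots> < \<infinity>"
      using x(3) fin by (auto simp: ennreal_mult_less_top less_top)
    finally show "(\<integral>\<^sup>+t\<in>?I. ennreal (norm (H t) powr p) \<partial>lborel) < \<infinity>" .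
  qed simp
  have trH: "is_trace_x p a b c d e w H"
    unfolding is_trace_x_def
  proof (intro conjI allI impI)
    fix \<epsilon> :: real assume "\<epsilon> > 0"
    obtain \<delta> where \<delta>: "0 < \<delta>" "\<delta> \<le> 1"
      "(\<integral>\<^sup>+z\<in>UNIV \<times> {e - \<delta>..e + \<delta>}. ennreal (k z) \<partial>lborel) < ennreal \<epsilon>"
      using strip_integral_tendsto_0[OF k \<open>\<epsilon> > 0\<close>] .
    have "AE x in lborel. x \<in> {c<..<d} \<and> \<bar>x - e\<bar> < \<delta> \<longrightarrow>
        (\<integral>\<^sup>+t\<in>?I. ennreal (norm (w (t, x) - H t) powr p) \<partial>lebesgue) < ennreal \<epsilon>"
      using near[OF \<delta>(2)] AE_lborel_pair_snd[OF W(2)]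
    proof eventually_elim
      case (elim x)
      show ?case
      proof
        assume x: "x \<in> {c<..<d} \<and> \<bar>x - e\<bar> < \<delta>"
        have "(\<integral>\<^sup>+t\<in>?I. ennreal (norm (w (t, x) - H t) powr p) \<partial>lborel)
            = (\<integral>\<^sup>+t\<in>?I. ennreal (norm (W (t, x) - H t) powr p) \<partial>lborel)"
          using elim(2) by (intro nn_integral_cong_AE, eventually_elim) (use x in \<open>auto simp: indicator_def\<close>)
        also have "\<dots> \<le> (\<integral>\<^sup>+z\<in>UNIV \<times> {e - \<delta>..e + \<delta>}. ennreal (k z) \<partial>lborel)"
          using x by (intro elim(1)[rule_format]) auto
        also have "\<dots> < ennreal \<epsilon>" by fact
        finally show "(\<integral>\<^sup>+t\<in>?I. ennreal (norm (w (t, x) - H t) powr p) \<partial>lebesgue) < ennreal \<epsilon>"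
          by (simp add: nn_integral_completion)
      qed
    qed
    with \<delta>(1) show "\<exists>\<delta>>0. AE x in lebesgue. x \<in> {c<..<d} \<and> \<bar>x - e\<bar> < \<delta> \<longrightarrow>
        (\<integral>\<^sup>+t\<in>?I. ennreal (norm (w (t, x) - H t) powr p) \<partial>lebesgue) < ennreal \<epsilon>"
      by (blast intro: AE_completion)
  qed fact
  \<comment> \<open>\<open>H\<close> witnesses that some trace exists, so the chosen one has the
    defining property.\<close>
  then have "is_trace_x p a b c d e w (trace_x p a b c d e w)"
    unfolding trace_x_def by (rule someI[where P = "is_trace_x p a b c d e w"])
  from is_trace_x_unique[OF p cd e W(1,2) this trH] show ?thesis
    by (simp add: H_def)
qed

text \<open>Both definitions are the same formula with the coordinates exchanged, so the trace on t
  = t0 is a special case of the theory in x.\<close>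

lemma trace_t_eq_trace_x_swap: "trace_t p t0 t1 x0 x1 a w = trace_x p x0 x1 t0 t1 a (w \<circ> prod.swap)"
  by (simp add: trace_t_def trace_x_def is_trace_t_def is_trace_x_def)

section \<open>Tensor products of test functions\<close>

text \<open>The bridge between the integrals in the definitions, taken over the completion with
  arbitrary representatives, and those over Borel representatives.\<close>

lemma lebesgue_integral_eq_lborel:
  fixes f F :: "'a::euclidean_space \<Rightarrow> 'b::euclidean_space"
  assumes "F \<in> borel_measurable borel" "AE z in lborel. F z = f z"
  shows "integral\<^sup>L lebesgue f = integral\<^sup>L lborel F"
proof -
  have F: "F \<in> borel_measurable lebesgue" using assms(1) by (simp add: measurable_completion)
  have AE: "AE z in lebesgue. F z = f z" using assms(2) by (rule AE_completion)
  have "integral\<^sup>L lebesgue f = integral\<^sup>L lebesgue F"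
    using F borel_measurable_AE[OF F AE] AE by (intro integral_cong_AE) auto
  also have "\<dots> = integral\<^sup>L lborel F" using assms(1) by (simp add: integral_completion)
  finally show ?thesis .
qed

lemma smooth1_funpow_deriv: "smooth1 f \<Longrightarrow> smooth1 ((deriv ^^ n) f)"
  by (induction n) (auto intro: smooth1_deriv)

lemma smooth1_funpow_deriv_Suc:
  "smooth1 f \<Longrightarrow> ((deriv ^^ n) f has_real_derivative (deriv ^^ Suc n) f x) (at x)"
  using smooth1_deriv(1)[OF smooth1_funpow_deriv] by simp

lemma pd_tensor:
  assumes "smooth1 \<psi>" "smooth1 \<eta>"
  shows "pd i j (\<lambda>z. \<psi> (fst z) * \<eta> (snd z)) = (\<lambda>z. (deriv ^^ i) \<psi> (fst z) * (deriv ^^ j) \<eta> (snd z))"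
proof -
  have px: "(px ^^ j) (\<lambda>z. \<psi> (fst z) * \<eta> (snd z)) = (\<lambda>z. \<psi> (fst z) * (deriv ^^ j) \<eta> (snd z))"
  proof (induction j)
    case (Suc j)
    have "px (\<lambda>z. \<psi> (fst z) * (deriv ^^ j) \<eta> (snd z)) = (\<lambda>z. \<psi> (fst z) * (deriv ^^ Suc j) \<eta> (snd z))"
    proof
      fix z show "px (\<lambda>z. \<psi> (fst z) * (deriv ^^ j) \<eta> (snd z)) z = \<psi> (fst z) * (deriv ^^ Suc j) \<eta> (snd z)"
        using DERIV_cmult[OF smooth1_funpow_deriv_Suc[OF assms(2), of j "snd z"], of "\<psi> (fst z)"]
        by (simp add: px_def DERIV_imp_deriv)
    qed
    then show ?case using Suc by simp
  qed simp
  have "(pt ^^ i) (\<lambda>z. \<psi> (fst z) * (deriv ^^ j) \<eta> (snd z)) = (\<lambda>z. (deriv ^^ i) \<psi> (fst z) * (deriv ^^ j) \<eta> (snd z))"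
  proof (induction i)
    case (Suc i)
    have "pt (\<lambda>z. (deriv ^^ i) \<psi> (fst z) * (deriv ^^ j) \<eta> (snd z)) = (\<lambda>z. (deriv ^^ Suc i) \<psi> (fst z) * (deriv ^^ j) \<eta> (snd z))"
    proof
      fix z show "pt (\<lambda>z. (deriv ^^ i) \<psi> (fst z) * (deriv ^^ j) \<eta> (snd z)) z = (deriv ^^ Suc i) \<psi> (fst z) * (deriv ^^ j) \<eta> (snd z)"
        using DERIV_cmult_right[OF smooth1_funpow_deriv_Suc[OF assms(1), of i "fst z"], of "(deriv ^^ j) \<eta> (snd z)"]
        by (simp add: pt_def DERIV_imp_deriv)
    qed
    then show ?case using Suc by simp
  qed simp
  then show ?thesis by (simp add: pd_def px)
qed

lemma test_fun_tensor:
  assumes \<psi>: "test_fun1 t0 t1 \<psi>" and \<eta>: "test_fun1 x0 x1 \<eta>"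
  shows "test_fun (rect t0 t1 x0 x1) (\<lambda>z. \<psi> (fst z) * \<eta> (snd z))"
proof -
  from \<psi> obtain a b where ab: "smooth1 \<psi>" "t0 < a" "b < t1" "\<And>x. x \<notin> {a..b} \<Longrightarrow> \<psi> x = 0"
    by (auto simp: test_fun1_def)
  from \<eta> obtain c d where cd: "smooth1 \<eta>" "x0 < c" "d < x1" "\<And>x. x \<notin> {c..d} \<Longrightarrow> \<eta> x = 0"
    by (auto simp: test_fun1_def)
  have "smooth2 (\<lambda>z. \<psi> (fst z) * \<eta> (snd z))"
    unfolding smooth2_def pd_tensor[OF ab(1) cd(1)]
  proof (intro allI conjI)
    fix i j
    show "continuous_on UNIV (\<lambda>z. (deriv ^^ i) \<psi> (fst z) * (deriv ^^ j) \<eta> (snd z))"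
      by (intro continuous_intros continuous_on_compose2[OF smooth1_continuous[OF smooth1_funpow_deriv]] ab cd) auto
    fix z
    show "((\<lambda>s. (deriv ^^ i) \<psi> (fst (s, snd z)) * (deriv ^^ j) \<eta> (snd (s, snd z))) has_real_derivative
        (deriv ^^ Suc i) \<psi> (fst z) * (deriv ^^ j) \<eta> (snd z)) (at (fst z))"
      using DERIV_cmult_right[OF smooth1_funpow_deriv_Suc[OF ab(1), of i "fst z"], of "(deriv ^^ j) \<eta> (snd z)"]
      by simp
    show "((\<lambda>y. (deriv ^^ i) \<psi> (fst (fst z, y)) * (deriv ^^ j) \<eta> (snd (fst z, y))) has_real_derivative
        (deriv ^^ i) \<psi> (fst z) * (deriv ^^ Suc j) \<eta> (snd z)) (at (snd z))"
      using DERIV_cmult[OF smooth1_funpow_deriv_Suc[OF cd(1), of j "snd z"], of "(deriv ^^ i) \<psi> (fst z)"]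
      by simp
  qed
  moreover have sub: "closure {z. \<psi> (fst z) * \<eta> (snd z) \<noteq> 0} \<subseteq> {a..b} \<times> {c..d}"
  proof (rule closure_minimal)
    show "{z. \<psi> (fst z) * \<eta> (snd z) \<noteq> 0} \<subseteq> {a..b} \<times> {c..d}"
      using ab(4) cd(4) by (force simp: mem_Times_iff)
  qed (intro closed_Times closed_atLeastAtMost)
  moreover have "compact (closure {z. \<psi> (fst z) * \<eta> (snd z) \<noteq> 0})"
    using bounded_subset[OF compact_imp_bounded[OF compact_Times[OF compact_Icc compact_Icc]] sub]
    by (simp add: compact_eq_bounded_closed)
  ultimately show ?thesis
    unfolding test_fun_def rect_def using ab cd by fastforce
qed

lemma rect_borel: "rect t0 t1 x0 x1 \<in> sets borel"
  by (simp add: rect_def open_Times)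

lemma emeasure_rect_finite: "emeasure lborel (rect t0 t1 x0 x1) < \<infinity>"
proof -
  have "emeasure lborel (rect t0 t1 x0 x1) = emeasure lborel {t0<..<t1} * emeasure lborel {x0<..<x1}"
    unfolding rect_def lborel_prod[symmetric] by (rule lborel.emeasure_pair_measure_Times) auto
  also have "\<dots> < \<infinity>"
    by (cases "t0 \<le> t1"; cases "x0 \<le> x1") (auto simp: ennreal_mult_less_top)
  finally show ?thesis .
qed

text \<open>Since \<open>U\<close> and \<open>V\<close> vanish outside the rectangle, the defining
  identity becomes one between integrals over the whole plane, open to Fubini.\<close>

lemma weak_deriv_tensor:
  fixes u v U V :: "real \<times> real \<Rightarrow> real^'n"
  assumes w: "is_weak_deriv (rect t0 t1 x0 x1) i j u v"
    and U: "U \<in> borel_measurable borel" "\<And>z. z \<notin> rect t0 t1 x0 x1 \<Longrightarrow> U z = 0"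
      "AE z in lborel. z \<in> rect t0 t1 x0 x1 \<longrightarrow> U z = u z"
    and V: "V \<in> borel_measurable borel" "\<And>z. z \<notin> rect t0 t1 x0 x1 \<Longrightarrow> V z = 0"
      "AE z in lborel. z \<in> rect t0 t1 x0 x1 \<longrightarrow> V z = v z"
    and \<psi>: "test_fun1 t0 t1 \<psi>" and \<eta>: "test_fun1 x0 x1 \<eta>"
  shows "(\<integral>z. ((deriv ^^ i) \<psi> (fst z) * (deriv ^^ j) \<eta> (snd z)) *\<^sub>R U z \<partial>lborel)
    = ((-1::real) ^ (i + j)) *\<^sub>R (\<integral>z. (\<psi> (fst z) * \<eta> (snd z)) *\<^sub>R V z \<partial>lborel)"
proof -
  let ?G = "rect t0 t1 x0 x1"
  have "test_fun1 t0 t1 ((deriv ^^ i) \<psi>)" "test_fun1 x0 x1 ((deriv ^^ j) \<eta>)"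
    using \<psi> \<eta> by (induction i; induction j; auto intro: test_fun1_deriv)+
  note m = test_fun1_tensor_measurable[OF this] test_fun1_tensor_measurable[OF \<psi> \<eta>]
  have 1: "(LINT z:?G|lebesgue. ((deriv ^^ i) \<psi> (fst z) * (deriv ^^ j) \<eta> (snd z)) *\<^sub>R u z)
      = (\<integral>z. ((deriv ^^ i) \<psi> (fst z) * (deriv ^^ j) \<eta> (snd z)) *\<^sub>R U z \<partial>lborel)"
    unfolding set_lebesgue_integral_def
  proof (rule lebesgue_integral_eq_lborel)
    show "AE z in lborel. ((deriv ^^ i) \<psi> (fst z) * (deriv ^^ j) \<eta> (snd z)) *\<^sub>R U z
        = indicator ?G z *\<^sub>R ((deriv ^^ i) \<psi> (fst z) * (deriv ^^ j) \<eta> (snd z)) *\<^sub>R u z"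
      using U(3) by eventually_elim (use U(2) in \<open>auto simp: indicator_def\<close>)
  qed (use m U in auto)
  have 2: "(LINT z:?G|lebesgue. (\<psi> (fst z) * \<eta> (snd z)) *\<^sub>R v z)
      = (\<integral>z. (\<psi> (fst z) * \<eta> (snd z)) *\<^sub>R V z \<partial>lborel)"
    unfolding set_lebesgue_integral_def
  proof (rule lebesgue_integral_eq_lborel)
    show "AE z in lborel. (\<psi> (fst z) * \<eta> (snd z)) *\<^sub>R V z
        = indicator ?G z *\<^sub>R (\<psi> (fst z) * \<eta> (snd z)) *\<^sub>R v z"
      using V(3) by eventually_elim (use V(2) in \<open>auto simp: indicator_def\<close>)
  qed (use m V in auto)
  show ?thesis
    using w[unfolded is_weak_deriv_def, rule_format, OF test_fun_tensor[OF \<psi> \<eta>]]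
    unfolding pd_tensor[OF test_fun1_props(1)[OF \<psi>] test_fun1_props(1)[OF \<eta>]] 1 2 .
qed

section \<open>Taylor expansion and the block matrix\<close>

lemma bounded_linear_vector_matrix_mult: "bounded_linear (\<lambda>x. x v* (A :: real^'n^'m))"
  by (rule linear_conv_bounded_linear[THEN iffD1]) (simp add: linear_iff algebra_simps scaleR_vector_matrix_assoc)

lemma bounded_linear_vector_matrix_mult_right: "bounded_linear (\<lambda>A. x v* (A :: real^'n^'m))"
  by (rule linear_conv_bounded_linear[THEN iffD1]) (simp add: linear_iff algebra_simps vector_scaleR_matrix_ac)

text \<open>\<open>gamma_mat\<close> carries \<open>gam k j\<close> in block row j and block column
  k, so this is block (j, m) of the identity gamma ** inverse = 1. The transposed placement is what
  row vectors require: \<open>gam\<close> has to stand to the left of \<open>Kblk\<close>.\<close>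

lemma gam_Kblk:
  fixes \<alpha> \<beta> :: "nat \<Rightarrow> nat \<Rightarrow> real^'n^'n"
  assumes det: "det (gamma_mat x0 x1 \<alpha> \<beta>) \<noteq> 0" and j: "j \<in> {1,2,3}" and m: "m \<in> {1,2,3}"
  shows "(\<Sum>k\<in>{1,2,3}. gam x0 x1 \<alpha> \<beta> k j ** Kblk x0 x1 \<alpha> \<beta> k m) = (if j = m then mat 1 else 0)"
proof -
  let ?\<Gamma> = "gamma_mat x0 x1 \<alpha> \<beta>"
  let ?V = "matrix_inv ?\<Gamma>"
  have "invertible ?\<Gamma>" using det by (simp add: invertible_det_nz)
  then have inv: "?\<Gamma> ** ?V = mat 1"
    unfolding invertible_def matrix_inv_def by (rule someI2_ex) blast
  \<comment> \<open>\<open>bidx\<close> sends every number other than 1 and 2 to \<open>B3\<close>,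
    so the restriction to {1, 2, 3} matters.\<close>
  have bi: "bnat (bidx i) = i" if "i \<in> {1,2,3}" for i
    using that by (auto simp: numeral_2_eq_2 numeral_3_eq_3)
  have "(\<Sum>k\<in>{1,2,3}. gam x0 x1 \<alpha> \<beta> k j ** Kblk x0 x1 \<alpha> \<beta> k m) $ a $ b
      = (if j = m then mat 1 else 0) $ a $ b" for a b
  proof -
    have "(\<Sum>k\<in>{1,2,3}. gam x0 x1 \<alpha> \<beta> k j ** Kblk x0 x1 \<alpha> \<beta> k m) $ a $ b
        = (\<Sum>k\<in>{1,2,3}. \<Sum>l\<in>UNIV. ?\<Gamma> $ (a, bidx j) $ (l, bidx k) * ?V $ (l, bidx k) $ (b, bidx m))"
      unfolding sum_component matrix_matrix_mult_def
      by (intro sum.cong) (use bi j in \<open>simp_all add: Kblk_def blk_of_def gamma_mat_def blkmat_def\<close>)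
    also have "\<dots> = (\<Sum>kk\<in>UNIV. \<Sum>l\<in>UNIV. ?\<Gamma> $ (a, bidx j) $ (l, kk) * ?V $ (l, kk) $ (b, bidx m))"
      by (simp add: UNIV_blk numeral_2_eq_2 numeral_3_eq_3)
    also have "\<dots> = (\<Sum>l\<in>UNIV. \<Sum>kk\<in>UNIV. ?\<Gamma> $ (a, bidx j) $ (l, kk) * ?V $ (l, kk) $ (b, bidx m))"
      by (rule sum.swap)
    also have "\<dots> = (\<Sum>r\<in>UNIV. ?\<Gamma> $ (a, bidx j) $ r * ?V $ r $ (b, bidx m))"
      by (simp add: sum.cartesian_product flip: UNIV_Times_UNIV)
    also have "\<dots> = (?\<Gamma> ** ?V) $ (a, bidx j) $ (b, bidx m)"
      by (simp add: matrix_matrix_mult_def)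
    also have "\<dots> = (if j = m then mat 1 else 0) $ a $ b"
      using bi[OF j] bi[OF m] by (auto simp: inv mat_def)
    finally show ?thesis .
  qed
  then show ?thesis by (simp add: vec_eq_iff)
qed

text \<open>The algebraic core: applying the boundary functionals to a quadratic polynomial with
  coefficients c0, c1, c2 gives the bracketed vectors, and by \<open>gam_Kblk\<close> the functions
  \<open>beta_fun\<close> reconstruct the polynomial from them.\<close>

lemma sum_gam_beta_fun:
  fixes \<alpha> \<beta> :: "nat \<Rightarrow> nat \<Rightarrow> real^'n^'n"
  assumes det: "det (gamma_mat x0 x1 \<alpha> \<beta>) \<noteq> 0"
  shows "(\<Sum>k\<in>{1,2,3}. (c0 v* gam x0 x1 \<alpha> \<beta> k 1 + c1 v* gam x0 x1 \<alpha> \<beta> k 2 + c2 v* gam x0 x1 \<alpha> \<beta> k 3)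
      v* beta_fun x0 x1 \<alpha> \<beta> k x) = c0 + (x - x0) *\<^sub>R c1 + ((x - x0)\<^sup>2 / 2) *\<^sub>R c2"
proof -
  \<comment> \<open>\<open>P m\<close> is the Taylor monomial of degree m - 1 at x0, and
    \<open>beta_fun k\<close> is the combination of the blocks \<open>Kblk k m\<close> with these
    weights.\<close>
  define P where "P m = (if m = 1 then 1 else if m = 2 then x - x0 else (x - x0)\<^sup>2 / 2)" for m :: nat
  define c where "c j = (if j = 1 then c0 else if j = 2 then c1 else c2)" for j :: nat
  let ?g = "gam x0 x1 \<alpha> \<beta>" and ?K = "Kblk x0 x1 \<alpha> \<beta>"
  have b: "beta_fun x0 x1 \<alpha> \<beta> k x = (\<Sum>m\<in>{1,2,3}. P m *\<^sub>R ?K k m)" for k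
    by (simp add: beta_fun_def P_def)
  have "(\<Sum>k\<in>{1,2,3}. (\<Sum>j\<in>{1,2,3}. c j v* ?g k j) v* beta_fun x0 x1 \<alpha> \<beta> k x)
      = (\<Sum>k\<in>{1,2,3}. \<Sum>j\<in>{1,2,3}. \<Sum>m\<in>{1,2,3}. P m *\<^sub>R (c j v* (?g k j ** ?K k m)))"
    unfolding b
    by (simp add: linear_sum[OF bounded_linear.linear[OF bounded_linear_vector_matrix_mult]]
        linear_sum[OF bounded_linear.linear[OF bounded_linear_vector_matrix_mult_right]]
        vector_matrix_mul_assoc vector_scaleR_matrix_ac scaleR_sum_right del: sum.insert)
       (rule sum.cong[OF refl], rule sum.swap)
  also have "\<dots> = (\<Sum>j\<in>{1,2,3}. \<Sum>m\<in>{1,2,3}. \<Sum>k\<in>{1,2,3}. P m *\<^sub>R (c j v* (?g k j ** ?K k m)))"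
    by (subst sum.swap, rule sum.cong[OF refl], subst sum.swap, rule refl)
  also have "\<dots> = (\<Sum>j\<in>{1,2,3}. \<Sum>m\<in>{1,2,3}. P m *\<^sub>R (c j v* (if j = m then mat 1 else 0)))"
  proof (intro sum.cong refl)
    fix j m :: nat assume jm: "j \<in> {1,2,3}" "m \<in> {1,2,3}"
    show "(\<Sum>k\<in>{1,2,3}. P m *\<^sub>R (c j v* (?g k j ** ?K k m))) = P m *\<^sub>R (c j v* (if j = m then mat 1 else 0))"
      unfolding gam_Kblk[OF det jm, symmetric]
      by (simp add: linear_sum[OF bounded_linear.linear[OF bounded_linear_vector_matrix_mult_right]]
          scaleR_sum_right del: sum.insert)
  qed
  also have "\<dots> = c0 + (x - x0) *\<^sub>R c1 + ((x - x0)\<^sup>2 / 2) *\<^sub>R c2"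
    by (simp add: P_def c_def)
  finally show ?thesis by (simp add: c_def add.assoc)
qed

text \<open>One step of Taylor's formula with integral remainder, for a function known only through
  its primitive: integration by parts trades h for the constant q and the derivative h'.\<close>

lemma taylor_step:
  fixes h h' :: "real \<Rightarrow> 'b::euclidean_space"
  assumes h: "integrable lborel h" and h': "integrable lborel h'"
    and prim: "AE y in lborel. y \<in> {c<..<d} \<longrightarrow> h y = q + (LINT \<xi>:{c..y}|lborel. h' \<xi>)"
    and x: "x \<in> {c..d}"
  shows "(LINT \<xi>:{c..x}|lborel. ((x - \<xi>) ^ n / fact n) *\<^sub>R h \<xi>)
    = ((x - c) ^ Suc n / fact (Suc n)) *\<^sub>R q
      + (LINT \<xi>:{c..x}|lborel. ((x - \<xi>) ^ Suc n / fact (Suc n)) *\<^sub>R h' \<xi>)"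
proof -
  define k where "k = (\<lambda>\<xi>. (x - \<xi>) ^ n / fact n :: real)"
  \<comment> \<open>The antiderivative of \<open>k\<close> that vanishes at x: then \<kappa> x -
    \<kappa> \<xi> is the next Taylor weight, and at \<xi> = c it is the coefficient of q.\<close>
  define \<kappa> where "\<kappa> = (\<lambda>\<xi>. - ((x - \<xi>) ^ Suc n / fact (Suc n)) :: real)"
  define P where "P y = (LINT \<xi>:{c..y}|lborel. h' \<xi>)" for y
  have \<kappa>: "(\<kappa> has_real_derivative k \<xi>) (at \<xi>)" for \<xi>
  proof -
    have "(\<kappa> has_real_derivative - (real (Suc n) * (x - \<xi>) ^ n * (- 1) / fact (Suc n))) (at \<xi>)"
      unfolding \<kappa>_def by (rule derivative_eq_intros refl | simp)+
    moreover have "real (Suc n) * y * (- 1) / fact (Suc n) = - (y / fact n)" for y :: real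
      by (simp only: fact_Suc of_nat_mult) (simp add: divide_simps)
    ultimately show ?thesis by (simp only: k_def minus_minus)
  qed
  have k: "continuous_on UNIV k" unfolding k_def by (intro continuous_intros) auto
  have [measurable]: "k \<in> borel_measurable borel" "h \<in> borel_measurable borel" "h' \<in> borel_measurable borel"
    using k h h' by (auto intro: borel_measurable_continuous_onI)
  \<comment> \<open>Measurability of a one-variable primitive is read off from a slice of the
    two-variable lemma.\<close>
  have [measurable]: "P \<in> borel_measurable borel"
  proof -
    have "(\<lambda>z::real \<times> real. h' (snd z)) \<in> borel_measurable borel"
      unfolding borel_prod[symmetric] by measurable
    from borel_measurable_primitive[OF this, of c]
    have "(\<lambda>z::real \<times> real. P (snd z)) \<in> borel_measurable (borel \<Otimes>\<^sub>M borel)"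
      by (simp add: P_def borel_prod)
    from measurable_compose[OF measurable_Pair1' this, of 0] show ?thesis by simp
  qed
  have "compact (k ` {c..x})"
    by (intro compact_continuous_image continuous_on_subset[OF k]) auto
  then obtain B where B: "\<And>\<xi>. \<xi> \<in> {c..x} \<Longrightarrow> \<bar>k \<xi>\<bar> \<le> B"
    by (metis compact_imp_bounded bounded_iff image_eqI real_norm_def)
  have kh: "integrable lborel (\<lambda>\<xi>. indicator {c..x} \<xi> *\<^sub>R k \<xi> *\<^sub>R h \<xi>)"
  proof (rule Bochner_Integration.integrable_bound)
    show "integrable lborel (\<lambda>\<xi>. B *\<^sub>R h \<xi>)" using h by simp
    have "norm (indicator {c..x} \<xi> *\<^sub>R k \<xi> *\<^sub>R h \<xi>) \<le> norm (B *\<^sub>R h \<xi>)" for \<xi>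
      using B[of \<xi>] by (auto simp: indicator_def intro!: mult_right_mono)
    then show "AE \<xi> in lborel. norm (indicator {c..x} \<xi> *\<^sub>R k \<xi> *\<^sub>R h \<xi>) \<le> norm (B *\<^sub>R h \<xi>)" by simp
  qed simp
  have kq: "has_bochner_integral lborel (\<lambda>\<xi>. (k \<xi> * indicator {c..x} \<xi>) *\<^sub>R q) ((\<kappa> x - \<kappa> c) *\<^sub>R q)"
    using x k \<kappa> by (intro has_bochner_integral_scaleR_left has_bochner_integral_FTC_Icc_real)
      (auto simp: continuous_on_eq_continuous_at)
  have "(LINT \<xi>:{c..x}|lborel. (\<kappa> x - \<kappa> \<xi>) *\<^sub>R h' \<xi>) = (LINT y:{c..x}|lborel. k y *\<^sub>R P y)"
    unfolding P_def by (rule primitive_by_parts[symmetric, OF h' \<kappa> k])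
  also have "\<dots> = (\<integral>\<xi>. indicator {c..x} \<xi> *\<^sub>R k \<xi> *\<^sub>R h \<xi> - (k \<xi> * indicator {c..x} \<xi>) *\<^sub>R q \<partial>lborel)"
    unfolding set_lebesgue_integral_def
  proof (rule integral_cong_AE)
    \<comment> \<open>\<open>prim\<close> speaks about the open interval; the endpoints c and d,
      which x may reach, are discarded as null sets.\<close>
    show "AE y in lborel. indicator {c..x} y *\<^sub>R k y *\<^sub>R P y
        = indicator {c..x} y *\<^sub>R k y *\<^sub>R h y - (k y * indicator {c..x} y) *\<^sub>R q"
      using prim AE_lborel_singleton[of c] AE_lborel_singleton[of d]
      by eventually_elim (use x in \<open>auto simp: indicator_def P_def algebra_simps\<close>)
  qed measurable
  also have "\<dots> = (LINT \<xi>:{c..x}|lborel. k \<xi> *\<^sub>R h \<xi>) - (\<kappa> x - \<kappa> c) *\<^sub>R q"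
    unfolding set_lebesgue_integral_def
    using kh kq by (simp add: has_bochner_integral_iff)
  finally show ?thesis
    by (simp add: \<kappa>_def k_def algebra_simps)
qed

text \<open>The first formula is one step on \<open>W2\<close> with weight 1. The second is one step
  on \<open>W1\<close> with weight 1, followed by a step on \<open>W2\<close> with weight x -
  \<xi>.\<close>

lemma taylor_of_primitives:
  fixes W1 W2 W3 :: "real \<Rightarrow> 'b::euclidean_space"
  assumes W: "integrable lborel W1" "integrable lborel W2" "integrable lborel W3"
    and "AE y in lborel. y \<in> {c<..<d} \<longrightarrow> W1 y = c1 + (LINT \<xi>:{c..y}|lborel. W2 \<xi>)"
    and "AE y in lborel. y \<in> {c<..<d} \<longrightarrow> W2 y = c2 + (LINT \<xi>:{c..y}|lborel. W3 \<xi>)"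
    and x: "x \<in> {c..d}"
  shows "(LINT \<xi>:{c..x}|lborel. W2 \<xi>) = (x - c) *\<^sub>R c2 + (LINT \<xi>:{c..x}|lborel. (x - \<xi>) *\<^sub>R W3 \<xi>)"
    and "(LINT \<xi>:{c..x}|lborel. W1 \<xi>) = (x - c) *\<^sub>R c1 + ((x - c)\<^sup>2 / 2) *\<^sub>R c2
      + (LINT \<xi>:{c..x}|lborel. ((x - \<xi>)\<^sup>2 / 2) *\<^sub>R W3 \<xi>)"
  using taylor_step[OF W(2,3) assms(5) x, of 0] taylor_step[OF W(2,3) assms(5) x, of 1]
    taylor_step[OF W(1,2) assms(4) x, of 0]
  by (simp_all add: power2_eq_square algebra_simps)

section \<open>The kernel\<close>

text \<open>The spatial factor of \<open>R0\<close>: with the Heaviside function in time split off,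
  the identity can be proved for one fixed \<tau>.\<close>

definition R0_kernel :: "real \<Rightarrow> real \<Rightarrow> (nat \<Rightarrow> nat \<Rightarrow> real^'n^'n) \<Rightarrow> (nat \<Rightarrow> nat \<Rightarrow> real^'n^'n)
    \<Rightarrow> real \<Rightarrow> real \<Rightarrow> real^'n^'n" where
  "R0_kernel x0 x1 \<alpha> \<beta> \<xi> x = ((x - \<xi>)\<^sup>2 / fact 2 * heaviside (x - \<xi>)) *\<^sub>R mat 1
     + (\<Sum>k\<in>{1,2,3}. a_fun x1 \<beta> k \<xi> ** q_fun x0 x1 \<alpha> \<beta> k x)"

lemma R0_eq_kernel: "R0 x0 x1 \<alpha> \<beta> w z = heaviside (fst z - fst w) *\<^sub>R R0_kernel x0 x1 \<alpha> \<beta> (snd w) (snd z)"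
  by (simp add: R0_def R0_kernel_def Let_def)

lemma vector_matrix_mult_minus_right: "x v* (- A) = - (x v* (A :: real^'n^'m))"
  by (rule linear_neg[OF bounded_linear.linear[OF bounded_linear_vector_matrix_mult_right]])

lemma vector_mult_R0_kernel:
  "v v* R0_kernel x0 x1 \<alpha> \<beta> \<xi> x = ((x - \<xi>)\<^sup>2 / 2 * heaviside (x - \<xi>)) *\<^sub>R v
     - (\<Sum>k\<in>{1,2,3}. (v v* a_fun x1 \<beta> k \<xi>) v* beta_fun x0 x1 \<alpha> \<beta> k x)"
proof -
  have "v v* R0_kernel x0 x1 \<alpha> \<beta> \<xi> x = ((x - \<xi>)\<^sup>2 / 2 * heaviside (x - \<xi>)) *\<^sub>R v
     + (\<Sum>k\<in>{1,2,3}. - ((v v* a_fun x1 \<beta> k \<xi>) v* beta_fun x0 x1 \<alpha> \<beta> k x))"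
    unfolding R0_kernel_def vector_matrix_mult_add_rdistrib vector_scaleR_matrix_ac
      linear_sum[OF bounded_linear.linear[OF bounded_linear_vector_matrix_mult_right]]
      vector_matrix_mul_assoc[symmetric] q_fun_def vector_matrix_mult_minus_right
    by simp
  then show ?thesis unfolding sum_negf by simp
qed

section \<open>Integration against the kernel\<close>

lemma integrable_scaleR_bounded:
  fixes V :: "'a \<Rightarrow> 'b::{banach, second_countable_topology}"
  assumes "integrable M V" "f \<in> borel_measurable M" "\<And>z. V z \<noteq> 0 \<Longrightarrow> \<bar>f z\<bar> \<le> B"
  shows "integrable M (\<lambda>z. f z *\<^sub>R V z)"
proof (rule Bochner_Integration.integrable_bound)
  show "integrable M (\<lambda>z. B *\<^sub>R V z)" using assms by simp
  have "norm (f z *\<^sub>R V z) \<le> norm (B *\<^sub>R V z)" for z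
    using assms(3)[of z] by (cases "V z = 0") (auto intro!: mult_right_mono)
  then show "AE z in M. norm (f z *\<^sub>R V z) \<le> norm (B *\<^sub>R V z)" by simp
qed (use assms in auto)

text \<open>X is the coordinate that enters the kernel: the identity on a slice, \<open>snd\<close>
  on the plane, so one set of lemmas serves both. Where V does not vanish, X stays in a compact
  interval, and continuous functions of X are bounded there.\<close>

context
  fixes V :: "'a::euclidean_space \<Rightarrow> real^'n" and X :: "'a \<Rightarrow> real" and x0 x1 :: real
  assumes V: "integrable lborel V" and X: "X \<in> borel_measurable borel"
    and supp: "\<And>z. V z \<noteq> 0 \<Longrightarrow> X z \<in> {x0..x1}"
begin

lemma integrable_continuous_scaleR:
  assumes "continuous_on UNIV f"
  shows "integrable lborel (\<lambda>z. f (X z) *\<^sub>R V z)"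
proof -
  have "compact (f ` {x0..x1})"
    by (intro compact_continuous_image continuous_on_subset[OF assms]) auto
  then obtain B where B: "\<And>\<xi>. \<xi> \<in> {x0..x1} \<Longrightarrow> \<bar>f \<xi>\<bar> \<le> B"
    by (metis compact_imp_bounded bounded_iff image_eqI real_norm_def)
  have "f \<in> borel_measurable borel" using assms by (rule borel_measurable_continuous_onI)
  then show ?thesis
    using X supp B by (intro integrable_scaleR_bounded[where B = B] V) auto
qed

lemma integrable_heaviside_scaleR:
  assumes "continuous_on UNIV f"
  shows "integrable lborel (\<lambda>z. (f (X z) * heaviside (x - X z)) *\<^sub>R V z)"
proof -
  have "heaviside \<in> borel_measurable borel" unfolding heaviside_def[abs_def] by measurable
  then have "integrable lborel (\<lambda>z. heaviside (x - X z) *\<^sub>R f (X z) *\<^sub>R V z)"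
    using X by (intro integrable_scaleR_bounded[where B = 1] integrable_continuous_scaleR assms)
      (auto simp: heaviside_def)
  then show ?thesis by (simp add: mult.commute)
qed

lemma integrable_a_fun: "integrable lborel (\<lambda>z. V z v* a_fun x1 \<beta> k (X z))"
  and integral_a_fun: "(\<integral>z. V z v* a_fun x1 \<beta> k (X z) \<partial>lborel)
    = (\<integral>z. ((x1 - X z)\<^sup>2 / 2) *\<^sub>R V z \<partial>lborel) v* \<beta> k 1
      + (\<integral>z. (x1 - X z) *\<^sub>R V z \<partial>lborel) v* \<beta> k 2 + (\<integral>z. V z \<partial>lborel) v* \<beta> k 3"
proof -
  have eq: "(\<lambda>z. V z v* a_fun x1 \<beta> k (X z)) = (\<lambda>z. (((x1 - X z)\<^sup>2 / 2) *\<^sub>R V z) v* \<beta> k 1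
      + ((x1 - X z) *\<^sub>R V z) v* \<beta> k 2 + V z v* \<beta> k 3)"
    by (simp add: a_fun_def vector_matrix_mult_add_rdistrib vector_scaleR_matrix_ac scaleR_vector_matrix_assoc)
  have i: "integrable lborel (\<lambda>z. ((x1 - X z)\<^sup>2 / 2) *\<^sub>R V z)" "integrable lborel (\<lambda>z. (x1 - X z) *\<^sub>R V z)"
    by (intro integrable_continuous_scaleR continuous_intros; simp)+
  note bl = bounded_linear_vector_matrix_mult
  note j = integrable_bounded_linear[OF bl i(1), of "\<beta> k 1"] integrable_bounded_linear[OF bl i(2), of "\<beta> k 2"]
    integrable_bounded_linear[OF bl V, of "\<beta> k 3"]
  show "integrable lborel (\<lambda>z. V z v* a_fun x1 \<beta> k (X z))"
    unfolding eq using j by (intro Bochner_Integration.integrable_add)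
  show "(\<integral>z. V z v* a_fun x1 \<beta> k (X z) \<partial>lborel)
    = (\<integral>z. ((x1 - X z)\<^sup>2 / 2) *\<^sub>R V z \<partial>lborel) v* \<beta> k 1
      + (\<integral>z. (x1 - X z) *\<^sub>R V z \<partial>lborel) v* \<beta> k 2 + (\<integral>z. V z \<partial>lborel) v* \<beta> k 3"
    unfolding eq using j
    by (simp add: integral_bounded_linear[OF bl i(1)] integral_bounded_linear[OF bl i(2)]
        integral_bounded_linear[OF bl V])
qed

lemma integrable_R0_kernel: "integrable lborel (\<lambda>z. V z v* R0_kernel x0 x1 \<alpha> \<beta> (X z) x)"
  and integral_R0_kernel: "(\<integral>z. V z v* R0_kernel x0 x1 \<alpha> \<beta> (X z) x \<partial>lborel)
    = (\<integral>z. ((x - X z)\<^sup>2 / 2 * heaviside (x - X z)) *\<^sub>R V z \<partial>lborel)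
      - (\<Sum>k\<in>{1,2,3}. (\<integral>z. V z v* a_fun x1 \<beta> k (X z) \<partial>lborel) v* beta_fun x0 x1 \<alpha> \<beta> k x)"
proof -
  have i: "integrable lborel (\<lambda>z. ((x - X z)\<^sup>2 / 2 * heaviside (x - X z)) *\<^sub>R V z)"
    by (intro integrable_heaviside_scaleR[of "\<lambda>\<xi>. (x - \<xi>)\<^sup>2 / 2"] continuous_intros) simp
  note bl = bounded_linear_vector_matrix_mult
  note j = integrable_bounded_linear[OF bl integrable_a_fun, of \<beta> _ "beta_fun x0 x1 \<alpha> \<beta> _ x"]
  show "integrable lborel (\<lambda>z. V z v* R0_kernel x0 x1 \<alpha> \<beta> (X z) x)"
    unfolding vector_mult_R0_kernel using i j
    by (intro Bochner_Integration.integrable_diff Bochner_Integration.integrable_sum)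
  show "(\<integral>z. V z v* R0_kernel x0 x1 \<alpha> \<beta> (X z) x \<partial>lborel)
    = (\<integral>z. ((x - X z)\<^sup>2 / 2 * heaviside (x - X z)) *\<^sub>R V z \<partial>lborel)
      - (\<Sum>k\<in>{1,2,3}. (\<integral>z. V z v* a_fun x1 \<beta> k (X z) \<partial>lborel) v* beta_fun x0 x1 \<alpha> \<beta> k x)"
    unfolding vector_mult_R0_kernel integral_bounded_linear[OF bl integrable_a_fun, symmetric] using i j
    by (simp add: Bochner_Integration.integral_diff Bochner_Integration.integral_sum del: sum.insert)
qed

end

text \<open>Here c0, c1, c2 stand for traces at x0 and d0, d1, d2 for those at x1. The boundary
  functional splits into a \<open>gam\<close> part and an integral \<open>J k\<close> of v; the
  terms of the kernel containing \<open>a_fun\<close> remove exactly the contribution of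
  \<open>J k\<close>, leaving the Taylor polynomial and its remainder.\<close>

lemma pointwise_representation:
  fixes \<alpha> \<beta> :: "nat \<Rightarrow> nat \<Rightarrow> real^'n^'n" and v :: "real \<Rightarrow> real^'n"
  assumes det: "det (gamma_mat x0 x1 \<alpha> \<beta>) \<noteq> 0"
    and v: "integrable lborel v" "\<And>\<xi>. \<xi> \<notin> {x0<..<x1} \<Longrightarrow> v \<xi> = 0"
    and x: "x \<in> {x0<..<x1}"
    and d0: "d0 = c0 + ((x1 - x0) *\<^sub>R c1 + ((x1 - x0)\<^sup>2 / 2) *\<^sub>R c2
      + (LINT \<xi>:{x0..x1}|lborel. ((x1 - \<xi>)\<^sup>2 / 2) *\<^sub>R v \<xi>))"
    and d1: "d1 = c1 + ((x1 - x0) *\<^sub>R c2 + (LINT \<xi>:{x0..x1}|lborel. (x1 - \<xi>) *\<^sub>R v \<xi>))"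
    and d2: "d2 = c2 + (LINT \<xi>:{x0..x1}|lborel. v \<xi>)"
  shows "c0 + ((x - x0) *\<^sub>R c1 + ((x - x0)\<^sup>2 / 2) *\<^sub>R c2
      + (LINT \<xi>:{x0..x}|lborel. ((x - \<xi>)\<^sup>2 / 2) *\<^sub>R v \<xi>))
    = (\<Sum>k\<in>{1,2,3}. (c0 v* \<alpha> k 1 + c1 v* \<alpha> k 2 + c2 v* \<alpha> k 3 + d0 v* \<beta> k 1 + d1 v* \<beta> k 2 + d2 v* \<beta> k 3)
        v* beta_fun x0 x1 \<alpha> \<beta> k x)
      + (\<integral>\<xi>. v \<xi> v* R0_kernel x0 x1 \<alpha> \<beta> \<xi> x \<partial>lborel)"
proof -
  have supp: "\<And>\<xi>. v \<xi> \<noteq> 0 \<Longrightarrow> \<xi> \<in> {x0..x1}" using v(2) by (metis atLeastAtMost_iff greaterThanLessThan_iff less_imp_le)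
  have S: "(LINT \<xi>:{x0..x1}|lborel. f \<xi> *\<^sub>R v \<xi>) = (\<integral>\<xi>. f \<xi> *\<^sub>R v \<xi> \<partial>lborel)" for f
    unfolding set_lebesgue_integral_def 
  proof (intro Bochner_Integration.integral_cong refl)
    show "indicator {x0..x1} \<xi> *\<^sub>R f \<xi> *\<^sub>R v \<xi> = f \<xi> *\<^sub>R v \<xi>" for \<xi>
      using supp[of \<xi>] by (cases "v \<xi> = 0") auto
  qed
  define J where "J k = (\<integral>\<xi>. v \<xi> v* a_fun x1 \<beta> k \<xi> \<partial>lborel)" for k
  have J: "J k = (LINT \<xi>:{x0..x1}|lborel. ((x1 - \<xi>)\<^sup>2 / 2) *\<^sub>R v \<xi>) v* \<beta> k 1
      + (LINT \<xi>:{x0..x1}|lborel. (x1 - \<xi>) *\<^sub>R v \<xi>) v* \<beta> k 2 + (LINT \<xi>:{x0..x1}|lborel. v \<xi>) v* \<beta> k 3" for k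
    unfolding J_def S using integral_a_fun[OF v(1), of "\<lambda>\<xi>. \<xi>", OF _ supp] S[of "\<lambda>_. 1"] by simp
  \<comment> \<open>This is the origin of \<open>gam\<close> and \<open>a_fun\<close>: substituting
    the Taylor formulas at x1, the powers of x1 - x0 collect in \<open>gam\<close> and the weights
    (x1 - \<xi>) of the remainders collect in \<open>a_fun\<close>.\<close>
  have L: "c0 v* \<alpha> k 1 + c1 v* \<alpha> k 2 + c2 v* \<alpha> k 3 + d0 v* \<beta> k 1 + d1 v* \<beta> k 2 + d2 v* \<beta> k 3
      = (c0 v* gam x0 x1 \<alpha> \<beta> k 1 + c1 v* gam x0 x1 \<alpha> \<beta> k 2 + c2 v* gam x0 x1 \<alpha> \<beta> k 3) + J k" for k
    unfolding J d0 d1 d2 gam_def Let_def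
    by (simp add: vector_matrix_left_distrib vector_matrix_mult_add_rdistrib vector_scaleR_matrix_ac
        scaleR_vector_matrix_assoc algebra_simps)
  have H: "(\<integral>\<xi>. ((x - \<xi>)\<^sup>2 / 2 * heaviside (x - \<xi>)) *\<^sub>R v \<xi> \<partial>lborel)
      = (LINT \<xi>:{x0..x}|lborel. ((x - \<xi>)\<^sup>2 / 2) *\<^sub>R v \<xi>)"
    unfolding set_lebesgue_integral_def
  proof (intro Bochner_Integration.integral_cong refl)
    fix \<xi>
    show "((x - \<xi>)\<^sup>2 / 2 * heaviside (x - \<xi>)) *\<^sub>R v \<xi> = indicator {x0..x} \<xi> *\<^sub>R ((x - \<xi>)\<^sup>2 / 2) *\<^sub>R v \<xi>"
      using v(2)[of \<xi>] by (cases "x0 \<le> \<xi>") (auto simp: heaviside_def)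
  qed
  have K: "(\<integral>\<xi>. v \<xi> v* R0_kernel x0 x1 \<alpha> \<beta> \<xi> x \<partial>lborel)
      = (LINT \<xi>:{x0..x}|lborel. ((x - \<xi>)\<^sup>2 / 2) *\<^sub>R v \<xi>)
        - (\<Sum>k\<in>{1,2,3}. J k v* beta_fun x0 x1 \<alpha> \<beta> k x)"
    unfolding H[symmetric] J_def by (rule integral_R0_kernel[OF v(1), of "\<lambda>\<xi>. \<xi>", OF _ supp]) simp
  define Q where "Q k = c0 v* gam x0 x1 \<alpha> \<beta> k 1 + c1 v* gam x0 x1 \<alpha> \<beta> k 2 + c2 v* gam x0 x1 \<alpha> \<beta> k 3" for k
  have "(\<Sum>k\<in>{1,2,3}. Q k v* beta_fun x0 x1 \<alpha> \<beta> k x) = c0 + (x - x0) *\<^sub>R c1 + ((x - x0)\<^sup>2 / 2) *\<^sub>R c2"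
    unfolding Q_def by (rule sum_gam_beta_fun[OF det])
  then show ?thesis
    unfolding L Q_def[symmetric] K vector_matrix_left_distrib sum.distrib by (simp add: algebra_simps)
qed

section \<open>Primitives and traces of functions in the Sobolev space\<close>

lemma borel_measurable_swap: "prod.swap \<in> borel \<rightarrow>\<^sub>M (borel :: ('a::euclidean_space \<times> 'b::euclidean_space) measure)"
  by (simp add: prod.swap_def[abs_def] borel_prod[symmetric])

lemma nn_integral_lborel_swap:
  fixes f :: "'a::euclidean_space \<times> 'b::euclidean_space \<Rightarrow> ennreal"
  assumes "f \<in> borel_measurable borel"
  shows "(\<integral>\<^sup>+z. f (prod.swap z) \<partial>lborel) = (\<integral>\<^sup>+z. f z \<partial>lborel)"
proof -
  have "(\<integral>\<^sup>+z. f z \<partial>distr lborel lborel prod.swap) = (\<integral>\<^sup>+z. f (prod.swap z) \<partial>lborel)"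
    using assms borel_measurable_swap by (intro nn_integral_distr) (auto cong: measurable_cong_sets)
  then show ?thesis by (simp add: distr_lborel_swap)
qed

lemma set_lebesgue_integral_singleton: "(LINT x:{a::real}|lborel. f x) = (0 :: 'b::euclidean_space)"
  unfolding set_lebesgue_integral_def
  by (rule integral_eq_zero_AE) (use AE_lborel_singleton[of a] in \<open>eventually_elim, auto simp: indicator_def\<close>)

lemma W13_weak_deriv:
  assumes "u \<in> W13 p G" "i \<le> 1" "j \<le> 3"
  shows "is_weak_deriv G i j u (wd p G i j u)" "Lpn_on p G (wd p G i j u)"
proof -
  have "\<exists>v. is_weak_deriv G i j u v \<and> Lpn_on p G v"
    using assms unfolding W13_def by blast
  then have "is_weak_deriv G i j u (wd p G i j u) \<and> Lpn_on p G (wd p G i j u)"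
    unfolding wd_def by (rule someI_ex)
  then show "is_weak_deriv G i j u (wd p G i j u)" "Lpn_on p G (wd p G i j u)" by auto
qed

text \<open>One set of representatives for all orders, so that the same \<open>W j\<close> occurs as
  integrand at one level and as primitive at the next; this consistency is what makes iteration
  possible.\<close>

lemma W13_primitives:
  fixes u :: "real \<times> real \<Rightarrow> real^'n"
  assumes p: "p \<ge> 1" and t: "t0 < t1" and x: "x0 < x1" and u: "u \<in> W13 p (rect t0 t1 x0 x1)"
  obtains U W C g where
    "U \<in> borel_measurable borel"
    "AE z in lborel. z \<in> rect t0 t1 x0 x1 \<longrightarrow> U z = u z"
    "(\<integral>\<^sup>+z. ennreal (norm (U z) powr p) \<partial>lborel) < \<infinity>"
    "\<And>j. j \<le> 3 \<Longrightarrow> integrable lborel (W j)"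
    "\<And>j z. j \<le> 3 \<Longrightarrow> z \<notin> rect t0 t1 x0 x1 \<Longrightarrow> W j z = 0"
    "\<And>j. j \<le> 3 \<Longrightarrow> AE z in lborel. z \<in> rect t0 t1 x0 x1 \<longrightarrow> W j z = wd p (rect t0 t1 x0 x1) 1 j u z"
    "\<And>j. j \<le> 3 \<Longrightarrow> (\<integral>\<^sup>+z. ennreal (norm (W j z) powr p) \<partial>lborel) < \<infinity>"
    "\<And>j. j \<le> 2 \<Longrightarrow> integrable lborel (C j)"
    "\<And>j. j \<le> 2 \<Longrightarrow> AE z in lborel. z \<in> rect t0 t1 x0 x1 \<longrightarrow>
      W j z = C j (fst z) + (LINT \<xi>:{x0..snd z}|lborel. W (Suc j) (fst z, \<xi>))"
    "integrable lborel g"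
    "AE z in lborel. z \<in> rect t0 t1 x0 x1 \<longrightarrow>
      U z = g (snd z) + (LINT \<tau>:{t0..fst z}|lborel. W 0 (\<tau>, snd z))"
proof -
  let ?G = "rect t0 t1 x0 x1"
  have Lu: "Lpn_on p ?G u" using u by (simp add: W13_def)
  obtain U where U: "U \<in> borel_measurable borel" "\<And>z. z \<notin> ?G \<Longrightarrow> U z = 0"
    "AE z in lborel. z \<in> ?G \<longrightarrow> U z = u z" "(\<integral>\<^sup>+z. ennreal (norm (U z) powr p) \<partial>lborel) < \<infinity>"
    using Lpn_on_borel_rep[OF Lu rect_borel p] by blast
  define Q where "Q j V \<longleftrightarrow> V \<in> borel_measurable borel \<and> (\<forall>z. z \<notin> ?G \<longrightarrow> V z = 0) \<and>
    (AE z in lborel. z \<in> ?G \<longrightarrow> V z = wd p ?G 1 j u z) \<and>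
    (\<integral>\<^sup>+z. ennreal (norm (V z) powr p) \<partial>lborel) < \<infinity>" for j and V :: "real \<times> real \<Rightarrow> real^'n"
  have "\<exists>V. Q j V" if "j \<le> 3" for j
    unfolding Q_def
    by (rule Lpn_on_borel_rep[OF W13_weak_deriv(2)[OF u order_refl that] rect_borel p]) blast
  then have "\<forall>j. \<exists>V. j \<le> 3 \<longrightarrow> Q j V" by blast
  from choice[OF this] obtain W where "\<And>j. j \<le> 3 \<Longrightarrow> Q j (W j)" by blast
  then have W: "\<And>j. j \<le> 3 \<Longrightarrow> W j \<in> borel_measurable borel"
    "\<And>j z. j \<le> 3 \<Longrightarrow> z \<notin> ?G \<Longrightarrow> W j z = 0"
    "\<And>j. j \<le> 3 \<Longrightarrow> AE z in lborel. z \<in> ?G \<longrightarrow> W j z = wd p ?G 1 j u z"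
    "\<And>j. j \<le> 3 \<Longrightarrow> (\<integral>\<^sup>+z. ennreal (norm (W j z) powr p) \<partial>lborel) < \<infinity>"
    unfolding Q_def by blast+
  have Ui: "integrable lborel U"
    using integrable_if_powr_finite[OF U(1,2,4) rect_borel emeasure_rect_finite p] by blast
  have Wi: "integrable lborel (W j)" if "j \<le> 3" for j
    using integrable_if_powr_finite[OF W(1)[OF that] W(2)[OF that] W(4)[OF that] rect_borel emeasure_rect_finite p]
    by blast
  have weak: "(\<integral>z. (deriv \<psi> (fst z) * (deriv ^^ j) \<eta> (snd z)) *\<^sub>R U z \<partial>lborel)
      = ((-1::real) ^ (1 + j)) *\<^sub>R (\<integral>z. (\<psi> (fst z) * \<eta> (snd z)) *\<^sub>R W j z \<partial>lborel)"
    if "j \<le> 3" "test_fun1 t0 t1 \<psi>" "test_fun1 x0 x1 \<eta>" for j \<psi> \<eta>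
    using weak_deriv_tensor[OF W13_weak_deriv(1)[OF u order_refl that(1)] U(1,2,3) W(1-3)[OF that(1)] that(2,3)]
    by simp
  define P where "P j C \<longleftrightarrow> integrable lborel C \<and> (AE z in lborel. z \<in> ?G \<longrightarrow>
      W j z = C (fst z) + (LINT \<xi>:{x0..snd z}|lborel. W (Suc j) (fst z, \<xi>)))" for j C
  have "\<exists>C. P j C" if j: "j \<le> 2" for j
  proof -
    have j3: "j \<le> 3" "Suc j \<le> 3" using j by auto
    \<comment> \<open>\<open>W (Suc j)\<close> is the weak x-derivative of \<open>W j\<close>:
      testing order j with \<eta>' and order j + 1 with \<eta> puts the same derivatives on the test
      function in the integral of \<open>U\<close>, and the two signs differ by one factor
      -1.\<close>
    have eqn: "(\<integral>z. (\<psi> (fst z) * deriv \<eta> (snd z)) *\<^sub>R W j z \<partial>lborel)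
        = - (\<integral>z. (\<psi> (fst z) * \<eta> (snd z)) *\<^sub>R W (Suc j) z \<partial>lborel)"
      if \<psi>: "test_fun1 t0 t1 \<psi>" and \<eta>: "test_fun1 x0 x1 \<eta>" for \<psi> \<eta>
    proof -
      have "((-1::real) ^ (1 + j)) *\<^sub>R (\<integral>z. (\<psi> (fst z) * deriv \<eta> (snd z)) *\<^sub>R W j z \<partial>lborel)
          = ((-1::real) ^ (1 + Suc j)) *\<^sub>R (\<integral>z. (\<psi> (fst z) * \<eta> (snd z)) *\<^sub>R W (Suc j) z \<partial>lborel)"
        unfolding weak[OF j3(1) \<psi> test_fun1_deriv[OF \<eta>], symmetric] weak[OF j3(2) \<psi> \<eta>, symmetric]
        by (simp only: funpow_Suc_right comp_apply)
      also have "\<dots> = ((-1::real) ^ (1 + j)) *\<^sub>R - (\<integral>z. (\<psi> (fst z) * \<eta> (snd z)) *\<^sub>R W (Suc j) z \<partial>lborel)"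
        by simp
      finally show ?thesis
        by (simp only: scaleR_cancel_left power_eq_0_iff) auto
    qed
    show ?thesis unfolding P_def rect_def
      by (rule weak_derivative_imp_primitive[OF x Wi[OF j3(1)] W(2)[OF j3(1), unfolded rect_def]
            Wi[OF j3(2)] W(2)[OF j3(2), unfolded rect_def] eqn]) blast+
  qed
  then have "\<forall>j. \<exists>C. j \<le> 2 \<longrightarrow> P j C" by blast
  from choice[OF this] obtain C where "\<And>j. j \<le> 2 \<Longrightarrow> P j (C j)" by blast
  then have C: "\<And>j. j \<le> 2 \<Longrightarrow> integrable lborel (C j)"
    "\<And>j. j \<le> 2 \<Longrightarrow> AE z in lborel. z \<in> ?G \<longrightarrow>
      W j z = C j (fst z) + (LINT \<xi>:{x0..snd z}|lborel. W (Suc j) (fst z, \<xi>))"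
    unfolding P_def by blast+
  have swap0: "z \<notin> {x0<..<x1} \<times> {t0<..<t1} \<Longrightarrow> prod.swap z \<notin> ?G" for z
    by (cases z) (auto simp: rect_def)
  \<comment> \<open>The same lemma in exchanged coordinates: \<open>W 0\<close> is the weak
    t-derivative of \<open>U\<close>, and the constant of integration becomes a function of
    x.\<close>
  obtain g where g: "integrable lborel g"
    "AE z in lborel. z \<in> {x0<..<x1} \<times> {t0<..<t1} \<longrightarrow>
      U (prod.swap z) = g (fst z) + (LINT \<tau>:{t0..snd z}|lborel. W 0 (prod.swap (fst z, \<tau>)))"
  proof (rule weak_derivative_imp_primitive[OF t, of "\<lambda>z. U (prod.swap z)" x0 x1 "\<lambda>z. W 0 (prod.swap z)"])
    show "integrable lborel (\<lambda>z. U (prod.swap z))" "integrable lborel (\<lambda>z. W 0 (prod.swap z))"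
      using Ui Wi by (auto intro: lborel_integrable_swap)
    show "U (prod.swap z) = 0" "W 0 (prod.swap z) = 0" if "z \<notin> {x0<..<x1} \<times> {t0<..<t1}" for z
      using swap0[OF that] U(2) W(2) by auto
    fix \<psi> \<eta> assume \<psi>: "test_fun1 x0 x1 \<psi>" and \<eta>: "test_fun1 t0 t1 \<eta>"
    have 1: "(\<integral>z. (\<psi> (fst z) * deriv \<eta> (snd z)) *\<^sub>R U (prod.swap z) \<partial>lborel)
        = (\<integral>z. (deriv \<eta> (fst z) * \<psi> (snd z)) *\<^sub>R U z \<partial>lborel)"
      using lborel_integral_swap[of "\<lambda>z. (deriv \<eta> (fst z) * \<psi> (snd z)) *\<^sub>R U z"]
        test_fun1_tensor_measurable[OF test_fun1_deriv[OF \<eta>] \<psi>] U(1) by (simp add: mult.commute)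
    have 2: "(\<integral>z. (\<psi> (fst z) * \<eta> (snd z)) *\<^sub>R W 0 (prod.swap z) \<partial>lborel)
        = (\<integral>z. (\<eta> (fst z) * \<psi> (snd z)) *\<^sub>R W 0 z \<partial>lborel)"
      using lborel_integral_swap[of "\<lambda>z. (\<eta> (fst z) * \<psi> (snd z)) *\<^sub>R W 0 z"]
        test_fun1_tensor_measurable[OF \<eta> \<psi>] W(1)[of 0] by (simp add: mult.commute)
    show "(\<integral>z. (\<psi> (fst z) * deriv \<eta> (snd z)) *\<^sub>R U (prod.swap z) \<partial>lborel)
        = - (\<integral>z. (\<psi> (fst z) * \<eta> (snd z)) *\<^sub>R W 0 (prod.swap z) \<partial>lborel)"
      unfolding 1 2 using weak[of 0, OF _ \<eta> \<psi>] by simp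
  qed blast
  have "AE z in lborel. z \<in> ?G \<longrightarrow> U z = g (snd z) + (LINT \<tau>:{t0..fst z}|lborel. W 0 (\<tau>, snd z))"
    using AE_lborel_swap[OF g(2)] by eventually_elim (auto simp: rect_def)
  then show thesis
    using that[of U W C g] U(1,3,4) Wi W(2,3,4) C g(1) by blast
qed

text \<open>The statement for x in exchanged coordinates, taken on the base line itself, where the
  remaining integral runs over a single point and vanishes.\<close>

lemma trace_t_eq_primitive:
  fixes w W g :: "real \<times> real \<Rightarrow> real^'n"
  assumes p: "p \<ge> 1" and cd: "c < d"
    and W: "W \<in> borel_measurable borel" "AE z in lborel. z \<in> rect c d a b \<longrightarrow> W z = w z"
      "(\<integral>\<^sup>+z. ennreal (norm (W z) powr p) \<partial>lborel) < \<infinity>"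
    and g: "integrable lborel g" "(\<integral>\<^sup>+z. ennreal (norm (g z) powr p) \<partial>lborel) < \<infinity>"
    and C: "C \<in> borel_measurable borel"
    and prim: "AE z in lborel. z \<in> rect c d a b \<longrightarrow>
      W z = C (snd z) + (LINT \<tau>:{c..fst z}|lborel. g (\<tau>, snd z))"
  shows "AE x in lborel. x \<in> {a<..<b} \<longrightarrow> trace_t p c d a b c w x = C x"
proof -
  have "AE x in lborel. x \<in> {a<..<b} \<longrightarrow>
      trace_x p a b c d c (w \<circ> prod.swap) x = C x + (LINT \<tau>:{c..c}|lborel. g (prod.swap (x, \<tau>)))"
  proof (rule trace_x_eq_primitive[OF p cd, where W = "\<lambda>z. W (prod.swap z)"])
    show "(\<lambda>z. W (prod.swap z)) \<in> borel_measurable borel"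
      using measurable_compose[OF borel_measurable_swap W(1)] .
    show "AE z in lborel. z \<in> {a<..<b} \<times> {c<..<d} \<longrightarrow> (w \<circ> prod.swap) z = W (prod.swap z)"
      using AE_lborel_swap[OF W(2)] by eventually_elim (auto simp: rect_def)
    show "(\<integral>\<^sup>+z. ennreal (norm (W (prod.swap z)) powr p) \<partial>lborel) < \<infinity>"
      using W by (subst nn_integral_lborel_swap[where f = "\<lambda>z. ennreal (norm (W z) powr p)"]) auto
    show "(\<integral>\<^sup>+z. ennreal (norm (g (prod.swap z)) powr p) \<partial>lborel) < \<infinity>"
      using g by (subst nn_integral_lborel_swap[where f = "\<lambda>z. ennreal (norm (g z) powr p)"]) auto
    show "AE z in lborel. z \<in> {a<..<b} \<times> {c<..<d} \<longrightarrow>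
      W (prod.swap z) = C (fst z) + (LINT \<xi>:{c..snd z}|lborel. g (prod.swap (fst z, \<xi>)))"
      using AE_lborel_swap[OF prim] by eventually_elim (auto simp: rect_def)
  qed (use cd C g lborel_integrable_swap in auto)
  then show ?thesis
    unfolding trace_t_eq_trace_x_swap by (simp add: set_lebesgue_integral_singleton)
qed

text \<open>A null set times the whole space is null, because infinity times zero is zero in
  \<open>ennreal\<close>.\<close>

lemma AE_lborel_snd:
  fixes P :: "'b::euclidean_space \<Rightarrow> bool"
  assumes "AE y in lborel. P y"
  shows "AE z in (lborel :: ('a::euclidean_space \<times> 'b) measure). P (snd z)"
proof -
  obtain N where N: "N \<in> sets lborel" "emeasure lborel N = 0" "{y. \<not> P y} \<subseteq> N"
    using assms by (auto elim!: AE_E)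
  have "emeasure (lborel \<Otimes>\<^sub>M lborel) ((UNIV :: 'a set) \<times> N) = emeasure lborel (UNIV :: 'a set) * emeasure lborel N"
    using N(1) by (intro lborel.emeasure_pair_measure_Times) auto
  moreover have "(UNIV :: 'a set) \<times> N \<in> sets (lborel \<Otimes>\<^sub>M lborel)"
    using N(1) by (intro pair_measureI) auto
  ultimately have "(UNIV :: 'a set) \<times> N \<in> null_sets lborel"
    using N(2) unfolding lborel_prod by (auto simp: null_sets_def)
  then show ?thesis
    by (rule AE_I') (use N(3) in auto)
qed

section \<open>The integral representation\<close>

text \<open>Equality almost everywhere is the meaning of the representation: u is a class of
  functions, and the chosen weak derivatives and traces are determined only up to null sets.\<close>

theorem mainTheorem1:
  fixes \<alpha> \<beta> :: "nat \<Rightarrow> nat \<Rightarrow> real^'n^'n"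
    and p t0 t1 x0 x1 :: real
    and u :: "real \<times> real \<Rightarrow> real^'n"
  assumes "p \<ge> 1" and "t0 < t1" and "x0 < x1"
    and "det (gamma_mat x0 x1 \<alpha> \<beta>) \<noteq> 0"
    and "u \<in> W13 p (rect t0 t1 x0 x1)"
  shows "AE z in lebesgue. z \<in> rect t0 t1 x0 x1 \<longrightarrow>
     u z = l0 p t0 t1 x0 x1 u (snd z)
         + (\<Sum>k\<in>{1,2,3}. LINT \<tau>:{t0..fst z}|lebesgue.
              lk p t0 t1 x0 x1 \<alpha> \<beta> k u \<tau> v* beta_fun x0 x1 \<alpha> \<beta> k (snd z))
         + (LINT w:rect t0 t1 x0 x1|lebesgue.
              wd p (rect t0 t1 x0 x1) 1 3 u w v* R0 x0 x1 \<alpha> \<beta> w z)"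
proof -
  let ?G = "rect t0 t1 x0 x1"
  let ?b = "\<lambda>k x. beta_fun x0 x1 \<alpha> \<beta> k x"
  note p = \<open>p \<ge> 1\<close> and t = \<open>t0 < t1\<close> and x = \<open>x0 < x1\<close>
  obtain U W C g where U: "U \<in> borel_measurable borel"
      "AE z in lborel. z \<in> ?G \<longrightarrow> U z = u z"
      "(\<integral>\<^sup>+z. ennreal (norm (U z) powr p) \<partial>lborel) < \<infinity>"
    and W: "\<And>j. j \<le> 3 \<Longrightarrow> integrable lborel (W j)"
      "\<And>j z. j \<le> 3 \<Longrightarrow> z \<notin> ?G \<Longrightarrow> W j z = 0"
      "\<And>j. j \<le> 3 \<Longrightarrow> AE z in lborel. z \<in> ?G \<longrightarrow> W j z = wd p ?G 1 j u z"
      "\<And>j. j \<le> 3 \<Longrightarrow> (\<integral>\<^sup>+z. ennreal (norm (W j z) powr p) \<partial>lborel) < \<infinity>"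
    and C: "\<And>j. j \<le> 2 \<Longrightarrow> integrable lborel (C j)"
      "\<And>j. j \<le> 2 \<Longrightarrow> AE z in lborel. z \<in> ?G \<longrightarrow>
        W j z = C j (fst z) + (LINT \<xi>:{x0..snd z}|lborel. W (Suc j) (fst z, \<xi>))"
    and g: "integrable lborel g"
      "AE z in lborel. z \<in> ?G \<longrightarrow> U z = g (snd z) + (LINT \<tau>:{t0..fst z}|lborel. W 0 (\<tau>, snd z))"
    using W13_primitives[OF p t x assms(5)] by blast
  \<comment> \<open>\<open>C j\<close> and \<open>D j\<close> are integrable versions of the traces
    of \<open>W j\<close> at x0 and x1. Accordingly \<open>M k\<close> stands in for
    \<open>lk\<close>, and \<open>N\<close> is the spatial integral of the kernel term at a fixed
    time.\<close>
  define D where "D j \<tau> = C j \<tau> + (LINT \<xi>:{x0..x1}|lborel. W (Suc j) (\<tau>, \<xi>))" for j \<tau>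
  define M where "M k \<tau> = C 0 \<tau> v* \<alpha> k 1 + C 1 \<tau> v* \<alpha> k 2 + C 2 \<tau> v* \<alpha> k 3
    + D 0 \<tau> v* \<beta> k 1 + D 1 \<tau> v* \<beta> k 2 + D 2 \<tau> v* \<beta> k 3" for k \<tau>
  define N where "N \<tau> y = (\<integral>\<xi>. W 3 (\<tau>, \<xi>) v* R0_kernel x0 x1 \<alpha> \<beta> \<xi> y \<partial>lborel)" for \<tau> y
  have supp: "W j (\<tau>, \<xi>) = 0" if "j \<le> 3" "\<xi> \<notin> {x0<..<x1}" for j \<tau> \<xi>
    using that by (intro W(2)) (auto simp: rect_def)
  have tr: "AE \<tau> in lborel. \<tau> \<in> {t0<..<t1} \<longrightarrow> trace_x p t0 t1 x0 x1 e (wd p ?G 1 j u) \<tau>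
      = C j \<tau> + (LINT \<xi>:{x0..e}|lborel. W (Suc j) (\<tau>, \<xi>))" if j: "j \<le> 2" and e: "e \<in> {x0..x1}" for j e
  proof (rule trace_x_eq_primitive[OF p x e])
    show "AE z in lborel. z \<in> {t0<..<t1} \<times> {x0<..<x1} \<longrightarrow> wd p ?G 1 j u z = W j z"
      using W(3)[of j] j by (auto simp: rect_def)
    show "W j \<in> borel_measurable borel" "C j \<in> borel_measurable borel"
      using W(1)[of j] C(1)[of j] j by auto
  qed (use j W C in \<open>auto simp: rect_def\<close>)
  have lk_eq: "AE \<tau> in lborel. \<tau> \<in> {t0<..<t1} \<longrightarrow> (\<forall>k. lk p t0 t1 x0 x1 \<alpha> \<beta> k u \<tau> = M k \<tau>)"
  proof -
    have e: "x0 \<in> {x0..x1}" "x1 \<in> {x0..x1}" using x by auto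
    have j: "(0::nat) \<le> 2" "(1::nat) \<le> 2" "(2::nat) \<le> 2" by auto
    show ?thesis
      using tr[OF j(1) e(1)] tr[OF j(2) e(1)] tr[OF j(3) e(1)] tr[OF j(1) e(2)] tr[OF j(2) e(2)] tr[OF j(3) e(2)]
      by eventually_elim (simp add: set_lebesgue_integral_singleton lk_def Let_def M_def D_def)
  qed
  \<comment> \<open>The left side is the primitive rather than \<open>W 0\<close>, hence defined for
    every y: one exceptional set of times serves all y.\<close>
  have rep: "AE \<tau> in lborel. \<tau> \<in> {t0<..<t1} \<longrightarrow> (\<forall>y\<in>{x0<..<x1}.
      C 0 \<tau> + (LINT \<xi>:{x0..y}|lborel. W 1 (\<tau>, \<xi>)) = (\<Sum>k\<in>{1,2,3}. M k \<tau> v* ?b k y) + N \<tau> y)"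
  proof -
    have j: "(1::nat) \<le> 2" "(2::nat) \<le> 2" "(1::nat) \<le> 3" "(2::nat) \<le> 3" "(3::nat) \<le> 3" by auto
    show ?thesis
      using lborel_AE_integrable_fst[OF W(1)[OF j(3)]] lborel_AE_integrable_fst[OF W(1)[OF j(4)]]
        lborel_AE_integrable_fst[OF W(1)[OF j(5)]] AE_lborel_pair[OF C(2)[OF j(1)]] AE_lborel_pair[OF C(2)[OF j(2)]]
    proof eventually_elim
      case (elim \<tau>)
      show ?case
      proof (intro impI ballI)
        fix y assume \<tau>: "\<tau> \<in> {t0<..<t1}" and y: "y \<in> {x0<..<x1}"
        have 1: "AE y in lborel. y \<in> {x0<..<x1} \<longrightarrow> W 1 (\<tau>, y) = C 1 \<tau> + (LINT \<xi>:{x0..y}|lborel. W 2 (\<tau>, \<xi>))"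
          and 2: "AE y in lborel. y \<in> {x0<..<x1} \<longrightarrow> W 2 (\<tau>, y) = C 2 \<tau> + (LINT \<xi>:{x0..y}|lborel. W 3 (\<tau>, \<xi>))"
          using elim(4,5) \<tau> by (simp_all add: rect_def numeral_2_eq_2 numeral_3_eq_3)
        note T = taylor_of_primitives[OF elim(1-3) 1 2]
        have ends: "y \<in> {x0..x1}" "x1 \<in> {x0..x1}" using y by auto
        have "C 0 \<tau> + ((y - x0) *\<^sub>R C 1 \<tau> + ((y - x0)\<^sup>2 / 2) *\<^sub>R C 2 \<tau>
            + (LINT \<xi>:{x0..y}|lborel. ((y - \<xi>)\<^sup>2 / 2) *\<^sub>R W 3 (\<tau>, \<xi>)))
          = (\<Sum>k\<in>{1,2,3}. M k \<tau> v* ?b k y) + N \<tau> y"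
          unfolding M_def N_def
        proof (rule pointwise_representation[OF assms(4) elim(3) _ y])
          show "D 0 \<tau> = C 0 \<tau> + ((x1 - x0) *\<^sub>R C 1 \<tau> + ((x1 - x0)\<^sup>2 / 2) *\<^sub>R C 2 \<tau>
              + (LINT \<xi>:{x0..x1}|lborel. ((x1 - \<xi>)\<^sup>2 / 2) *\<^sub>R W 3 (\<tau>, \<xi>)))"
            using T(2)[OF ends(2)] by (simp add: D_def)
          show "D 1 \<tau> = C 1 \<tau> + ((x1 - x0) *\<^sub>R C 2 \<tau> + (LINT \<xi>:{x0..x1}|lborel. (x1 - \<xi>) *\<^sub>R W 3 (\<tau>, \<xi>)))"
            using T(1)[OF ends(2)] by (simp add: D_def numeral_2_eq_2)
          show "D 2 \<tau> = C 2 \<tau> + (LINT \<xi>:{x0..x1}|lborel. W 3 (\<tau>, \<xi>))"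
            by (simp add: D_def)
        qed (simp add: supp)
        then show "C 0 \<tau> + (LINT \<xi>:{x0..y}|lborel. W 1 (\<tau>, \<xi>)) = (\<Sum>k\<in>{1,2,3}. M k \<tau> v* ?b k y) + N \<tau> y"
          unfolding T(2)[OF ends(1)] .
      qed
    qed
  qed
  have M: "integrable lborel (M k)" for k
  proof -
    have D: "integrable lborel (D j)" if j: "j \<le> 2" for j
    proof -
      have "(LINT \<xi>:{x0..x1}|lborel. W (Suc j) (\<tau>, \<xi>)) = (\<integral>\<xi>. W (Suc j) (\<tau>, \<xi>) \<partial>lborel)" for \<tau>
        unfolding set_lebesgue_integral_def
      proof (intro Bochner_Integration.integral_cong refl)
        show "indicator {x0..x1} \<xi> *\<^sub>R W (Suc j) (\<tau>, \<xi>) = W (Suc j) (\<tau>, \<xi>)" for \<xi>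
          using supp[of "Suc j" \<xi> \<tau>] j by (cases "\<xi> \<in> {x0..x1}") auto
      qed
      then show ?thesis
        unfolding D_def using C(1)[OF j] lborel_integrable_fst[OF W(1)[of "Suc j"]] j by simp
    qed
    show ?thesis
      unfolding M_def using C(1) D
      by (intro Bochner_Integration.integrable_add integrable_bounded_linear[OF bounded_linear_vector_matrix_mult]) auto
  qed
  have W3: "integrable lborel (W 3)" using W(1) by simp
  have W3_supp: "W 3 z \<noteq> 0 \<Longrightarrow> snd z \<in> {x0..x1}" for z
    using supp[of 3 "snd z" "fst z"] by (cases "snd z \<in> {x0<..<x1}") auto
  have snd_meas: "(snd :: real \<times> real \<Rightarrow> real) \<in> borel_measurable borel"
    unfolding borel_prod[symmetric] by measurable
  have kernel_int: "integrable lborel (\<lambda>w. W 3 w v* R0_kernel x0 x1 \<alpha> \<beta> (snd w) y)" for y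
    by (rule integrable_R0_kernel[OF W3 snd_meas W3_supp])
  have N: "integrable lborel (\<lambda>\<tau>. N \<tau> y)" for y
    using lborel_integrable_fst[OF kernel_int[of y]] by (simp add: N_def)
  have N0: "N \<tau> y = 0" if "\<tau> \<notin> {t0<..<t1}" for \<tau> y
  proof -
    have "W 3 (\<tau>, \<xi>) = 0" for \<xi> using that by (intro W(2)) (auto simp: rect_def)
    then show ?thesis by (simp add: N_def)
  qed
  have si: "set_integrable lborel {a..b} f" if "integrable lborel f" for a b and f :: "real \<Rightarrow> real^'n"
    using integrable_mult_indicator[OF _ that, of "{a..b}"] by (simp add: set_integrable_def)
  \<comment> \<open>All s are handled outside one null set of y, so that
    \<open>AE_lborel_snd\<close> can lift the statement to the plane and s can be taken as
    \<open>fst z\<close>.\<close>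
  have int_W0: "AE y in lborel. y \<in> {x0<..<x1} \<longrightarrow> (\<forall>s\<in>{t0<..<t1}.
      (LINT \<tau>:{t0..s}|lborel. W 0 (\<tau>, y))
        = (\<Sum>k\<in>{1,2,3}. LINT \<tau>:{t0..s}|lborel. M k \<tau> v* ?b k y) + (LINT \<tau>:{t0..s}|lborel. N \<tau> y))"
    using lborel_AE_integrable_snd[OF W(1)[OF le0]] AE_lborel_pair_snd[OF C(2)[OF le0]]
  proof eventually_elim
    case (elim y)
    show ?case
    proof (intro impI ballI)
      fix s assume y: "y \<in> {x0<..<x1}" and s: "s \<in> {t0<..<t1}"
      have Mb: "integrable lborel (\<lambda>\<tau>. M k \<tau> v* ?b k y)" for k
        by (rule integrable_bounded_linear[OF bounded_linear_vector_matrix_mult M])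
      have "(LINT \<tau>:{t0..s}|lborel. W 0 (\<tau>, y))
          = (LINT \<tau>:{t0..s}|lborel. (\<Sum>k\<in>{1,2,3}. M k \<tau> v* ?b k y) + N \<tau> y)"
      proof (rule set_lebesgue_integral_cong_AE)
        show "AE \<tau>\<in>{t0..s} in lborel. W 0 (\<tau>, y) = (\<Sum>k\<in>{1,2,3}. M k \<tau> v* ?b k y) + N \<tau> y"
          using elim(2) rep AE_lborel_singleton[of t0]
        proof eventually_elim
          case (elim \<tau>)
          show ?case
          proof
            assume "\<tau> \<in> {t0..s}"
            then have \<tau>: "\<tau> \<in> {t0<..<t1}" using elim(3) s by auto
            then have "(\<tau>, y) \<in> ?G" using y by (simp add: rect_def)
            with elim(1) have "W 0 (\<tau>, y) = C 0 \<tau> + (LINT \<xi>:{x0..y}|lborel. W 1 (\<tau>, \<xi>))" by simp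
            then show "W 0 (\<tau>, y) = (\<Sum>k\<in>{1,2,3}. M k \<tau> v* ?b k y) + N \<tau> y"
              by (rule trans) (rule elim(2)[rule_format, OF \<tau> y])
          qed
        qed
        show "(\<lambda>\<tau>. (\<Sum>k\<in>{1,2,3}. M k \<tau> v* ?b k y) + N \<tau> y) \<in> borel_measurable lborel"
          using Mb N by (intro borel_measurable_integrable Bochner_Integration.integrable_add
              Bochner_Integration.integrable_sum)
      qed (use elim(1) in auto)
      also have "\<dots> = (LINT \<tau>:{t0..s}|lborel. (\<Sum>k\<in>{1,2,3}. M k \<tau> v* ?b k y)) + (LINT \<tau>:{t0..s}|lborel. N \<tau> y)"
        by (intro set_integral_add si N Bochner_Integration.integrable_sum Mb)
      also have "(LINT \<tau>:{t0..s}|lborel. (\<Sum>k\<in>{1,2,3}. M k \<tau> v* ?b k y))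
          = (\<Sum>k\<in>{1,2,3}. LINT \<tau>:{t0..s}|lborel. M k \<tau> v* ?b k y)"
        using si[OF Mb] unfolding set_lebesgue_integral_def set_integrable_def scaleR_sum_right
        by (intro Bochner_Integration.integral_sum)
      finally show "(LINT \<tau>:{t0..s}|lborel. W 0 (\<tau>, y))
        = (\<Sum>k\<in>{1,2,3}. LINT \<tau>:{t0..s}|lborel. M k \<tau> v* ?b k y) + (LINT \<tau>:{t0..s}|lborel. N \<tau> y)" .
    qed
  qed
  have lk_int: "(LINT \<tau>:{t0..s}|lebesgue. lk p t0 t1 x0 x1 \<alpha> \<beta> k u \<tau> v* ?b k y)
      = (LINT \<tau>:{t0..s}|lborel. M k \<tau> v* ?b k y)" if "s \<in> {t0<..<t1}" for s y k
    unfolding set_lebesgue_integral_def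
  proof (rule lebesgue_integral_eq_lborel)
    have "integrable lborel (\<lambda>\<tau>. M k \<tau> v* ?b k y)"
      by (rule integrable_bounded_linear[OF bounded_linear_vector_matrix_mult M])
    from si[OF this] show "(\<lambda>\<tau>. indicator {t0..s} \<tau> *\<^sub>R (M k \<tau> v* ?b k y)) \<in> borel_measurable borel"
      by (auto simp: set_integrable_def dest: borel_measurable_integrable)
    show "AE \<tau> in lborel. indicator {t0..s} \<tau> *\<^sub>R (M k \<tau> v* ?b k y)
        = indicator {t0..s} \<tau> *\<^sub>R (lk p t0 t1 x0 x1 \<alpha> \<beta> k u \<tau> v* ?b k y)"
      using lk_eq AE_lborel_singleton[of t0]
      by eventually_elim (use that in \<open>auto simp: indicator_def\<close>)
  qed
  \<comment> \<open>After Fubini the Heaviside factor in time stops the integral at s, and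
    \<open>N\<close> vanishes before t0; the integral over the rectangle thus reduces to one over
    [t0, s].\<close>
  have R0_int: "(LINT w:?G|lebesgue. wd p ?G 1 3 u w v* R0 x0 x1 \<alpha> \<beta> w (s, y)) = (LINT \<tau>:{t0..s}|lborel. N \<tau> y)" for s y
  proof -
    define F where "F w = heaviside (s - fst w) *\<^sub>R (W 3 w v* R0_kernel x0 x1 \<alpha> \<beta> (snd w) y)" for w
    have [measurable]: "heaviside \<in> borel_measurable borel" unfolding heaviside_def[abs_def] by measurable
    have "(\<lambda>w::real \<times> real. heaviside (s - fst w)) \<in> borel_measurable borel"
      unfolding borel_prod[symmetric] by measurable
    then have F: "integrable lborel F"
      unfolding F_def[abs_def]
      by (intro integrable_scaleR_bounded[where B = 1] kernel_int) (auto simp: heaviside_def)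
    have "(LINT w:?G|lebesgue. wd p ?G 1 3 u w v* R0 x0 x1 \<alpha> \<beta> w (s, y)) = (\<integral>w. F w \<partial>lborel)"
      unfolding set_lebesgue_integral_def
    proof (rule lebesgue_integral_eq_lborel)
      show "F \<in> borel_measurable borel" using F by auto
      show "AE w in lborel. F w = indicator ?G w *\<^sub>R (wd p ?G 1 3 u w v* R0 x0 x1 \<alpha> \<beta> w (s, y))"
        using W(3)[OF order_refl]
      proof eventually_elim
        case (elim w)
        then show ?case
          using W(2)[OF order_refl, of w]
          by (cases "w \<in> ?G") (simp_all add: F_def R0_eq_kernel vector_scaleR_matrix_ac)
      qed
    qed
    also have "\<dots> = (\<integral>\<tau>. \<integral>\<xi>. F (\<tau>, \<xi>) \<partial>lborel \<partial>lborel)"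
      using lborel_integral_fst[OF F] by simp
    also have "\<dots> = (LINT \<tau>:{t0..s}|lborel. N \<tau> y)"
      unfolding set_lebesgue_integral_def
    proof (intro Bochner_Integration.integral_cong refl)
      fix \<tau>
      have "(\<integral>\<xi>. F (\<tau>, \<xi>) \<partial>lborel) = heaviside (s - \<tau>) *\<^sub>R N \<tau> y"
        by (simp add: F_def N_def)
      then show "(\<integral>\<xi>. F (\<tau>, \<xi>) \<partial>lborel) = indicator {t0..s} \<tau> *\<^sub>R N \<tau> y"
        using N0[of \<tau> y] by (cases "t0 \<le> \<tau>") (auto simp: heaviside_def)
    qed
    finally show ?thesis .
  qed
  have l0_eq: "AE y in lborel. y \<in> {x0<..<x1} \<longrightarrow> l0 p t0 t1 x0 x1 u y = g y"
    unfolding l0_def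
    by (rule trace_t_eq_primitive[OF p t U W(1)[OF le0] W(4)[OF le0] _ g(2)]) (use g(1) in auto)
  show ?thesis
  proof (rule AE_completion)
    show "AE z in lborel. z \<in> ?G \<longrightarrow>
     u z = l0 p t0 t1 x0 x1 u (snd z)
         + (\<Sum>k\<in>{1,2,3}. LINT \<tau>:{t0..fst z}|lebesgue. lk p t0 t1 x0 x1 \<alpha> \<beta> k u \<tau> v* ?b k (snd z))
         + (LINT w:?G|lebesgue. wd p ?G 1 3 u w v* R0 x0 x1 \<alpha> \<beta> w z)"
      using U(2) g(2) AE_lborel_snd[OF l0_eq] AE_lborel_snd[OF int_W0]
    proof eventually_elim
      case (elim z)
      show ?case
      proof
        assume z: "z \<in> ?G"
        then have st: "fst z \<in> {t0<..<t1}" "snd z \<in> {x0<..<x1}" by (auto simp: rect_def)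
        have "u z = g (snd z) + (LINT \<tau>:{t0..fst z}|lborel. W 0 (\<tau>, snd z))"
          using elim(1,2) z by simp
        also have "g (snd z) = l0 p t0 t1 x0 x1 u (snd z)"
          using elim(3) st by simp
        also have "(LINT \<tau>:{t0..fst z}|lborel. W 0 (\<tau>, snd z))
            = (\<Sum>k\<in>{1,2,3}. LINT \<tau>:{t0..fst z}|lborel. M k \<tau> v* ?b k (snd z))
              + (LINT \<tau>:{t0..fst z}|lborel. N \<tau> (snd z))"
          using elim(4) st by blast
        finally show "u z = l0 p t0 t1 x0 x1 u (snd z)
         + (\<Sum>k\<in>{1,2,3}. LINT \<tau>:{t0..fst z}|lebesgue. lk p t0 t1 x0 x1 \<alpha> \<beta> k u \<tau> v* ?b k (snd z))
         + (LINT w:?G|lebesgue. wd p ?G 1 3 u w v* R0 x0 x1 \<alpha> \<beta> w z)"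
          unfolding lk_int[OF st(1)] using R0_int[of "fst z" "snd z"] by (simp add: add.assoc)
      qed
    qed
  qed
qed

end
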